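(* Let $p$ be a prime and $q=p^h$ with $h\in\mathbb{N}$. Let $\mathcal{B}\subseteq\mathbb{Z}_q^n$ be a box with associated polynomials $g_{ij}$ ($j\in[1,n]$, $i\in\mathbb{N}_0$). Let $f\in\mathbb{Z}_q[x_1,\dots,x_n]$ be a nonzero polynomial, let $m\in\mathbb{N}$, and let $V:=\{X\in\mathcal{B}: f(X)\equiv0\pmod{p^m}\}$. Write the Teichm\"uller expansion $f=\sum_{i=0}^\infty p^if_i$ with $f_i=\sum_{j=1}^ra_{ij}X^{u_j}$ ($a_{ij}\in T_q$, $u_1,\dots,u_r\in\mathbb{N}_0^n$). Let $d\in\mathbb{N}$. Suppose that for every $i\in[0,m-1]$, every $j\in[1,r]$, writing $u_j=(\alpha_1,\dots,\alpha_n)$, and every $\beta=(\beta_{tl})\in\mathbb{N}_0^{|u_j|}$ with $i+|\beta|\leq m-1$, we have $$\deg\Big(a_{ij}\prod_{l=1}^n\prod_{t=1}^{\alpha_l}g_{\beta_{tl}l}(X)\Big)\leq dp^{h\lfloor (i+|\beta|)/h\rfloor}.$$ Then $$\mathrm{ord}_q(|V|)\geq\left\lceil\frac{n-\frac{p^m-1}{p-1}d}{p^{m-1}d}\right\rceil^*.$$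
   Context: $\mathbb{N}$ = positive integers, $\mathbb{N}_0=\mathbb{N}\cup\{0\}$, $[a,b]=\{x\in\mathbb{Z}:a\le x\le b\}$, $\lfloor x\rfloor$ is the floor; $X^u=x_1^{d_1}\cdots x_n^{d_n}$ for $u=(d_1,\dots,d_n)$. $\mathbb{Z}_q$ is the ring of integers of the unramified extension of $\mathbb{Q}_p$ of degree $h$ (residue field $\mathbb{F}_q$); $T_q\subset\mathbb{Z}_q$ is the set of Teichm\"uller representatives of $\mathbb{F}_q$ (i.e. $0$ and the $(q-1)$-th roots of unity). A Teichm\"uller polynomial has all coefficients in $T_q$; a polynomial is reduced if its degree in each variable is at most $q-1$. Every $f\in\mathbb{Z}_q[x_1,\dots,x_n]$ has a unique Teichm\"uller expansion $f=\sum_{i\ge0}p^if_i$ with each $f_i$ a Teichm\"uller polynomial. A box is a subset $\mathcal{B}\subseteq\mathbb{Z}_q^n$ with $|\mathcal{B}|=q^n$ whose reduction modulo $p$ is $\mathbb{F}_q^n$. For such $\mathcal{B}$ there are unique reduced Teichm\"uller polynomials $g_{ij}\in\mathbb{Z}_q[x_1,\dots,x_n]$ ($i\in\mathbb{N}$, $j\in[1,n]$) such that every $Y\in\mathcal{B}$ satisfies $Y=\sum_{i\ge0}(g_{i1}(X),\dots,g_{in}(X))p^i$, where $X\in T_q^n$ is the Teichm\"uller lifting of $Y\bmod p$ and by convention $g_{0j}(X)=x_j$; these are the polynomials associated with $\mathcal{B}$. For $\alpha=(\alpha_1,\dots,\alpha_n)\in\mathbb{N}_0^n$ put $|\alpha|=\sum_l\alpha_l$;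 an element $\beta\in\mathbb{N}_0^{|\alpha|}$ is written $\beta=(\beta_{tl})$ with $l\in[1,n]$, $t\in[1,\alpha_l]$, and $|\beta|=\sum_{l,t}\beta_{tl}$. $\deg$ is total degree. $\mathrm{ord}_q$ is the $q$-adic valuation with $\mathrm{ord}_q(q)=1$; $\lceil t\rceil^*$ is the least nonnegative integer $\geq t$. *)

theory Defs
  imports Complex_Main "HOL-Library.Poly_Mapping" "HOL-Library.FuncSet" "HOL-Library.Cardinality"
    "HOL-Library.Extended_Real" "HOL-Computational_Algebra.Primes"
begin

section \<open>Unramified extensions of the field of p-adic numbers\<close>

text \<open>
  A valued field is a type \<open>'k\<close> of class \<^class>\<open>field_char_0\<close> with a real absolute value
  \<open>v\<close>; convergence always refers to \<open>v\<close>. The field of p-adic numbers is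
  the closure of the rationals in \<open>'k\<close>. In the locale below, \<open>v\<close> extends the p-adic absolute
  value and Cauchy sequences of rationals converge, so this closure is the completion
  of the rationals.
\<close>

definition vlim :: "('k::field_char_0 \<Rightarrow> real) \<Rightarrow> (nat \<Rightarrow> 'k) \<Rightarrow> 'k \<Rightarrow> bool" where
  "vlim v s x \<longleftrightarrow> (\<lambda>k. v (s k - x)) \<longlonglongrightarrow> 0"

definition vsums :: "('k::field_char_0 \<Rightarrow> real) \<Rightarrow> (nat \<Rightarrow> 'k) \<Rightarrow> 'k \<Rightarrow> bool" where
  "vsums v s x \<longleftrightarrow> vlim v (\<lambda>N. \<Sum>i<N. s i) x"

definition vCauchy :: "('k::field_char_0 \<Rightarrow> real) \<Rightarrow> (nat \<Rightarrow> 'k) \<Rightarrow> bool" where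
  "vCauchy v s \<longleftrightarrow> (\<forall>e>0. \<exists>M. \<forall>k\<ge>M. \<forall>l\<ge>M. v (s k - s l) < e)"

definition Qp :: "('k::field_char_0 \<Rightarrow> real) \<Rightarrow> 'k set" where
  "Qp v = {x. \<exists>s :: nat \<Rightarrow> rat. vlim v (\<lambda>k. of_rat (s k)) x}"

definition val_ring :: "('k::field_char_0 \<Rightarrow> real) \<Rightarrow> 'k set" where
  "val_ring v = {x. v x \<le> 1}"

definition residue_rel :: "('k::field_char_0 \<Rightarrow> real) \<Rightarrow> ('k \<times> 'k) set" where
  "residue_rel v = {(x, y). x \<in> val_ring v \<and> y \<in> val_ring v \<and> v (x - y) < 1}"

definition is_basis_over :: "'k::field set \<Rightarrow> nat \<Rightarrow> (nat \<Rightarrow> 'k) \<Rightarrow> bool" where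
  "is_basis_over F h b \<longleftrightarrow>
     (\<forall>x. \<exists>!c. c \<in> {..<h} \<rightarrow>\<^sub>E F \<and> x = (\<Sum>i<h. c i * b i))"

text \<open>
  Unramified of degree \<open>h\<close>: both the field degree and the residue field degree are \<open>h\<close>.
  The integers \<open>val_ring v\<close> then form the ring written \<open>Z_q\<close> with \<open>q = p ^ h\<close>.
\<close>

locale unramified_extension =
  fixes p h :: nat and v :: "'k::field_char_0 \<Rightarrow> real"
  assumes prime_p: "prime p"
    and h_pos: "h \<ge> 1"
    and v_nonneg: "v x \<ge> 0"
    and v_eq_0: "v x = 0 \<longleftrightarrow> x = 0"
    and v_mult: "v (x * y) = v x * v y"
    and v_ultrametric: "v (x + y) \<le> max (v x) (v y)"
    and v_padic: "z \<noteq> 0 \<Longrightarrow> v (of_int z) = (1 / real p) ^ multiplicity (int p) z"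
    and Qp_complete: "vCauchy v (\<lambda>k. of_rat (s k)) \<Longrightarrow> \<exists>x. vlim v (\<lambda>k. of_rat (s k)) x"
    and degree_h: "\<exists>b. is_basis_over (Qp v) h b"
    and residue_field_card: "card (val_ring v // residue_rel v) = p ^ h"

definition cong_pow :: "nat \<Rightarrow> ('k::field_char_0 \<Rightarrow> real) \<Rightarrow> nat \<Rightarrow> 'k \<Rightarrow> 'k \<Rightarrow> bool" where
  "cong_pow p v m x y \<longleftrightarrow> (\<exists>z\<in>val_ring v. x - y = of_nat p ^ m * z)"

definition Teich :: "nat \<Rightarrow> nat \<Rightarrow> ('k::field_char_0 \<Rightarrow> real) \<Rightarrow> 'k set" where
  "Teich p h v = {x \<in> val_ring v. x = 0 \<or> x ^ (p ^ h - 1) = 1}"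

section \<open>Polynomials\<close>

text \<open>The variables are indexed by a finite type \<open>'n\<close>; the number of variables is \<open>CARD('n)\<close>.\<close>

type_synonym ('n, 'k) mpol = "('n \<Rightarrow>\<^sub>0 nat) \<Rightarrow>\<^sub>0 'k"

definition coeffs_in :: "'k::zero set \<Rightarrow> ('n, 'k) mpol \<Rightarrow> bool" where
  "coeffs_in A P \<longleftrightarrow> (\<forall>u. Poly_Mapping.lookup P u \<in> A)"

definition pvar :: "'n \<Rightarrow> ('n, 'k::comm_ring_1) mpol" where
  "pvar l = Poly_Mapping.single (Poly_Mapping.single l 1) 1"

definition peval :: "('n::finite, 'k::comm_ring_1) mpol \<Rightarrow> ('n \<Rightarrow> 'k) \<Rightarrow> 'k" where
  "peval P X = (\<Sum>u\<in>Poly_Mapping.keys P.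
      Poly_Mapping.lookup P u * (\<Prod>l\<in>UNIV. X l ^ Poly_Mapping.lookup u l))"

text \<open>The zero polynomial is given degree 0; only upper bounds by natural numbers are used.\<close>

definition total_deg :: "('n::finite, 'k::zero) mpol \<Rightarrow> nat" where
  "total_deg P = (if P = 0 then 0 else
      Max ((\<lambda>u. \<Sum>l\<in>UNIV. Poly_Mapping.lookup u l) ` Poly_Mapping.keys P))"

definition reduced :: "nat \<Rightarrow> ('n, 'k::zero) mpol \<Rightarrow> bool" where
  "reduced q P \<longleftrightarrow> (\<forall>u\<in>Poly_Mapping.keys P. \<forall>l. Poly_Mapping.lookup u l \<le> q - 1)"

text \<open>The series of polynomials is understood coefficientwise.\<close>

definition Teich_expansion ::
  "nat \<Rightarrow> nat \<Rightarrow> ('k::field_char_0 \<Rightarrow> real) \<Rightarrow> ('n, 'k) mpol \<Rightarrow> (nat \<Rightarrow> ('n, 'k) mpol) \<Rightarrow> bool"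
where
  "Teich_expansion p h v f F \<longleftrightarrow>
     (\<forall>i. coeffs_in (Teich p h v) (F i)) \<and>
     (\<forall>u. vsums v (\<lambda>i. of_nat p ^ i * Poly_Mapping.lookup (F i) u) (Poly_Mapping.lookup f u))"

section \<open>Boxes and their associated polynomials\<close>

definition is_box ::
  "nat \<Rightarrow> nat \<Rightarrow> ('k::field_char_0 \<Rightarrow> real) \<Rightarrow> ('n::finite \<Rightarrow> 'k) set \<Rightarrow> bool" where
  "is_box p h v B \<longleftrightarrow>
     (\<forall>Y\<in>B. \<forall>l. Y l \<in> val_ring v) \<and>
     card B = (p ^ h) ^ CARD('n) \<and>
     (\<forall>X. (\<forall>l. X l \<in> val_ring v) \<longrightarrow> (\<exists>Y\<in>B. \<forall>l. cong_pow p v 1 (Y l) (X l)))"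

definition associated_polys ::
  "nat \<Rightarrow> nat \<Rightarrow> ('k::field_char_0 \<Rightarrow> real) \<Rightarrow> ('n::finite \<Rightarrow> 'k) set
    \<Rightarrow> (nat \<Rightarrow> 'n \<Rightarrow> ('n, 'k) mpol) \<Rightarrow> bool" where
  "associated_polys p h v B g \<longleftrightarrow>
     (\<forall>l. g 0 l = pvar l) \<and>
     (\<forall>i\<ge>1. \<forall>l. coeffs_in (Teich p h v) (g i l) \<and> reduced (p ^ h) (g i l)) \<and>
     (\<forall>Y\<in>B. \<forall>X. (\<forall>l. X l \<in> Teich p h v \<and> cong_pow p v 1 (X l) (Y l)) \<longrightarrow>
        (\<forall>l. vsums v (\<lambda>i. peval (g i l) X * of_nat p ^ i) (Y l)))"

section \<open>The quantities in the estimate\<close>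

text \<open>The valuation \<open>ord_q\<close> with \<open>q = p ^ h\<close>, normalised by \<open>ord_q q = 1\<close>, on
  natural numbers.\<close>

definition ordq :: "nat \<Rightarrow> nat \<Rightarrow> nat \<Rightarrow> ereal" where
  "ordq p h N = (if N = 0 then \<infinity> else ereal (real (multiplicity p N) / real h))"

definition ceil_star :: "real \<Rightarrow> nat" where
  "ceil_star t = (LEAST k::nat. t \<le> real k)"

end

theory Submission
  imports Defs "HOL-Computational_Algebra.Polynomial" "HOL-Number_Theory.Cong"
begin

text \<open>
  Parametrise the box by \<open>X\<close> in \<open>T ^ n\<close>, where \<open>T\<close> is the set of Teichmueller representatives. Modulo
  \<open>p ^ m\<close>, the value of \<open>f\<close> becomes a sum over \<open>s < m\<close> of \<open>p ^ s\<close> times Teichmueller monomials in \<open>X\<close>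
  which, after raising to the power \<open>p ^ s\<close>, have degree at most \<open>d * p ^ s\<close>. If the part with \<open>s = 0\<close> is
  divisible by \<open>p\<close>, the multinomial theorem for the sum of the \<open>p ^ N\<close>-th roots of its monomials turns it
  into terms of the same shape with \<open>s > 0\<close>. Iterating, divisibility by \<open>p ^ m\<close> becomes a
  system of \<open>m\<close> equations over the residue field whose degrees are \<open>d, d * p, \<dots>, d * p ^ (m - 1)\<close>, and
  the bound is that of the Ax-Katz theorem for this system.

  For the latter, the indicator function of \<open>p\<close> dividing a sum of elements of \<open>T\<close> is expanded as a
  polynomial in the summands. Its coefficients are Jacobi sums, whose divisibility by \<open>p\<close> is bounded below by
  Stickelberger's digit count. A monomial contributes to the sum over \<open>T ^ n\<close> only if all its
  exponents are divisible by \<open>q - 1\<close>. This condition is invariant under the Frobenius twists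
  \<open>u \<mapsto> p ^ i * u\<close>, and comparing degrees in each of the \<open>h\<close> twists separately gives the divisibility by
  powers of \<open>q\<close>.
\<close>

section \<open>The field: discreteness of the value group\<close>

text \<open>The degree hypothesis is the natural one at level \<open>s = i + |\<beta>|\<close>: on
  \<open>T\<close> the \<open>p ^ s\<close>-th power depends only on \<open>s mod h\<close>, so the
  \<open>p ^ s\<close>-th power of a monomial of degree at most
  \<open>d * p ^ (h * (s div h))\<close> can be rewritten with degree at most
  \<open>d * p ^ s\<close>. Thus each term has formal degree at most \<open>d\<close> once a root of
  order \<open>p ^ s\<close> is taken, and multinomial carries preserve this. The degrees of the
  \<open>m\<close> equations add up to \<open>(p ^ m - 1) / (p - 1) * d\<close>, and the largest is
  \<open>p ^ (m - 1) * d\<close>; these are the two constants of the bound. The indicators of the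
  equations are multiplied. An equation of degree \<open>D'\<close> pays \<open>D'\<close> once, and
  each further factor \<open>p\<close> in a coefficient pays for at most the largest degree. The
  axioms fix the field degree and the residue degree and give completeness for sequences of
  rationals. That the value group is generated by \<open>p\<close>, and that the integers are
  complete, has to be extracted from this by counting dimensions and by passing to
  coordinates.\<close>

lemma homogeneous_system_nontrivial:
  fixes A :: "nat \<Rightarrow> 'j \<Rightarrow> 'a::idom"
  assumes F0: "0 \<in> F" and F1: "1 \<in> F"
    and Fd: "\<And>x y. x \<in> F \<Longrightarrow> y \<in> F \<Longrightarrow> x - y \<in> F"
    and Fm: "\<And>x y. x \<in> F \<Longrightarrow> y \<in> F \<Longrightarrow> x * y \<in> F"
    and "finite S" and "card S > n"
    and "\<And>i j. i < n \<Longrightarrow> j \<in> S \<Longrightarrow> A i j \<in> F"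
  shows "\<exists>c. (\<forall>j\<in>S. c j \<in> F) \<and> (\<exists>j\<in>S. c j \<noteq> 0) \<and> (\<forall>i<n. (\<Sum>j\<in>S. A i j * c j) = 0)"
  using assms(5-)
proof (induction n arbitrary: S A)
  case 0
  then obtain j where "j \<in> S" by fastforce
  then show ?case using F1 by (intro exI[of _ "\<lambda>_. 1"]) auto
next
  case (Suc n)
  show ?case
  proof (cases "\<forall>j\<in>S. A n j = 0")
    case True
    obtain c where c: "\<forall>j\<in>S. c j \<in> F" "\<exists>j\<in>S. c j \<noteq> 0" "\<forall>i<n. (\<Sum>j\<in>S. A i j * c j) = 0"
      using Suc.IH[of S A] Suc.prems by auto
    then show ?thesis using True by (intro exI[of _ c]) (auto simp: less_Suc_eq)
  next
    case False
    then obtain k where k: "k \<in> S" "A n k \<noteq> 0" by auto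
    define S' where "S' = S - {k}"
    have S': "finite S'" "card S' > n" "S = insert k S'" "k \<notin> S'"
      using Suc.prems k by (auto simp: S'_def)
    \<comment> \<open>Elimination without division: the rows are cross-multiplied with the pivot
      \<open>A n k\<close>, which keeps all entries in \<open>F\<close>. The last unknown is then
      read off from row \<open>n\<close>, with the other unknowns scaled by the pivot.\<close>
    define A' where "A' i j = A n k * A i j - A i k * A n j" for i j
    have A': "A' i j \<in> F" if "i < n" "j \<in> S'" for i j
      using that Suc.prems(3) S'(3) k unfolding A'_def by (intro Fd Fm) auto
    obtain c where c: "\<forall>j\<in>S'. c j \<in> F" "\<exists>j\<in>S'. c j \<noteq> 0"
        "\<forall>i<n. (\<Sum>j\<in>S'. A' i j * c j) = 0"
      using Suc.IH[of S' A'] S' A' by auto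
    have sumF: "(\<Sum>j\<in>B. f j) \<in> F" if "\<And>j. j \<in> B \<Longrightarrow> f j \<in> F" for B and f :: "'j \<Rightarrow> 'a"
      using that
    proof (induction B rule: infinite_finite_induct)
      case (insert x B)
      have "f x - (0 - sum f B) \<in> F" using insert by (intro Fd F0) auto
      then show ?case using insert by simp
    qed (auto simp: F0)
    define c' where "c' j = (if j = k then 0 - (\<Sum>j\<in>S'. A n j * c j) else A n k * c j)" for j
    have 1: "\<forall>j\<in>S. c' j \<in> F"
    proof
      fix j assume "j \<in> S"
      show "c' j \<in> F" unfolding c'_def
        using \<open>j \<in> S\<close> c(1) k Suc.prems(3) S'(3) by (auto intro!: Fd F0 Fm sumF simp del: diff_0)
    qed
    have 2: "\<exists>j\<in>S. c' j \<noteq> 0"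
      using c(2) k S' unfolding c'_def by auto
    have s: "(\<Sum>j\<in>S. A i j * c' j) = (\<Sum>j\<in>S'. A' i j * c j)" for i
    proof -
      have "(\<Sum>j\<in>S. A i j * c' j) = A i k * c' k + (\<Sum>j\<in>S'. A i j * c' j)"
        using S' by simp
      also have "(\<Sum>j\<in>S'. A i j * c' j) = (\<Sum>j\<in>S'. A i j * (A n k * c j))"
        using S' by (intro sum.cong) (auto simp: c'_def)
      finally show ?thesis
        by (simp add: c'_def A'_def sum_subtractf sum_distrib_left algebra_simps)
    qed
    have "(\<Sum>j\<in>S. A i j * c' j) = 0" if "i < Suc n" for i
      using that c(3) s by (cases "i = n") (auto simp: A'_def)
    then show ?thesis using 1 2 by blast
  qed
qed

context unramified_extension
begin

abbreviation q :: nat where "q \<equiv> p ^ h"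
abbreviation pinv :: real where "pinv \<equiv> 1 / real p"
abbreviation T :: "'k set" where "T \<equiv> Teich p h v"

section \<open>Elementary properties of the absolute value\<close>

lemma p_gt_1: "p > 1" using prime_p by (rule prime_gt_1_nat)
lemma p_pos [simp]: "p > 0" using p_gt_1 by simp
lemma q_gt_1: "q > 1" using one_less_power[OF p_gt_1, of h] h_pos by simp
lemma p_le_q: "p \<le> q" using p_gt_1 h_pos self_le_power[of p h] by simp

lemma v_0 [simp]: "v 0 = 0" by (simp add: v_eq_0)
lemma v_1 [simp]: "v 1 = 1"
proof -
  have "v 1 * v 1 = v 1" using v_mult[of 1 1] by simp
  then show ?thesis using v_eq_0[of 1] by simp
qed
lemma v_minus [simp]: "v (- x) = v x"
proof -
  have "v (-1) * v (-1) = 1" using v_mult[of "-1" "-1"] by simp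
  then have "v (-1) = 1" using v_nonneg[of "-1"] by (simp add: square_eq_1_iff)
  then show ?thesis using v_mult[of "-1" x] by simp
qed
lemma v_pos: "x \<noteq> 0 \<Longrightarrow> v x > 0"
  using v_nonneg[of x] v_eq_0[of x] by linarith
lemma v_diff_commute: "v (x - y) = v (y - x)"
  using v_minus[of "x - y"] by simp
lemma v_diff: "v (x - y) \<le> max (v x) (v y)"
  using v_ultrametric[of x "- y"] by simp
lemma v_power: "v (x ^ n) = v x ^ n"
  by (induction n) (auto simp: v_mult)
lemma v_prod: "v (prod f A) = (\<Prod>i\<in>A. v (f i))"
  by (induction A rule: infinite_finite_induct) (auto simp: v_mult)
lemma v_inverse: "v (inverse x) = inverse (v x)"
proof (cases "x = 0")
  case False
  then have "v x * v (inverse x) = 1" using v_mult[of x "inverse x"] by simp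
  then show ?thesis by (metis inverse_unique)
qed auto
lemma v_divide: "v (x / y) = v x / v y"
  by (simp add: divide_inverse v_mult v_inverse)
lemma v_add_le: "v x \<le> c \<Longrightarrow> v y \<le> c \<Longrightarrow> v (x + y) \<le> c"
  using v_ultrametric[of x y] by linarith
lemma v_add_less: "v x < c \<Longrightarrow> v y < c \<Longrightarrow> v (x + y) < c"
  using v_ultrametric[of x y] by linarith
lemma v_diff_le: "v x \<le> c \<Longrightarrow> v y \<le> c \<Longrightarrow> v (x - y) \<le> c"
  using v_diff[of x y] by linarith
lemma v_diff_less: "v x < c \<Longrightarrow> v y < c \<Longrightarrow> v (x - y) < c"
  using v_diff[of x y] by linarith
lemma v_sum_le: "(\<And>i. i \<in> A \<Longrightarrow> v (f i) \<le> c) \<Longrightarrow> 0 \<le> c \<Longrightarrow> v (sum f A) \<le> c"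
  by (induction A rule: infinite_finite_induct) (auto intro: v_add_le)
lemma v_sum_less: "(\<And>i. i \<in> A \<Longrightarrow> v (f i) < c) \<Longrightarrow> 0 < c \<Longrightarrow> v (sum f A) < c"
  by (induction A rule: infinite_finite_induct) (auto intro: v_add_less)
lemma v_trans_less: "v (x - y) < c \<Longrightarrow> v (y - z) < c \<Longrightarrow> v (x - z) < c"
  using v_add_less[of "x - y" c "y - z"] by simp
lemma v_trans_le: "v (x - y) \<le> c \<Longrightarrow> v (y - z) \<le> c \<Longrightarrow> v (x - z) \<le> c"
  using v_add_le[of "x - y" c "y - z"] by simp
lemma v_eq_if_less: "v (x - y) < v x \<Longrightarrow> v y = v x"
proof -
  assume a: "v (x - y) < v x"
  have "v y \<le> v x" using v_diff_le[of x "v x" "x - y"] a by simp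
  moreover have "v x \<le> max (v (x - y)) (v y)" using v_ultrametric[of "x - y" y] by simp
  ultimately show ?thesis using a by linarith
qed
lemma v_of_int_le [simp]: "v (of_int z) \<le> 1"
  using v_padic[of z] p_gt_1 by (cases "z = 0") (auto intro!: power_le_one)
lemma v_of_nat_le [simp]: "v (of_nat n) \<le> 1"
  using v_of_int_le[of "int n"] by simp
lemma v_of_nat: "n \<noteq> 0 \<Longrightarrow> v (of_nat n) = pinv ^ multiplicity p n"
proof -
  assume n: "n \<noteq> 0"
  have "v (of_nat n) = pinv ^ multiplicity (int p) (int n)"
    using v_padic[of "int n"] n by simp
  also have "multiplicity (int p) (int n) = multiplicity p n"
  proof (rule multiplicity_eqI)
    show "int p ^ multiplicity p n dvd int n"
      by (simp flip: of_nat_power add: multiplicity_dvd)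
    show "\<not> int p ^ Suc (multiplicity p n) dvd int n"
      using n p_gt_1 power_dvd_iff_le_multiplicity[of n p "Suc (multiplicity p n)"]
      by (subst of_nat_power[symmetric], subst int_dvd_int_iff) auto
  qed
  finally show ?thesis .
qed
lemma v_p [simp]: "v (of_nat p) = pinv"
  using v_of_nat[of p] p_gt_1 multiplicity_self[of p] by simp
lemma inv_p_less_1: "pinv < 1" using p_gt_1 by simp
lemma v_of_int_less_1_iff: "v (of_int z) < 1 \<longleftrightarrow> int p dvd z"
proof (cases "z = 0")
  case False
  have "pinv ^ n < 1 \<longleftrightarrow> n > 0" for n
    using inv_p_less_1 by (subst power_less_one_iff) auto
  then have "v (of_int z) < 1 \<longleftrightarrow> multiplicity (int p) z > 0"
    using v_padic[OF False] by simp
  also have "\<dots> \<longleftrightarrow> int p dvd z"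
    using False prime_p by (simp add: prime_multiplicity_gt_zero_iff)
  finally show ?thesis .
qed auto
lemma v_of_nat_less_1_iff: "v (of_nat n) < 1 \<longleftrightarrow> p dvd n"
  using v_of_int_less_1_iff[of "int n"] by simp
lemma v_of_int_eq_1: "\<not> int p dvd z \<Longrightarrow> v (of_int z) = 1"
  using v_of_int_less_1_iff[of z] v_of_int_le[of z] by linarith
lemma coprime_p_iff: "coprime z (int p) \<longleftrightarrow> \<not> int p dvd z"
proof -
  have "prime (int p)" using prime_p by simp
  then show ?thesis using prime_imp_coprime[of "int p" z] coprime_common_divisor[of z "int p" "int p"] p_gt_1
    by (auto simp: coprime_commute)
qed
lemma v_of_int_dvd: "int p ^ k dvd z \<Longrightarrow> v (of_int z) \<le> pinv ^ k"
  by (auto elim!: dvdE simp: v_mult v_power intro!: mult_left_le)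
lemma v_of_nat_dvd: "p ^ k dvd n \<Longrightarrow> v (of_nat n) \<le> pinv ^ k"
  by (auto elim!: dvdE simp: v_mult v_power intro!: mult_left_le)
lemma inv_p_power_mono: "k \<le> l \<Longrightarrow> pinv ^ l \<le> pinv ^ k"
  using p_gt_1 by (intro power_decreasing) auto
lemma inv_p_pos: "0 < pinv" using p_gt_1 by simp
lemma power_le_1_v: "v x \<le> 1 \<Longrightarrow> v x ^ n \<le> 1"
  using v_nonneg by (intro power_le_one) auto
lemma v_mult_le_1: "v x \<le> 1 \<Longrightarrow> v y \<le> c \<Longrightarrow> v (x * y) \<le> c"
  using v_nonneg[of x] v_nonneg[of y] by (simp add: v_mult) (metis mult_le_one mult_left_le_one_le order_trans)
lemma v_mult_le: "v x \<le> c \<Longrightarrow> v y \<le> d \<Longrightarrow> v (x * y) \<le> c * d"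
  using v_nonneg[of x] v_nonneg[of y] by (simp add: v_mult mult_mono')
lemma v_mult_less_1: "v x \<le> 1 \<Longrightarrow> v y < 1 \<Longrightarrow> v (x * y) < 1"
  using v_mult_le_1[of x y "v y"] by simp
lemma v_mult_less_1': "v x < 1 \<Longrightarrow> v y \<le> 1 \<Longrightarrow> v (x * y) < 1"
  using v_mult_less_1[of y x] by (simp add: mult.commute)
lemma v_mult_le_1': "v x \<le> c \<Longrightarrow> v y \<le> 1 \<Longrightarrow> v (x * y) \<le> c"
  using v_mult_le_1[of y x c] by (simp add: mult.commute)
lemma tiny_zero: "(\<And>k. v x \<le> pinv ^ k) \<Longrightarrow> x = 0"
proof (rule ccontr)
  assume a: "\<And>k. v x \<le> pinv ^ k" and "x \<noteq> 0"
  then have "v x > 0" using v_nonneg[of x] v_eq_0[of x] by linarith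
  then obtain k where "pinv ^ k < v x"
    using real_arch_pow_inv[of "v x" "pinv"] inv_p_less_1 by blast
  then show False using a[of k] by simp
qed

section \<open>Limits and the closure of the rationals\<close>

lemma vlim_iff: "vlim v s x \<longleftrightarrow> (\<forall>e>0. \<exists>N. \<forall>k\<ge>N. v (s k - x) < e)"
  unfolding vlim_def lim_sequentially dist_real_def by (simp add: v_nonneg)

lemma vlimD: "vlim v s x \<Longrightarrow> e > 0 \<Longrightarrow> \<exists>N. \<forall>k\<ge>N. v (s k - x) < e"
  unfolding vlim_iff by blast

lemma vlimI: "(\<And>e. e > 0 \<Longrightarrow> \<exists>N. \<forall>k\<ge>N. v (s k - x) < e) \<Longrightarrow> vlim v s x"
  unfolding vlim_iff by blast

lemma vlim_diff:
  assumes "vlim v s x" "vlim v t y" shows "vlim v (\<lambda>k. s k - t k) (x - y)"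
proof (rule vlimI)
  fix e :: real assume e: "e > 0"
  obtain N where N: "\<forall>k\<ge>N. v (s k - x) < e" using vlimD[OF assms(1) e] by blast
  obtain M where M: "\<forall>k\<ge>M. v (t k - y) < e" using vlimD[OF assms(2) e] by blast
  have "v (s k - t k - (x - y)) < e" if "k \<ge> max N M" for k
    using v_diff_less[of "s k - x" e "t k - y"] N M that by (simp add: algebra_simps)
  then show "\<exists>N. \<forall>k\<ge>N. v (s k - t k - (x - y)) < e" by blast
qed

lemma vlim_mult:
  assumes "vlim v s x" "vlim v t y" shows "vlim v (\<lambda>k. s k * t k) (x * y)"
proof (rule vlimI)
  fix e :: real assume e: "e > 0"
  define C where "C = max 1 (max (v x) (v y))"
  have C: "C > 0" "v x \<le> C" "v y \<le> C" "C \<ge> 1" by (auto simp: C_def)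
  obtain N where N: "\<forall>k\<ge>N. v (s k - x) < min 1 (e / C)" using vlimD[OF assms(1), of "min 1 (e / C)"] e C by auto
  obtain M where M: "\<forall>k\<ge>M. v (t k - y) < e / C" using vlimD[OF assms(2), of "e / C"] e C by auto
  show "\<exists>N. \<forall>k\<ge>N. v (s k * t k - x * y) < e"
  proof (intro exI allI impI)
    fix k assume k: "k \<ge> max N M"
    have s: "v (s k) \<le> C" using v_add_le[of "s k - x" C x] N[rule_format, of k] k C by simp
    have "v (s k * (t k - y)) \<le> C * v (t k - y)" using s by (simp add: v_mult mult_right_mono v_nonneg)
    also have "\<dots> < e" using M[rule_format, of k] k C by (simp add: field_simps)
    finally have 1: "v (s k * (t k - y)) < e" .
    have "v ((s k - x) * y) \<le> v (s k - x) * C" using C by (simp add: v_mult mult_left_mono v_nonneg)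
    also have "\<dots> < e" using N[rule_format, of k] k C by (simp add: field_simps)
    finally have 2: "v ((s k - x) * y) < e" .
    show "v (s k * t k - x * y) < e" using v_add_less[OF 1 2] by (simp add: algebra_simps)
  qed
qed

lemma Qp_of_rat: "of_rat r \<in> Qp v"
  unfolding Qp_def vlim_def by (auto intro!: exI[of _ "\<lambda>_. r"])
lemma QpI: "vlim v (\<lambda>k. of_rat (s k)) x \<Longrightarrow> x \<in> Qp v"
  unfolding Qp_def by (intro CollectI exI)
lemma Qp_diff:
  assumes "x \<in> Qp v" "y \<in> Qp v" shows "x - y \<in> Qp v"
proof -
  obtain s t where "vlim v (\<lambda>k. of_rat (s k)) x" "vlim v (\<lambda>k. of_rat (t k)) y"
    using assms unfolding Qp_def by blast
  then have "vlim v (\<lambda>k. of_rat (s k - t k)) (x - y)" using vlim_diff by (simp add: of_rat_diff)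
  then show ?thesis by (rule QpI)
qed
lemma Qp_mult:
  assumes "x \<in> Qp v" "y \<in> Qp v" shows "x * y \<in> Qp v"
proof -
  obtain s t where "vlim v (\<lambda>k. of_rat (s k)) x" "vlim v (\<lambda>k. of_rat (t k)) y"
    using assms unfolding Qp_def by blast
  then have "vlim v (\<lambda>k. of_rat (s k * t k)) (x * y)" using vlim_mult by (simp add: of_rat_mult)
  then show ?thesis by (rule QpI)
qed
lemma Qp_0: "0 \<in> Qp v" using Qp_of_rat[of 0] by simp
lemma Qp_1: "1 \<in> Qp v" using Qp_of_rat[of 1] by simp

lemma Qp_approx:
  assumes "x \<in> Qp v" "e > 0" shows "\<exists>r. v (x - of_rat r) < e"
proof -
  obtain s where "vlim v (\<lambda>k. of_rat (s k)) x" using assms(1) unfolding Qp_def by blast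
  then obtain N where "\<forall>k\<ge>N. v (of_rat (s k) - x) < e" using vlimD[of _ x e] assms(2) by blast
  then show ?thesis using v_diff_commute by (metis order_refl)
qed

text \<open>The denominator in lowest terms is prime to \<open>p\<close>, so an integer inverts it
  modulo \<open>p ^ k\<close>.\<close>

lemma rat_integral_approx:
  assumes "v (of_rat r) \<le> 1" shows "\<exists>n::int. v (of_rat r - of_int n) \<le> pinv ^ k"
proof -
  obtain a b where ab: "r = Fract a b" "b > 0" "coprime a b" by (rule Rat_cases)
  have r: "of_rat r = (of_int a / of_int b :: 'k)" using ab by (simp add: of_rat_rat)
  have "\<not> int p dvd b"
  proof
    assume d: "int p dvd b"
    have "int p dvd a \<Longrightarrow> False"
      using d coprime_common_divisor[OF ab(3), of "int p"] p_gt_1 by simp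
    then have "v (of_int a) = 1" by (intro v_of_int_eq_1) blast
    moreover have "v (of_int b) < 1" using d v_of_int_less_1_iff by simp
    moreover have "v (of_int b) > 0" using ab(2) by (intro v_pos) simp
    ultimately show False using assms unfolding r by (simp add: v_divide)
  qed
  then have cop: "coprime b (int p ^ k)"
    using coprime_p_iff[of b] by (simp add: coprime_commute)
  then obtain b' where b': "[b * b' = 1] (mod int p ^ k)" using cong_solve_coprime_int by blast
  have vb: "v (of_int b) = 1" using \<open>\<not> int p dvd b\<close> by (rule v_of_int_eq_1)
  have b0: "of_int b \<noteq> (0::'k)" using ab by simp
  have "of_rat r - of_int (a * b') = of_int (a * (1 - b * b')) / (of_int b :: 'k)"
    unfolding r using b0 by (simp add: field_simps)
  then have "v (of_rat r - of_int (a * b')) = v (of_int (a * (1 - b * b')))"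
    by (simp add: v_divide vb)
  also have "\<dots> \<le> pinv ^ k"
  proof (rule v_of_int_dvd)
    have "int p ^ k dvd 1 - b * b'" using b' by (simp add: cong_iff_dvd_diff dvd_diff_commute)
    then show "int p ^ k dvd a * (1 - b * b')" by simp
  qed
  finally show ?thesis by blast
qed

lemma Qp_integral_approx:
  assumes "x \<in> Qp v" "v x \<le> 1" shows "\<exists>n::int. v (x - of_int n) \<le> pinv ^ k"
proof -
  have e: "pinv ^ k > 0" using inv_p_pos by simp
  obtain r where r: "v (x - of_rat r) < pinv ^ k" using Qp_approx[OF assms(1) e] by blast
  also have "\<dots> \<le> 1" using inv_p_power_mono[of 0 k] by simp
  finally have "v (of_rat r) \<le> 1" using v_diff_le[OF assms(2), of "x - of_rat r"] by simp
  then obtain n where "v (of_rat r - of_int n) \<le> pinv ^ k" using rat_integral_approx by blast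
  then have "v (x - of_int n) \<le> pinv ^ k"
    using v_trans_le[of x "of_rat r" _ "of_int n"] less_imp_le[OF r] by blast
  then show ?thesis by blast
qed

section \<open>The residue field\<close>

lemma equiv_residue: "equiv (val_ring v) (residue_rel v)"
proof (intro equivI refl_onI symI transI)
  fix x y z assume "(x, y) \<in> residue_rel v" "(y, z) \<in> residue_rel v"
  then show "(x, z) \<in> residue_rel v" unfolding residue_rel_def using v_trans_less[of x y 1 z] by auto
qed (auto simp: residue_rel_def v_diff_commute)

lemma residue_relD: "(x, y) \<in> residue_rel v \<Longrightarrow> v (x - y) < 1"
  by (simp add: residue_rel_def)

text \<open>A system of representatives replaces the quotient, so that counting can be done with
  elements of the field itself.\<close>

lemma residue_reps: "\<exists>S. S \<subseteq> val_ring v \<and> card S = q \<and> (\<forall>x. v x \<le> 1 \<longrightarrow> (\<exists>!s. s \<in> S \<and> v (x - s) < 1))"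
proof -
  define f where "f C = (SOME x. x \<in> C)" for C :: "'k set"
  let ?Q = "val_ring v // residue_rel v"
  have f: "f C \<in> C" if "C \<in> ?Q" for C
    unfolding f_def using in_quotient_imp_non_empty[OF equiv_residue that] by (simp add: some_in_eq)
  have inj: "inj_on f ?Q"
  proof (rule inj_onI)
    fix C D assume CD: "C \<in> ?Q" "D \<in> ?Q" "f C = f D"
    then have "f C \<in> C \<inter> D" using f[of C] f[of D] by simp
    then show "C = D" using quotient_disj[OF equiv_residue CD(1,2)] by blast
  qed
  have sub: "f ` ?Q \<subseteq> val_ring v" using f in_quotient_imp_subset[OF equiv_residue] by blast
  have ex: "\<exists>!s. s \<in> f ` ?Q \<and> v (x - s) < 1" if x: "v x \<le> 1" for x
  proof -
    have xr: "x \<in> val_ring v" using x by (simp add: val_ring_def)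
    let ?C = "residue_rel v `` {x}"
    have C: "?C \<in> ?Q" using xr by (rule quotientI)
    have "f ?C \<in> ?C" using f C by blast
    then have 1: "v (x - f ?C) < 1" by (intro residue_relD) blast
    have uniq: "s = f ?C" if s: "s \<in> f ` ?Q" "v (x - s) < 1" for s
    proof -
      obtain D where D: "D \<in> ?Q" "s = f D" using s by auto
      have "(x, s) \<in> residue_rel v" using s xr sub by (auto simp: residue_rel_def)
      then have "s \<in> D \<inter> ?C" using f[OF D(1)] D(2) by blast
      then have "D = ?C" using quotient_disj[OF equiv_residue D(1) C] by blast
      then show ?thesis using D by simp
    qed
    show ?thesis
    proof (rule ex1I)
      show "f ?C \<in> f ` ?Q \<and> v (x - f ?C) < 1" using 1 C by (intro conjI imageI)
      show "s = f ?C" if "s \<in> f ` ?Q \<and> v (x - s) < 1" for s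
        using that uniq by (elim conjE)
    qed
  qed
  have "card (f ` ?Q) = q" using card_image[OF inj] residue_field_card by simp
  then show ?thesis using sub ex by (intro exI[of _ "f ` ?Q"] conjI allI impI)
qed

text \<open>Pigeonhole: otherwise \<open>A\<close> would meet every residue class. This supplies a
  vector outside a given span when a basis of the residue field is built.\<close>

lemma residue_classes_bound:
  assumes "finite A" "card A < q" shows "\<exists>x. v x \<le> 1 \<and> (\<forall>a\<in>A. v (x - a) \<ge> 1)"
proof (rule ccontr)
  assume "\<not> ?thesis"
  then have *: "\<And>x. v x \<le> 1 \<Longrightarrow> \<exists>a\<in>A. v (x - a) < 1" by (meson not_le)
  obtain S where S: "S \<subseteq> val_ring v" "card S = q" "\<And>x. v x \<le> 1 \<Longrightarrow> \<exists>!s. s \<in> S \<and> v (x - s) < 1"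
    using residue_reps by blast
  have "\<forall>s\<in>S. \<exists>a. a\<in>A \<and> v (s - a) < 1" using * S(1) unfolding val_ring_def by blast
  then obtain g where g: "\<forall>s\<in>S. g s \<in> A \<and> v (s - g s) < 1" by metis
  have "inj_on g S"
  proof (rule inj_onI)
    fix s t assume st: "s \<in> S" "t \<in> S" "g s = g t"
    have "v (s - t) < 1" using st g v_trans_less[of s "g s" 1 t] v_diff_commute by metis
    moreover have "v s \<le> 1" using S(1) st unfolding val_ring_def by blast
    moreover have "v (s - s) < 1" by simp
    ultimately show "s = t" using S(3)[of s] st by blast
  qed
  then have "card S \<le> card A" using g assms(1) card_inj_on_le by blast
  then show False using S(2) assms(2) by simp
qed

text \<open>The residue field has \<open>p ^ h\<close> elements, hence dimension \<open>h\<close>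
  over its prime field. Independent lifts are chosen greedily, and they span because their
  combinations already fill all \<open>p ^ h\<close> residue classes. Integer coefficients stand for
  elements of the prime field.\<close>

lemma residue_basis:
  "\<exists>b::nat \<Rightarrow> 'k. (\<forall>i<h. v (b i) \<le> 1) \<and>
     (\<forall>n::nat \<Rightarrow> int. v (\<Sum>i<h. of_int (n i) * b i) < 1 \<longrightarrow> (\<forall>i<h. int p dvd n i)) \<and>
     (\<forall>x. v x \<le> 1 \<longrightarrow> (\<exists>n::nat \<Rightarrow> int. v (x - (\<Sum>i<h. of_int (n i) * b i)) < 1))"
proof -
  define indep where "indep k b \<longleftrightarrow> (\<forall>i<k. v (b i) \<le> 1) \<and>
     (\<forall>n::nat \<Rightarrow> int. v (\<Sum>i<k. of_int (n i) * b i) < 1 \<longrightarrow> (\<forall>i<k. int p dvd n i))" for k and b :: "nat \<Rightarrow> 'k"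
  define C where "C k = {..<k} \<rightarrow>\<^sub>E {0..<int p}" for k :: nat
  define comb where "comb k b n = (\<Sum>i<k. of_int (n i) * b i)" for k and b :: "nat \<Rightarrow> 'k" and n :: "nat \<Rightarrow> int"
  have finC: "finite (C k)" for k unfolding C_def by (intro finite_PiE) auto
  have cardC: "card (C k) = p ^ k" for k unfolding C_def by (simp add: card_PiE)
  have vcomb: "v (comb k b n) \<le> 1" if "\<forall>i<k. v (b i) \<le> 1" for k b n
    unfolding comb_def using that by (intro v_sum_le v_mult_le_1) auto
  have red: "\<exists>n'\<in>C k. v (comb k b n - comb k b n') < 1" if b: "\<forall>i<k. v (b i) \<le> 1" for k b n
  proof -
    define n' where "n' = restrict (\<lambda>i. n i mod int p) {..<k}"
    have "n' \<in> C k" unfolding C_def n'_def using p_gt_1 by auto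
    moreover have "comb k b n - comb k b n' = (\<Sum>i<k. of_int (n i - n i mod int p) * b i)"
      unfolding comb_def n'_def sum_subtractf[symmetric] by (intro sum.cong) (auto simp: algebra_simps)
    moreover have "v \<dots> < 1"
    proof (intro v_sum_less)
      fix i assume "i \<in> {..<k}"
      have "v (of_int (n i - n i mod int p)) < 1" unfolding v_of_int_less_1_iff
        by (simp add: minus_mod_eq_mult_div)
      then show "v (of_int (n i - n i mod int p) * b i) < 1"
        using b \<open>i \<in> {..<k}\<close> v_mult_less_1[of "b i" "of_int (n i - n i mod int p)"]
        by (simp only: mult.commute lessThan_iff)
    qed auto
    ultimately show ?thesis by metis
  qed
  have ex: "\<exists>b. indep k b" if "k \<le> h" for k
    using that
  proof (induction k)
    case 0 then show ?case by (auto simp: indep_def)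
  next
    case (Suc k)
    then obtain b where b: "indep k b" by auto
    have b1: "\<forall>i<k. v (b i) \<le> 1" using b by (simp add: indep_def)
    have "card (comb k b ` C k) < q"
      using card_image_le[OF finC, of "comb k b" k] cardC[of k] Suc.prems p_gt_1
      by (metis le_neq_implies_less less_le_trans linorder_not_less not_less_eq_eq power_strict_increasing_iff Suc_le_lessD)
    then obtain x where x: "v x \<le> 1" "\<forall>n\<in>C k. v (x - comb k b n) \<ge> 1"
      using residue_classes_bound[of "comb k b ` C k"] finC by auto
    have x': "v (x - comb k b n) \<ge> 1" for n
    proof (rule ccontr)
      assume a: "\<not> v (x - comb k b n) \<ge> 1"
      obtain n' where "n' \<in> C k" "v (comb k b n - comb k b n') < 1" using red[OF b1] by blast
      then show False using x(2) a v_trans_less[of x "comb k b n" 1 "comb k b n'"] by fastforce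
    qed
    define b' where "b' = b(k := x)"
    have comb': "(\<Sum>i<Suc k. of_int (n i) * b' i) = comb k b n + of_int (n k) * x" for n
      unfolding comb_def b'_def by simp
    have "indep (Suc k) b'" unfolding indep_def
    proof (intro conjI allI impI)
      fix i assume "i < Suc k" then show "v (b' i) \<le> 1" using b1 x by (auto simp: b'_def less_Suc_eq)
    next
      fix n :: "nat \<Rightarrow> int" and i assume a: "v (\<Sum>i<Suc k. of_int (n i) * b' i) < 1" and i: "i < Suc k"
      \<comment> \<open>A coefficient prime to \<open>p\<close> could be inverted modulo
        \<open>p\<close>, which would place \<open>x\<close> in the span of the earlier
        lifts.\<close>
      have nk: "int p dvd n k"
      proof (rule ccontr)
        assume "\<not> int p dvd n k"
        then have "coprime (n k) (int p)"
          using coprime_p_iff[of "n k"] by simp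
        then obtain e where e: "[n k * e = 1] (mod int p)" using cong_solve_coprime_int by blast
        have "v (of_int e * (comb k b n + of_int (n k) * x)) < 1"
          using a unfolding comb' by (intro v_mult_less_1) auto
        moreover have "v (of_int (1 - n k * e) * x) < 1"
        proof -
          have "int p dvd 1 - n k * e" using e by (simp add: cong_iff_dvd_diff dvd_diff_commute)
          then have "v (of_int (1 - n k * e)) < 1" by (simp only: v_of_int_less_1_iff)
          then show ?thesis using x(1) by (rule v_mult_less_1')
        qed
        ultimately have "v (of_int e * (comb k b n + of_int (n k) * x) + of_int (1 - n k * e) * x) < 1"
          by (rule v_add_less)
        also have "of_int e * (comb k b n + of_int (n k) * x) + of_int (1 - n k * e) * x
            = x - comb k b (\<lambda>i. - e * n i)"
          unfolding comb_def by (simp add: sum_distrib_left sum_negf algebra_simps)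
        finally show False using x' by (metis linorder_not_le)
      qed
      then have "v (of_int (n k) * x) < 1" using x(1) by (intro v_mult_less_1') (simp_all only: v_of_int_less_1_iff)
      then have "v (comb k b n) < 1" using a unfolding comb' using v_diff_less by fastforce
      then show "int p dvd n i" using b nk i unfolding indep_def comb_def by (cases "i = k") auto
    qed
    then show ?case by blast
  qed
  obtain b where b: "indep h b" using ex[of h] by auto
  have b1: "\<forall>i<h. v (b i) \<le> 1" using b by (simp add: indep_def)
  have sp: "\<exists>n. v (x - (\<Sum>i<h. of_int (n i) * b i)) < 1" if x: "v x \<le> 1" for x
  proof (rule ccontr)
    assume no: "\<not> ?thesis"
    then have no': "v (x - comb h b n) \<ge> 1" for n unfolding comb_def by (meson linorder_not_le)
    have inj: "n = n'" if n: "n \<in> C h" "n' \<in> C h" "v (comb h b n - comb h b n') < 1" for n n'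
    proof -
      have "comb h b n - comb h b n' = (\<Sum>i<h. of_int (n i - n' i) * b i)"
        unfolding comb_def by (simp add: sum_subtractf algebra_simps)
      then have d: "\<forall>i<h. int p dvd n i - n' i" using n(3) b unfolding indep_def by metis
      show "n = n'"
      proof (rule PiE_ext)
        show "n \<in> {..<h} \<rightarrow>\<^sub>E {0..<int p}" "n' \<in> {..<h} \<rightarrow>\<^sub>E {0..<int p}" using n by (auto simp: C_def)
        fix i assume "i \<in> {..<h}"
        then have "int p dvd n i - n' i" "n i \<in> {0..<int p}" "n' i \<in> {0..<int p}" using d n by (auto simp: C_def)
        then show "n i = n' i" by (metis atLeastLessThan_iff mod_eq_dvd_iff mod_pos_pos_trivial)
      qed
    qed
    obtain S where S: "S \<subseteq> val_ring v" "card S = q" "\<And>x. v x \<le> 1 \<Longrightarrow> \<exists>!s. s \<in> S \<and> v (x - s) < 1"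
      using residue_reps by blast
    have finS: "finite S" using S(2) p_gt_1 by (intro card_ge_0_finite) simp
    define g where "g y = (THE s. s \<in> S \<and> v (y - s) < 1)" for y
    have g: "g y \<in> S" "v (y - g y) < 1" if "v y \<le> 1" for y
      using theI'[OF S(3)[OF that]] unfolding g_def by auto
    \<comment> \<open>The \<open>p ^ h\<close> combinations lie in distinct classes, so their
      representatives exhaust \<open>S\<close> and the class of \<open>x\<close> is among
      them.\<close>
    have "inj_on (g \<circ> comb h b) (C h)"
    proof (rule inj_onI)
      fix n n' assume n: "n \<in> C h" "n' \<in> C h" "(g \<circ> comb h b) n = (g \<circ> comb h b) n'"
      have "v (comb h b n - g (comb h b n)) < 1" "v (comb h b n' - g (comb h b n')) < 1" using g vcomb b1 by auto
      then have "v (comb h b n - comb h b n') < 1" using n(3) v_trans_less[of _ "g (comb h b n)" 1 "comb h b n'"]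
        v_diff_commute by (metis comp_apply)
      then show "n = n'" using inj n by blast
    qed
    then have c: "card ((g \<circ> comb h b) ` C h) = q" using cardC card_image by metis
    have "(g \<circ> comb h b) ` C h \<subseteq> S" using g vcomb b1 by auto
    then have "(g \<circ> comb h b) ` C h = S" using c S(2) finS by (intro card_subset_eq) auto
    then obtain n where n: "n \<in> C h" "g x = g (comb h b n)" using g(1)[OF x] by auto
    then have "v (x - comb h b n) < 1" using g(2)[OF x] g(2)[of "comb h b n"] vcomb[OF b1] v_diff_commute v_trans_less by metis
    then show False using no' by (metis linorder_not_le)
  qed
  show ?thesis using b b1 sp unfolding indep_def by blast
qed

text \<open>An element of absolute value strictly between \<open>1 / p\<close> and \<open>1\<close> would be independent over \<open>Qp\<close>
  of a lifted basis of the residue field, which already has \<open>h\<close> elements.\<close>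
lemma discrete:
  assumes "v x < 1" shows "v x \<le> pinv"
proof (rule ccontr)
  assume x: "\<not> v x \<le> pinv"
  obtain b where b: "\<forall>i<h. v (b i) \<le> 1"
    "\<And>n::nat \<Rightarrow> int. v (\<Sum>i<h. of_int (n i) * b i) < 1 \<Longrightarrow> (\<forall>i<h. int p dvd n i)"
    using residue_basis by metis
  obtain e where e: "is_basis_over (Qp v) h e" using degree_h by blast
  \<comment> \<open>These are \<open>h + 1\<close> vectors in a space of dimension \<open>h\<close>
    over \<open>Qp v\<close>, so they satisfy a nontrivial linear relation.\<close>
  define y where "y = b(h := x)"
  have y1: "v (y i) \<le> 1" if "i \<le> h" for i using that b(1) assms by (auto simp: y_def)
  have "\<forall>j. \<exists>c. c \<in> {..<h} \<rightarrow>\<^sub>E Qp v \<and> y j = (\<Sum>i<h. c i * e i)" using e unfolding is_basis_over_def by metis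
  then obtain A where A: "\<And>j. A j \<in> {..<h} \<rightarrow>\<^sub>E Qp v" "\<And>j. y j = (\<Sum>i<h. A j i * e i)" by metis
  have "\<exists>c. (\<forall>j\<in>{..h}. c j \<in> Qp v) \<and> (\<exists>j\<in>{..h}. c j \<noteq> 0) \<and> (\<forall>i<h. (\<Sum>j\<in>{..h}. A j i * c j) = 0)"
  proof (rule homogeneous_system_nontrivial)
    show "A j i \<in> Qp v" if "i < h" for i j using A(1)[of j] that by (auto dest!: PiE_mem)
  qed (use Qp_0 Qp_1 Qp_diff Qp_mult in auto)
  then obtain c where c: "\<And>j. j \<le> h \<Longrightarrow> c j \<in> Qp v" "\<exists>j\<le>h. c j \<noteq> 0" "\<And>i. i < h \<Longrightarrow> (\<Sum>j\<le>h. A j i * c j) = 0"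
    by auto
  have rel: "(\<Sum>j\<le>h. c j * y j) = 0"
  proof -
    have "(\<Sum>j\<le>h. c j * y j) = (\<Sum>j\<le>h. \<Sum>i<h. (A j i * c j) * e i)"
      by (subst A(2)) (simp add: sum_distrib_left algebra_simps)
    also have "\<dots> = (\<Sum>i<h. \<Sum>j\<le>h. (A j i * c j) * e i)" by (rule sum.swap)
    also have "\<dots> = (\<Sum>i<h. (\<Sum>j\<le>h. A j i * c j) * e i)" by (simp add: sum_distrib_right)
    finally show ?thesis using c(3) by simp
  qed
  obtain k where k: "k \<le> h" "\<And>j. j \<le> h \<Longrightarrow> v (c j) \<le> v (c k)"
  proof -
    have "\<exists>k\<in>{..h}. \<forall>j\<in>{..h}. v (c j) \<le> v (c k)"
      using Max_in[of "(\<lambda>j. v (c j)) ` {..h}"] Max_ge[of "(\<lambda>j. v (c j)) ` {..h}"] by fastforce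
    then show ?thesis using that by auto
  qed
  have ck: "v (c k) > 0"
    using c(2) k(2) v_nonneg v_eq_0 by (metis less_eq_real_def order_antisym)
  \<comment> \<open>Dividing by a rational of the same absolute value as the largest coefficient
    makes all coefficients integral and one of them a unit. They remain in \<open>Qp v\<close> and
    can therefore be approximated by integers.\<close>
  obtain r where r: "v (c k - of_rat r) < v (c k)" using Qp_approx c(1) k(1) ck by blast
  have vr: "v (of_rat r) = v (c k)" using v_eq_if_less[OF r] .
  have r0: "of_rat r \<noteq> (0::'k)" using vr ck by auto
  define c' where "c' j = c j * of_rat (inverse r)" for j
  have c'Q: "c' j \<in> Qp v" if "j \<le> h" for j using that c(1) Qp_mult Qp_of_rat by (auto simp: c'_def)
  have vc': "v (c' j) = v (c j) / v (c k)" for j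
    unfolding c'_def of_rat_inverse v_mult v_inverse vr by (simp add: divide_inverse)
  have c'1: "v (c' j) \<le> 1" if "j \<le> h" for j
    using k(2)[OF that] ck by (simp add: vc')
  have c'k: "v (c' k) = 1"
    using ck by (simp add: vc')
  have "\<forall>j. \<exists>n::int. j \<le> h \<longrightarrow> v (c' j - of_int n) \<le> pinv^2" using Qp_integral_approx c'Q c'1 by blast
  then obtain n where n: "\<And>j. j \<le> h \<Longrightarrow> v (c' j - of_int (n j)) \<le> pinv^2" by metis
  have rel': "(\<Sum>j\<le>h. c' j * y j) = 0"
    using rel unfolding c'_def by (simp flip: sum_distrib_right add: mult.assoc mult.commute[of "of_rat _"])
      (simp add: mult.assoc[symmetric] sum_distrib_right[symmetric])
  have "v (\<Sum>j\<le>h. (c' j - of_int (n j)) * y j) \<le> pinv^2"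
    using n y1 v_mult_le_1 by (intro v_sum_le) (auto simp: mult.commute)
  then have "v (\<Sum>j\<le>h. of_int (n j) * y j) \<le> pinv^2"
    using rel' v_minus by (simp add: left_diff_distrib sum_subtractf)
  moreover have "pinv^2 < pinv" using p_gt_1 by (simp add: field_simps power2_eq_square)
  ultimately have s: "v (\<Sum>j\<le>h. of_int (n j) * y j) < pinv" by simp
  have split: "(\<Sum>j\<le>h. of_int (n j) * y j) = (\<Sum>j<h. of_int (n j) * b j) + of_int (n h) * x"
    by (simp add: lessThan_Suc_atMost[symmetric] y_def)
  have "v (of_int (n h) * x) < 1" using assms by (intro v_mult_less_1) auto
  moreover have "v (\<Sum>j\<le>h. of_int (n j) * y j) < 1" using s inv_p_less_1 by linarith
  ultimately have "v (\<Sum>j<h. of_int (n j) * b j) < 1" using split v_diff_less by fastforce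
  then have d: "\<forall>i<h. int p dvd n i" using b(2) by blast
  have nk: "\<not> int p dvd n k"
  proof
    assume "int p dvd n k"
    then have "v (of_int (n k)) < 1" by (simp add: v_of_int_less_1_iff)
    moreover have "v (c' k - of_int (n k)) < 1" using n[OF k(1)] inv_p_less_1 \<open>pinv^2 < pinv\<close> by linarith
    ultimately show False using v_add_less[of "c' k - of_int (n k)" 1 "of_int (n k)"] c'k by simp
  qed
  \<comment> \<open>The coefficients of \<open>b\<close> are divisible by \<open>p\<close>, so the
    unit coefficient belongs to \<open>x\<close>; the relation then bounds \<open>v x\<close> by
    \<open>1 / p\<close>.\<close>
  then have "k = h" using d k(1) by (meson le_neq_implies_less)
  then have "v (of_int (n h)) = 1" using nk v_of_int_eq_1 by simp
  then have vx: "v (of_int (n h) * x) = v x" by (simp add: v_mult)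
  have "v (\<Sum>j<h. of_int (n j) * b j) \<le> pinv"
  proof (intro v_sum_le)
    fix i assume "i \<in> {..<h}"
    then have "v (of_int (n i)) \<le> pinv" using d v_of_int_dvd[of 1 "n i"] by simp
    then show "v (of_int (n i) * b i) \<le> pinv" using b(1) \<open>i \<in> {..<h}\<close> by (intro v_mult_le_1') auto
  qed simp
  then have "v (of_int (n h) * x) \<le> pinv"
    using s split v_diff_le[of "\<Sum>j\<le>h. of_int (n j) * y j" "pinv" "\<Sum>j<h. of_int (n j) * b j"] by simp
  then show False using vx x by simp
qed

section \<open>Completeness and Teichmueller representatives\<close>

lemma discrete_power: "v x < pinv ^ k \<Longrightarrow> v x \<le> pinv ^ Suc k"
proof -
  assume a: "v x < pinv ^ k"
  have "v (x / of_nat p ^ k) < 1" using a p_gt_1 by (simp add: v_divide v_power field_simps)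
  then have "v (x / of_nat p ^ k) \<le> pinv" by (rule discrete)
  then show ?thesis using p_gt_1 by (simp add: v_divide v_power field_simps)
qed

lemma cong_pow_iff: "cong_pow p v k x y \<longleftrightarrow> v (x - y) \<le> pinv ^ k"
proof
  assume "cong_pow p v k x y"
  then show "v (x - y) \<le> pinv ^ k"
    unfolding cong_pow_def val_ring_def by (auto simp: v_mult v_power intro!: mult_left_le)
next
  assume a: "v (x - y) \<le> pinv ^ k"
  have "v ((x - y) / of_nat p ^ k) \<le> 1" using a p_gt_1 by (simp add: v_divide v_power field_simps)
  moreover have "x - y = of_nat p ^ k * ((x - y) / of_nat p ^ k)" using p_gt_1 by simp
  ultimately show "cong_pow p v k x y" unfolding cong_pow_def val_ring_def by blast
qed

lemma telescoping_bound:
  assumes "\<And>N. v (s (Suc N) - s N) \<le> pinv ^ N" shows "v (s (N + d) - s N) \<le> pinv ^ N"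
proof (induction d)
  case (Suc d)
  have "v (s (Suc (N + d)) - s (N + d)) \<le> pinv ^ N"
    using assms[of "N + d"] inv_p_power_mono[of N "N + d"] by linarith
  then show ?case using v_trans_le[OF _ Suc] by simp
qed simp

lemma limit_bound:
  assumes "\<And>N. v (s (Suc N) - s N) \<le> pinv ^ N" "vlim v s x"
  shows "v (s N - x) \<le> pinv ^ N"
proof -
  obtain M where M: "\<forall>k\<ge>M. v (s k - x) < pinv ^ N"
    using vlimD[OF assms(2), of "pinv ^ N"] inv_p_pos by auto
  have "v (s N - s (N + M)) \<le> pinv ^ N" using telescoping_bound[of s N M] assms(1) by (simp add: v_diff_commute)
  moreover have "v (s (N + M) - x) \<le> pinv ^ N" using M by (simp add: less_imp_le)
  ultimately show ?thesis by (rule v_trans_le)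
qed

lemma vCauchy_telescoping:
  assumes "\<And>N. v (s (Suc N) - s N) \<le> pinv ^ N" shows "vCauchy v s"
  unfolding vCauchy_def
proof (intro allI impI)
  fix e :: real assume "e > 0"
  then obtain M where M: "pinv ^ M < e" using real_arch_pow_inv inv_p_less_1 by blast
  have b: "v (s k - s M) \<le> pinv ^ M" if "k \<ge> M" for k
    using telescoping_bound[of s M "k - M"] assms that by simp
  have "v (s k - s l) < e" if "k \<ge> M" "l \<ge> M" for k l
    using v_trans_le[OF b[OF that(1)], of "s l"] b[OF that(2)] M by (simp add: v_diff_commute)
  then show "\<exists>M. \<forall>k\<ge>M. \<forall>l\<ge>M. v (s k - s l) < e" by blast
qed

text \<open>Completeness is available for rational sequences. Each \<open>x N\<close> is
  approximated by an integer combination of a lifted residue basis. As the lifts stay independent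
  modulo every power of \<open>p\<close>, close combinations have close coordinates, so every
  coordinate sequence is Cauchy and converges.\<close>

lemma complete_telescoping:
  assumes x1: "\<And>N. v (x N) \<le> 1" and x: "\<And>N. v (x (Suc N) - x N) \<le> pinv ^ N"
  shows "\<exists>y. \<forall>N. v (x N - y) \<le> pinv ^ N"
proof -
  obtain b where b: "\<forall>i<h. v (b i) \<le> 1"
    "\<And>n::nat \<Rightarrow> int. v (\<Sum>i<h. of_int (n i) * b i) < 1 \<Longrightarrow> (\<forall>i<h. int p dvd n i)"
    "\<And>x. v x \<le> 1 \<Longrightarrow> (\<exists>n::nat \<Rightarrow> int. v (x - (\<Sum>i<h. of_int (n i) * b i)) < 1)"
    using residue_basis by metis
  have digits: "\<exists>n::nat \<Rightarrow> int. v (z - (\<Sum>i<h. of_int (n i) * b i)) \<le> pinv ^ N" if z: "v z \<le> 1" for z N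
  proof (induction N)
    case 0
    show ?case using z by (intro exI[of _ "\<lambda>_. 0"]) simp
  next
    case (Suc N)
    then obtain n :: "nat \<Rightarrow> int" where n: "v (z - (\<Sum>i<h. of_int (n i) * b i)) \<le> pinv ^ N" by blast
    define y where "y = (z - (\<Sum>i<h. of_int (n i) * b i)) / of_nat p ^ N"
    have "v y \<le> 1" using n p_gt_1 by (simp add: y_def v_divide v_power field_simps)
    then obtain n' :: "nat \<Rightarrow> int" where n': "v (y - (\<Sum>i<h. of_int (n' i) * b i)) < 1" using b(3) by blast
    have "of_nat p ^ N * y = z - (\<Sum>i<h. of_int (n i) * b i)" using p_gt_1 by (simp add: y_def)
    then have "z - (\<Sum>i<h. of_int (n i + int p ^ N * n' i) * b i) = of_nat p ^ N * (y - (\<Sum>i<h. of_int (n' i) * b i))"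
      by (simp add: algebra_simps sum.distrib sum_distrib_left)
    moreover have "v \<dots> = pinv ^ N * v (y - (\<Sum>i<h. of_int (n' i) * b i))"
      by (simp only: v_mult v_power v_p)
    moreover have "\<dots> \<le> pinv ^ N * pinv"
      using discrete[OF n'] by (intro mult_left_mono) auto
    ultimately have "v (z - (\<Sum>i<h. of_int (n i + int p ^ N * n' i) * b i)) \<le> pinv ^ Suc N" by simp
    then show ?case by (intro exI[of _ "\<lambda>i. n i + int p ^ N * n' i"])
  qed
  have indep: "\<forall>i<h. int p ^ N dvd n i" if "v (\<Sum>i<h. of_int (n i) * b i) \<le> pinv ^ N" for N and n :: "nat \<Rightarrow> int"
    using that
  proof (induction N arbitrary: n)
    case (Suc N)
    have "pinv ^ Suc N < 1" using inv_p_less_1 p_gt_1 by (intro power_Suc_less_one) auto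
    then have "v (\<Sum>i<h. of_int (n i) * b i) < 1" using Suc.prems by linarith
    then have "\<forall>i<h. int p dvd n i" by (rule b(2))
    then have n: "n i = int p * (n i div int p)" if "i < h" for i using that by simp
    have e: "(\<Sum>i<h. of_int (n i) * b i) = of_nat p * (\<Sum>i<h. of_int (n i div int p) * b i)"
      unfolding sum_distrib_left
    proof (intro sum.cong refl)
      fix i assume "i \<in> {..<h}"
      then have "(of_int (n i) :: 'k) = of_int (int p * (n i div int p))" using n by simp
      then show "of_int (n i) * b i = of_nat p * (of_int (n i div int p) * b i)" by simp
    qed
    have "v (\<Sum>i<h. of_int (n i div int p) * b i) \<le> pinv ^ N"
      using Suc.prems p_gt_1 unfolding e by (simp add: v_mult field_simps)
    then have "\<forall>i<h. int p ^ N dvd n i div int p" by (rule Suc.IH)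
    then show ?case using n by (metis mult_dvd_mono dvd_refl power_Suc)
  qed simp
  have "\<forall>N. \<exists>n::nat \<Rightarrow> int. v (x N - (\<Sum>i<h. of_int (n i) * b i)) \<le> pinv ^ N" using digits x1 by blast
  then obtain n :: "nat \<Rightarrow> nat \<Rightarrow> int" where n: "\<And>N. v (x N - (\<Sum>i<h. of_int (n N i) * b i)) \<le> pinv ^ N" by metis
  have step: "v (of_int (n (Suc N) i) - of_int (n N i)) \<le> pinv ^ N" if i: "i < h" for i N
  proof -
    let ?s = "\<lambda>N. \<Sum>i<h. of_int (n N i) * b i"
    have "v (?s (Suc N) - x (Suc N)) \<le> pinv ^ N"
      using n[of "Suc N"] inv_p_power_mono[of N "Suc N"] v_diff_commute[of "?s (Suc N)" "x (Suc N)"] by linarith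
    then have "v (?s (Suc N) - ?s N) \<le> pinv ^ N"
      using v_trans_le[OF _ v_trans_le[OF x[of N] n[of N]]] by blast
    moreover have "?s (Suc N) - ?s N = (\<Sum>i<h. of_int (n (Suc N) i - n N i) * b i)"
      by (simp add: sum_subtractf[symmetric] left_diff_distrib)
    ultimately have "int p ^ N dvd n (Suc N) i - n N i" using indep[of "\<lambda>i. n (Suc N) i - n N i"] i by simp
    then show ?thesis using v_of_int_dvd by (metis of_int_diff)
  qed
  have "\<forall>i. \<exists>c. i < h \<longrightarrow> vlim v (\<lambda>N. of_int (n N i)) c"
  proof (intro allI)
    fix i
    show "\<exists>c. i < h \<longrightarrow> vlim v (\<lambda>N. of_int (n N i)) c"
    proof (cases "i < h")
      case True
      have "vCauchy v (\<lambda>N. of_rat (of_int (n N i)))"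
        using step[OF True] by (intro vCauchy_telescoping) simp
      from Qp_complete[OF this] show ?thesis by simp
    qed auto
  qed
  then obtain c where c: "\<And>i. i < h \<Longrightarrow> vlim v (\<lambda>N. of_int (n N i)) (c i)" by metis
  have cb: "v (of_int (n N i) - c i) \<le> pinv ^ N" if "i < h" for i N
    using limit_bound[OF step c] that by blast
  have "v (x N - (\<Sum>i<h. c i * b i)) \<le> pinv ^ N" for N
  proof (rule v_trans_le[OF n])
    have "(\<Sum>i<h. of_int (n N i) * b i) - (\<Sum>i<h. c i * b i) = (\<Sum>i<h. (of_int (n N i) - c i) * b i)"
      by (simp add: sum_subtractf left_diff_distrib)
    also have "v \<dots> \<le> pinv ^ N"
      using cb b(1) by (intro v_sum_le v_mult_le_1') auto
    finally show "v ((\<Sum>i<h. of_int (n N i) * b i) - (\<Sum>i<h. c i * b i)) \<le> pinv ^ N" .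
  qed
  then show ?thesis by blast
qed

section \<open>Congruences under products and powers, and Fermat's theorem\<close>

lemma v_cong_mult:
  assumes "v x \<le> 1" "v y' \<le> 1" "v (x - x') < c" "v (y - y') < c"
  shows "v (x * y - x' * y') < c"
proof -
  have "v (x * (y - y')) < c" using assms v_mult_le_1[of x "y - y'" "v (y - y')"] by simp
  moreover have "v ((x - x') * y') < c" using assms v_mult_le_1'[of "x - x'" "v (x - x')" y'] by simp
  ultimately show ?thesis using v_add_less[of "x * (y - y')" c "(x - x') * y'"] by (simp add: algebra_simps)
qed

lemma v_cong_prod:
  assumes "\<And>i. i \<in> A \<Longrightarrow> v (f i) \<le> 1" "\<And>i. i \<in> A \<Longrightarrow> v (g i) \<le> 1" "\<And>i. i \<in> A \<Longrightarrow> v (f i - g i) < c" "c > 0"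
  shows "v (prod f A - prod g A) < c"
  using assms(1-3)
proof (induction A rule: infinite_finite_induct)
  case (insert a A)
  have "v (prod g A) \<le> 1" unfolding v_prod using insert by (intro prod_le_1) (auto simp: v_nonneg)
  then show ?case using insert by (simp add: v_cong_mult)
qed (auto simp: \<open>c > 0\<close>)

lemma v_cong_power:
  assumes "v x \<le> 1" "v y \<le> 1" "v (x - y) < c" shows "v (x ^ n - y ^ n) < c"
proof -
  have "c > 0" using assms v_nonneg[of "x - y"] by linarith
  then show ?thesis using v_cong_prod[of "{..<n}" "\<lambda>_. x" "\<lambda>_. y" c] assms by simp
qed

lemma power_q: "(x::'k) ^ q = x * x ^ (q - 1)"
  using power_minus_mult[of q x] q_gt_1 by (simp only: mult.commute)

text \<open>For a unit \<open>z\<close>, multiplication by \<open>z\<close> permutes the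
  \<open>q - 1\<close> nonzero residue classes. Comparing the product of their representatives
  before and after gives \<open>z ^ (q - 1)\<close> congruent to 1.\<close>

lemma fermat:
  assumes z: "v z \<le> 1" shows "v (z ^ q - z) < 1"
proof (cases "v z < 1")
  case True
  have "v (z * z ^ (q - 1)) < 1" using True z by (intro v_mult_less_1') (auto simp: v_power power_le_1_v)
  then have "v (z ^ q) < 1" by (simp only: power_q)
  then show ?thesis using True by (rule v_diff_less)
next
  case False
  then have z1: "v z = 1" using z by simp
  obtain S where S: "S \<subseteq> val_ring v" "card S = q" "\<And>x. v x \<le> 1 \<Longrightarrow> \<exists>!s. s \<in> S \<and> v (x - s) < 1"
    using residue_reps by blast
  have fin: "finite S" using S(2) q_gt_1 by (intro card_ge_0_finite) simp
  define g where "g y = (THE s. s \<in> S \<and> v (y - s) < 1)" for y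
  have g: "g y \<in> S" "v (y - g y) < 1" if "v y \<le> 1" for y
    using theI'[OF S(3)[OF that]] unfolding g_def by auto
  have uniq: "s = t" if "s \<in> S" "t \<in> S" "v (s - t) < 1" for s t
    using S(3)[of s] S(1) that unfolding val_ring_def by (metis (mono_tags, lifting) S(1) diff_self mem_Collect_eq subsetD v_0 val_ring_def zero_less_one)
  define U where "U = {s\<in>S. v s = 1}"
  have finU: "finite U" using fin by (simp add: U_def)
  have cardU: "card U = q - 1"
  proof -
    have "S - U = {g 0}"
    proof (intro set_eqI iffI)
      fix s assume s: "s \<in> S - U"
      then have "v s < 1" using S(1) unfolding U_def val_ring_def by fastforce
      then have "v (s - g 0) < 1" using g(2)[of 0] by (intro v_diff_less) auto
      then show "s \<in> {g 0}" using uniq[of s "g 0"] s g(1)[of 0] by auto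
    next
      fix s assume "s \<in> {g 0}"
      then show "s \<in> S - U" using g[of 0] by (auto simp: U_def)
    qed
    moreover have "card (S - U) = card S - card U" using finU by (intro card_Diff_subset) (auto simp: U_def)
    moreover have "card U \<le> card S" using fin by (intro card_mono) (auto simp: U_def)
    ultimately show ?thesis using S(2) q_gt_1 by simp
  qed
  have zs: "v (z * s) = 1" if "s \<in> U" for s using that z1 by (simp add: U_def v_mult)
  have gU: "g (z * s) \<in> U" if "s \<in> U" for s
  proof -
    have "v (z * s - g (z * s)) < v (z * s)" using zs[OF that] g(2)[of "z * s"] by simp
    then have "v (g (z * s)) = v (z * s)" by (rule v_eq_if_less)
    then show ?thesis using zs[OF that] g(1)[of "z * s"] by (simp add: U_def)
  qed
  have inj: "inj_on (\<lambda>s. g (z * s)) U"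
  proof (rule inj_onI)
    fix s t assume st: "s \<in> U" "t \<in> U" "g (z * s) = g (z * t)"
    have "v (z * s - g (z * s)) < 1" "v (g (z * s) - z * t) < 1"
      using g(2)[of "z * s"] g(2)[of "z * t"] zs st v_diff_commute[of "z * t"] by simp_all
    then have "v (z * s - z * t) < 1" by (rule v_trans_less)
    then have "v (s - t) < 1" by (simp flip: right_diff_distrib add: v_mult z1)
    then show "s = t" using uniq st by (simp add: U_def)
  qed
  have "(\<lambda>s. g (z * s)) ` U = U" using inj gU finU by (intro endo_inj_surj) auto
  then have "(\<Prod>s\<in>U. g (z * s)) = \<Prod>U" using prod.reindex[OF inj, of "\<lambda>x. x"] by simp
  moreover have "v ((\<Prod>s\<in>U. z * s) - (\<Prod>s\<in>U. g (z * s))) < 1"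
  proof (rule v_cong_prod)
    fix s assume s: "s \<in> U"
    show "v (z * s) \<le> 1" using zs[OF s] by simp
    show "v (g (z * s)) \<le> 1" using gU[OF s] by (simp add: U_def)
    show "v (z * s - g (z * s)) < 1" using g(2) zs[OF s] by simp
  qed simp
  moreover have "(\<Prod>s\<in>U. z * s) = z ^ (q - 1) * \<Prod>U" by (simp add: prod.distrib cardU)
  ultimately have "v ((z ^ (q - 1) - 1) * \<Prod>U) < 1" by (simp add: left_diff_distrib)
  moreover have "v (\<Prod>U) = 1" unfolding v_prod by (simp add: U_def)
  ultimately have "v (z ^ (q - 1) - 1) < 1" by (simp add: v_mult)
  then have "v (z * (z ^ (q - 1) - 1)) < 1" using z by (rule v_mult_less_1[rotated])
  moreover have "z * (z ^ (q - 1) - 1) = z ^ q - z" by (simp only: power_q) (simp add: algebra_simps)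
  ultimately show ?thesis by simp
qed

text \<open>The cofactor of \<open>x - y\<close> in \<open>x ^ p - y ^ p\<close> is a sum of
  \<open>p\<close> terms, all congruent to \<open>y ^ (p - 1)\<close>, and is therefore itself
  divisible by \<open>p\<close>.\<close>

lemma v_cong_power_p:
  assumes "v x \<le> 1" "v y \<le> 1" "v (x - y) \<le> pinv ^ k" "k \<ge> 1"
  shows "v (x ^ p - y ^ p) \<le> pinv ^ Suc k"
proof -
  have "pinv ^ k \<le> pinv" using assms(4) inv_p_power_mono[of 1 k] by simp
  then have lt: "v (x - y) < 1" using assms(3) inv_p_less_1 by linarith
  have "v (\<Sum>i<p. y ^ (p - Suc i) * x ^ i - y ^ (p - 1)) \<le> pinv"
  proof (intro v_sum_le discrete)
    fix i assume i: "i \<in> {..<p}"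
    have "v (y ^ (p - Suc i) * (x ^ i - y ^ i)) < 1"
      using v_cong_power[OF assms(1,2) lt, of i] assms(2) by (intro v_mult_less_1) (auto simp: v_power power_le_1_v)
    moreover have "y ^ (p - 1) = y ^ (p - Suc i) * y ^ i" using i by (simp flip: power_add)
    ultimately show "v (y ^ (p - Suc i) * x ^ i - y ^ (p - 1)) < 1" by (simp add: right_diff_distrib)
  qed simp
  moreover have "v (of_nat p * y ^ (p - 1)) \<le> pinv" using assms(2)
    by (intro v_mult_le_1') (auto simp: v_power power_le_1_v)
  ultimately have "v ((\<Sum>i<p. y ^ (p - Suc i) * x ^ i - y ^ (p - 1)) + of_nat p * y ^ (p - 1)) \<le> pinv"
    by (rule v_add_le)
  then have "v (\<Sum>i<p. y ^ (p - Suc i) * x ^ i) \<le> pinv" by (simp add: sum_subtractf)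
  then have "v ((x - y) * (\<Sum>i<p. y ^ (p - Suc i) * x ^ i)) \<le> pinv ^ k * pinv"
    using assms(3) by (rule v_mult_le[rotated])
  then show ?thesis by (simp add: power_diff_sumr2 mult.commute)
qed

lemma v_cong_power_p_power:
  assumes "v x \<le> 1" "v y \<le> 1" "v (x - y) < 1"
  shows "v (x ^ (p ^ N) - y ^ (p ^ N)) \<le> pinv ^ Suc N"
proof (induction N)
  case 0 then show ?case using discrete assms by simp
next
  case (Suc N)
  have "v ((x ^ (p ^ N)) ^ p - (y ^ (p ^ N)) ^ p) \<le> pinv ^ Suc (Suc N)"
    using assms Suc by (intro v_cong_power_p) (auto simp: v_power power_le_1_v)
  then show ?case by (simp flip: power_mult add: mult.commute)
qed

section \<open>Teichmueller representatives\<close>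

lemma Teich_iff: "t \<in> T \<longleftrightarrow> t ^ q = t"
proof
  assume "t \<in> T"
  then show "t ^ q = t" using q_gt_1 by (subst power_q) (auto simp: Teich_def)
next
  assume a: "t ^ q = t"
  show "t \<in> T"
  proof (cases "t = 0")
    case False
    have "t * t ^ (q - 1) = t" using a by (simp only: power_q)
    then have 1: "t ^ (q - 1) = 1" using False by simp
    \<comment> \<open>Roots of unity are automatically integral. Membership in \<open>T\<close> thus
      becomes an equation, visibly stable under products and inverses.\<close>
    have "\<not> v t > 1"
    proof
      assume "v t > 1"
      then have "v t ^ (q - 1) > 1" using q_gt_1 by (intro one_less_power) auto
      then show False using 1 by (metis v_1 v_power less_irrefl)
    qed
    then show ?thesis using 1 by (simp add: Teich_def val_ring_def)
  qed (simp add: Teich_def val_ring_def)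
qed

lemma Teich_power_q: "t \<in> T \<Longrightarrow> t ^ q = t" by (simp add: Teich_iff)
lemma Teich_v_le: "t \<in> T \<Longrightarrow> v t \<le> 1" by (simp add: Teich_def val_ring_def)
lemma Teich_power_q_power: "t \<in> T \<Longrightarrow> t ^ (p ^ (h * k)) = t"
proof (induction k)
  case (Suc k)
  have "t ^ (p ^ (h * Suc k)) = (t ^ (p ^ (h * k))) ^ q"
    by (simp flip: power_mult add: power_add mult.commute)
  then show ?case using Suc Teich_power_q by simp
qed simp
lemma Teich_0 [simp]: "0 \<in> T" and Teich_1 [simp]: "1 \<in> T"
  using q_gt_1 by (auto simp: Teich_iff)
lemma Teich_mult: "s \<in> T \<Longrightarrow> t \<in> T \<Longrightarrow> s * t \<in> T"
  by (simp add: Teich_iff power_mult_distrib)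
lemma Teich_power: "t \<in> T \<Longrightarrow> t ^ n \<in> T"
  by (induction n) (auto intro: Teich_mult)
lemma Teich_prod: "(\<And>i. i \<in> A \<Longrightarrow> f i \<in> T) \<Longrightarrow> prod f A \<in> T"
  by (induction A rule: infinite_finite_induct) (auto intro: Teich_mult)
lemma Teich_inverse: "t \<in> T \<Longrightarrow> inverse t \<in> T"
  by (simp add: Teich_iff power_inverse)
lemma Teich_v: "t \<in> T \<Longrightarrow> t \<noteq> 0 \<Longrightarrow> v t = 1"
  using Teich_v_le[of t] Teich_v_le[OF Teich_inverse, of t, unfolded v_inverse] v_pos[of t]
  by (simp add: inverse_le_1_iff)
lemma Teich_unit_power: "t \<in> T \<Longrightarrow> t \<noteq> 0 \<Longrightarrow> t ^ (q - 1) = 1"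
  by (auto simp: Teich_def)

text \<open>Raising to the power \<open>p ^ (h * k)\<close> fixes both elements but improves a
  congruence modulo \<open>p\<close> to one modulo \<open>p ^ (h * k + 1)\<close>.\<close>

lemma Teich_eqI:
  assumes "s \<in> T" "t \<in> T" "v (s - t) < 1" shows "s = t"
proof -
  have "v (s - t) \<le> pinv ^ k" for k
  proof -
    have "v (s - t) \<le> pinv ^ Suc (h * k)"
      using v_cong_power_p_power[of s t "h * k"] assms Teich_power_q_power Teich_v_le by simp
    also have "k \<le> Suc (h * k)" using h_pos by (simp add: le_SucI)
    then have "pinv ^ Suc (h * k) \<le> pinv ^ k" by (rule inv_p_power_mono)
    finally show ?thesis .
  qed
  then show ?thesis using tiny_zero[of "s - t"] by simp
qed

text \<open>The iterated \<open>q\<close>-th powers of \<open>z\<close> converge, by Fermat's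
  congruence and its improvement under \<open>p\<close>-th powers. The limit is fixed by
  \<open>x \<mapsto> x ^ q\<close>.\<close>

lemma Teich_lift_exists:
  assumes z: "v z \<le> 1" shows "\<exists>t\<in>T. v (z - t) < 1"
proof -
  define x where "x N = z ^ (p ^ (h * N))" for N
  have x1: "v (x N) \<le> 1" for N using z by (simp add: x_def v_power power_le_1_v)
  have xS: "x (Suc N) = x N ^ q" for N
    unfolding x_def by (simp flip: power_mult add: power_add mult.commute)
  have step: "v (x (Suc N) - x N) \<le> pinv ^ N" for N
  proof -
    have "x (Suc N) = (z ^ q) ^ (p ^ (h * N))"
      unfolding x_def by (simp flip: power_mult add: power_add mult.commute)
    then have "v (x (Suc N) - x N) \<le> pinv ^ Suc (h * N)"
      using v_cong_power_p_power[of "z ^ q" z "h * N"] z fermat[OF z] by (simp add: x_def v_power power_le_1_v)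
    also have "N \<le> Suc (h * N)" using h_pos by (simp add: le_SucI)
    then have "pinv ^ Suc (h * N) \<le> pinv ^ N" by (rule inv_p_power_mono)
    finally show ?thesis .
  qed
  obtain t where t: "\<And>N. v (x N - t) \<le> pinv ^ N" using complete_telescoping[OF x1 step] by blast
  have t1: "v t \<le> 1" using v_diff_le[OF x1[of 0], of "x 0 - t"] t[of 0] by simp
  have "t ^ q - t = 0"
  proof (rule tiny_zero)
    fix k
    have "v (t ^ q - x (Suc k) ^ q) \<le> pinv ^ k"
    proof -
      have "v (t - x (Suc k)) < pinv ^ k"
      proof -
        have "pinv ^ Suc k < pinv ^ k" using inv_p_pos inv_p_less_1 by (intro power_strict_decreasing) auto
        then show ?thesis using t[of "Suc k"] v_diff_commute[of t "x (Suc k)"] by simp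
      qed
      then show ?thesis using v_cong_power[OF t1 x1] by (intro less_imp_le) blast
    qed
    moreover have "v (x (Suc k) ^ q - t) \<le> pinv ^ k"
      using t[of "Suc (Suc k)"] inv_p_power_mono[of k "Suc (Suc k)"] xS[of "Suc k"] by simp
    ultimately show "v (t ^ q - t) \<le> pinv ^ k" by (rule v_trans_le)
  qed
  then have "t \<in> T" by (simp add: Teich_iff)
  moreover have "v (z - t) < 1"
  proof -
    have "v (z - x 1) < 1" using fermat[OF z] v_diff_commute[of z "z ^ q"] by (simp add: x_def)
    moreover have "v (x 1 - t) < 1" using t[of 1] inv_p_less_1 unfolding power_one_right by linarith
    ultimately show ?thesis by (rule v_trans_less)
  qed
  ultimately show ?thesis by blast
qed

definition teich :: "'k \<Rightarrow> 'k" where "teich z = (SOME t. t \<in> T \<and> v (z - t) < 1)"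

lemma teich: "v z \<le> 1 \<Longrightarrow> teich z \<in> T" "v z \<le> 1 \<Longrightarrow> v (z - teich z) < 1"
  using someI_ex[of "\<lambda>t. t \<in> T \<and> v (z - t) < 1"] Teich_lift_exists[of z] unfolding teich_def by auto

lemma teich_eqI: "t \<in> T \<Longrightarrow> v (z - t) < 1 \<Longrightarrow> teich z = t"
proof -
  assume t: "t \<in> T" "v (z - t) < 1"
  have z: "v z \<le> 1" using v_add_le[of "z - t" 1 t] t Teich_v_le[of t] by simp
  show ?thesis
    using teich[OF z] t v_trans_less[of "teich z" z 1 t] v_diff_commute by (intro Teich_eqI) auto
qed

lemma card_Teich: "card T = q" and finite_Teich: "finite T"
proof -
  obtain S where S: "S \<subseteq> val_ring v" "card S = q" "\<And>x. v x \<le> 1 \<Longrightarrow> \<exists>!s. s \<in> S \<and> v (x - s) < 1"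
    using residue_reps by blast
  have S1: "v s \<le> 1" if "s \<in> S" for s using that S(1) by (auto simp: val_ring_def)
  have "bij_betw teich S T"
  proof (intro bij_betw_imageI inj_onI set_eqI iffI)
    fix s t assume st: "s \<in> S" "t \<in> S" "teich s = teich t"
    have "v (s - t) < 1" using teich(2)[OF S1[OF st(1)]] teich(2)[OF S1[OF st(2)]] st(3) v_diff_commute[of t]
      v_trans_less[of s "teich s" 1 t] by simp
    moreover have "v (s - s) < 1" by simp
    ultimately show "s = t" using S(3)[OF S1[OF st(1)]] st by blast
  next
    fix t assume "t \<in> teich ` S" then show "t \<in> T" using teich(1) S1 by auto
  next
    fix t assume t: "t \<in> T"
    then obtain s where s: "s \<in> S" "v (t - s) < 1" using S(3)[OF Teich_v_le] by blast
    then have "teich s = t" using t v_diff_commute[of t s] by (intro teich_eqI) auto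
    then show "t \<in> teich ` S" using s by blast
  qed
  then show "card T = q" using S(2) bij_betw_same_card by fastforce
  then show "finite T" using q_gt_1 by (intro card_ge_0_finite) simp
qed

section \<open>Jacobi sums\<close>

lemma teich_Teich [simp]: "t \<in> T \<Longrightarrow> teich t = t"
  by (rule teich_eqI) auto

lemma q_dvd_iff: "\<not> (q - 1) dvd c \<Longrightarrow> \<not> (q - 1) dvd c * p ^ i"
proof -
  have "coprime (q - 1) q" using q_gt_1 coprime_diff_one_left_nat[of q] by simp
  then have "coprime (q - 1) p" using h_pos by simp
  then have "coprime (q - 1) (p ^ i)" by simp
  then show "\<not> (q - 1) dvd c \<Longrightarrow> \<not> (q - 1) dvd c * p ^ i" by (simp add: coprime_dvd_mult_left_iff)
qed

lemma Teich_power_mod: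
  assumes "t \<in> T" "t \<noteq> 0" shows "t ^ k = t ^ (k mod (q - 1))"
proof -
  define d r where "d = k div (q - 1)" and "r = k mod (q - 1)"
  have "k = (q - 1) * d + r" by (simp add: d_def r_def)
  then have "t ^ k = (t ^ (q - 1)) ^ d * t ^ r" by (simp only: power_add power_mult)
  then show ?thesis using Teich_unit_power[OF assms] by (simp add: r_def)
qed

text \<open>Otherwise the \<open>q - 1\<close> nonzero elements of \<open>T\<close> would all be
  roots of \<open>x ^ r - 1\<close> with \<open>0 < r < q - 1\<close>.\<close>

lemma Teich_nontrivial_power:
  assumes "\<not> (q - 1) dvd k" shows "\<exists>t\<in>T. t \<noteq> 0 \<and> t ^ k \<noteq> 1"
proof (rule ccontr)
  assume no: "\<not> ?thesis"
  define r where "r = k mod (q - 1)"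
  have r: "0 < r" "r < q - 1" using assms q_gt_1 by (auto simp: r_def mod_greater_zero_iff_not_dvd)
  have "t ^ r = 1" if t: "t \<in> T - {0}" for t
    using no t Teich_power_mod[of t k] by (auto simp: r_def)
  then have sub: "T - {0} \<subseteq> {x. poly (monom 1 r - 1) x = 0}" by (auto simp: poly_monom)
  have deg: "degree (monom 1 r - 1 :: 'k poly) \<le> r"
    by (rule degree_diff_le) (auto simp: degree_monom_le)
  have nz: "monom 1 r - 1 \<noteq> (0 :: 'k poly)"
  proof
    assume "monom 1 r - 1 = (0 :: 'k poly)"
    then have "poly (monom 1 r - 1) 0 = (0 :: 'k)" by simp
    then show False using r by (simp add: poly_monom power_0_left)
  qed
  have "card (T - {0}) \<le> card {x. poly (monom 1 r - 1 :: 'k poly) x = 0}"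
    using sub poly_roots_finite[OF nz] by (rule card_mono[rotated])
  also have "\<dots> \<le> r" using card_poly_roots_bound[OF nz] deg by simp
  finally show False using r card_Teich finite_Teich by simp
qed

lemma bij_Teich_mult: "u \<in> T \<Longrightarrow> u \<noteq> 0 \<Longrightarrow> bij_betw (\<lambda>t. u * t) T T"
  by (rule bij_betwI[where g = "\<lambda>t. inverse u * t"]) (auto intro!: Teich_mult Teich_inverse)

lemma bij_Teich_inverse: "bij_betw inverse T T"
  by (rule bij_betwI[where g = inverse]) (auto intro!: Teich_inverse)

text \<open>A further power map undoes this one, since the power \<open>p ^ (h * i)\<close> is the
  identity on \<open>T\<close>.\<close>

lemma bij_Teich_power: "bij_betw (\<lambda>t. t ^ p ^ i) T T"
proof -
  have "inj_on (\<lambda>t. t ^ p ^ i) T"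
  proof (rule inj_onI)
    fix s t assume st: "s \<in> T" "t \<in> T" "s ^ p ^ i = t ^ p ^ i"
    have "i \<le> h * i" using h_pos by simp
    then have e: "p ^ (h * i) = p ^ i * p ^ (h * i - i)" by (simp flip: power_add)
    have "s ^ (p ^ i * p ^ (h * i - i)) = t ^ (p ^ i * p ^ (h * i - i))"
      by (simp only: power_mult[of _ "p ^ i"] st(3))
    then have "s ^ p ^ (h * i) = t ^ p ^ (h * i)" unfolding e .
    then show "s = t" using st Teich_power_q_power by simp
  qed
  moreover have "(\<lambda>t. t ^ p ^ i) ` T \<subseteq> T" by (auto intro: Teich_power)
  ultimately show ?thesis using endo_inj_surj[OF finite_Teich] unfolding bij_betw_def by blast
qed

text \<open>Translation in the residue field, transported to \<open>T\<close>.\<close>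

lemma bij_teich_shift: "v c \<le> 1 \<Longrightarrow> bij_betw (\<lambda>s. teich (c + s)) T T"
proof -
  assume c: "v c \<le> 1"
  have 1: "teich (- c + teich (c + s)) = s" if "s \<in> T" "v c \<le> 1" for s c
  proof (rule teich_eqI[OF that(1)])
    have "v (c + s) \<le> 1" using that Teich_v_le by (intro v_add_le) auto
    then show "v (- c + teich (c + s) - s) < 1" using teich(2)[of "c + s"] v_diff_commute[of "c + s"]
      by (simp add: algebra_simps)
  qed
  show ?thesis
  proof (rule bij_betwI[where g = "\<lambda>s. teich (- c + s)"])
    show "(\<lambda>s. teich (c + s)) \<in> T \<rightarrow> T" using c Teich_v_le by (auto intro!: teich v_add_le)
    show "(\<lambda>s. teich (- c + s)) \<in> T \<rightarrow> T" using c Teich_v_le by (intro Pi_I teich v_add_le) auto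
    show "teich (- c + teich (c + s)) = s" if "s \<in> T" for s using 1[OF that c] .
    show "teich (c + teich (- c + s)) = s" if "s \<in> T" for s using 1[OF that, of "- c"] c by simp
  qed
qed

text \<open>The case \<open>k = 0\<close> stands apart because \<open>0 ^ 0 = 1\<close>. It is the
  source of a full factor \<open>q\<close> for every variable that is absent from a
  monomial.\<close>

lemma sum_Teich_power:
  "(\<Sum>t\<in>T. t ^ k) = (if k = 0 then of_nat q else if (q - 1) dvd k then of_nat (q - 1) else 0)"
proof (cases "(q - 1) dvd k")
  case True
  have "(\<Sum>t\<in>T. t ^ k) = 0 ^ k + (\<Sum>t\<in>T - {0}. t ^ k)" by (rule sum.remove) (auto simp: finite_Teich)
  also have "(\<Sum>t\<in>T - {0}. t ^ k) = (\<Sum>t\<in>T - {0}. 1)"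
    using True Teich_unit_power by (intro sum.cong) (auto elim!: dvdE simp: power_mult)
  finally show ?thesis using q_gt_1 True by (auto simp: card_Teich finite_Teich power_0_left of_nat_diff)
next
  case False
  then obtain t where t: "t \<in> T" "t \<noteq> 0" "t ^ k \<noteq> 1" using Teich_nontrivial_power by blast
  have "(\<Sum>s\<in>T. s ^ k) = (\<Sum>s\<in>T. (t * s) ^ k)"
    by (rule sum.reindex_bij_betw[symmetric]) (rule bij_Teich_mult[OF t(1,2)])
  also have "\<dots> = t ^ k * (\<Sum>s\<in>T. s ^ k)" by (simp add: power_mult_distrib sum_distrib_left)
  finally have "(\<Sum>s\<in>T. s ^ k) = 0" using t(3) by simp
  then show ?thesis using False by (cases "k = 0") auto
qed

lemma sum_Teich_inverse_power: "(\<Sum>t\<in>T. inverse t ^ k) = (\<Sum>t\<in>T. t ^ k)"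
  by (rule sum.reindex_bij_betw[OF bij_Teich_inverse])

text \<open>The correction at \<open>0\<close> makes \<open>chi k\<close>, for \<open>1 \<le> k \<le> q - 1\<close> and up to the
  factor \<open>q - 1\<close>, the functional that extracts the coefficient of \<open>t ^ k\<close> of a function on \<open>T\<close>.\<close>
definition chi :: "nat \<Rightarrow> 'k \<Rightarrow> 'k" where
  "chi k t = inverse t ^ k - (if (q - 1) dvd k \<and> t = 0 then of_nat (q - 1) else 0)"

lemma sum_chi: "k \<ge> 1 \<Longrightarrow> (\<Sum>t\<in>T. chi k t) = 0"
  by (cases "(q - 1) dvd k") (simp_all add: chi_def sum_subtractf sum_Teich_inverse_power sum_Teich_power finite_Teich)

lemma chi_cong: "[k = l] (mod (q - 1)) \<Longrightarrow> k \<ge> 1 \<Longrightarrow> l \<ge> 1 \<Longrightarrow> t \<in> T \<Longrightarrow> chi k t = chi l t"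
proof -
  assume a: "[k = l] (mod (q - 1))" "k \<ge> 1" "l \<ge> 1" "t \<in> T"
  have d: "(q - 1) dvd k \<longleftrightarrow> (q - 1) dvd l" using a(1) by (rule cong_dvd_iff)
  show ?thesis
  proof (cases "t = 0")
    case False
    then show ?thesis using Teich_power_mod[OF Teich_inverse[OF a(4)], of k] Teich_power_mod[OF Teich_inverse[OF a(4)], of l] a(1)
      by (simp add: chi_def cong_def)
  qed (use a d in \<open>simp add: chi_def power_0_left\<close>)
qed

lemma v_chi: "t \<in> T \<Longrightarrow> v (chi k t) \<le> 1"
  unfolding chi_def using Teich_v_le[OF Teich_inverse]
  by (intro v_diff_le) (auto simp: v_power intro!: power_le_1_v)

lemma chi_plain: "\<not> (q - 1) dvd k \<Longrightarrow> chi k t = inverse t ^ k" by (simp add: chi_def)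

text \<open>\<open>J ks w\<close> sums the products of the values \<open>chi k\<close> over all
  tuples from \<open>T\<close> whose sum is congruent to \<open>w\<close> modulo \<open>p\<close>.
  The recursion on single variables makes merging two characters a local operation on the
  list.\<close>

primrec J :: "nat list \<Rightarrow> 'k \<Rightarrow> 'k" where
  "J [] w = (if v w < 1 then 1 else 0)"
| "J (k # ks) w = (\<Sum>t\<in>T. chi k t * J ks (w - t))"

lemma J_cong: "v (w - w') < 1 \<Longrightarrow> J ks w = J ks w'"
proof (induction ks arbitrary: w w')
  case Nil
  then show ?case using v_trans_less[of w w' 1 0] v_trans_less[of w' w 1 0] v_diff_commute[of w] by auto
next
  case (Cons k ks)
  then show ?case by (auto intro!: sum.cong)
qed

lemma v_J: "v (J ks w) \<le> 1"
  by (induction ks arbitrary: w) (auto intro!: v_sum_le v_mult_le_1 v_chi)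

lemma J_swap: "J (a # b # ks) w = J (b # a # ks) w"
proof -
  have "J (a # b # ks) w = (\<Sum>t\<in>T. \<Sum>s\<in>T. chi a t * (chi b s * J ks (w - t - s)))"
    by (simp add: sum_distrib_left)
  also have "\<dots> = (\<Sum>s\<in>T. \<Sum>t\<in>T. chi a t * (chi b s * J ks (w - t - s)))" by (rule sum.swap)
  also have "\<dots> = J (b # a # ks) w" by (simp add: sum_distrib_left algebra_simps diff_diff_eq)
  finally show ?thesis .
qed

lemma J_move: "J (xs @ a # ys) w = J (a # xs @ ys) w"
proof (induction xs arbitrary: w)
  case (Cons x xs)
  have "J ((x # xs) @ a # ys) w = J (x # a # xs @ ys) w" using Cons by simp
  then show ?case using J_swap by simp
qed simp

lemma J_Cons_cong: "(\<And>w. J ks w = c * J ks' w) \<Longrightarrow> J (k # ks) w = c * J (k # ks') w"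
  by (simp add: sum_distrib_left algebra_simps)

lemma J_mset: "mset xs = mset ys \<Longrightarrow> J xs w = J ys w"
proof (induction xs arbitrary: ys w)
  case (Cons x xs)
  then have "x \<in> set ys" by (metis list.set_intros(1) set_mset_mset)
  then obtain as bs where ys: "ys = as @ x # bs" by (meson split_list)
  then have "mset xs = mset (as @ bs)" using Cons.prems by simp
  then have "\<And>w. J xs w = J (as @ bs) w" using Cons.IH by blast
  then show ?case unfolding ys J_move by simp
qed simp

text \<open>The convolution of two characters on the residue field.\<close>

definition conv :: "nat \<Rightarrow> nat \<Rightarrow> 'k \<Rightarrow> 'k" where
  "conv a b u = (\<Sum>t\<in>T. chi a t * chi b (teich (u - t)))"

lemma sum_Teich_shift: "v c \<le> 1 \<Longrightarrow> (\<Sum>s\<in>T. f (teich (c + s))) = (\<Sum>s\<in>T. f s)"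
  using sum.reindex_bij_betw[OF bij_teich_shift] by blast

lemma J_conv: "J (a # b # ks) w = (\<Sum>u\<in>T. conv a b u * J ks (w - u))"
proof -
  have "(\<Sum>s\<in>T. chi b s * J ks (w - t - s)) = (\<Sum>u\<in>T. chi b (teich (u - t)) * J ks (w - u))" if t: "t \<in> T" for t
  proof -
    have "(\<Sum>s\<in>T. chi b s * J ks (w - t - s))
        = (\<Sum>u\<in>T. chi b (teich (- t + u)) * J ks (w - t - teich (- t + u)))"
      using sum_Teich_shift[of "- t" "\<lambda>s. chi b s * J ks (w - t - s)"] t Teich_v_le by simp
    also have "\<dots> = (\<Sum>u\<in>T. chi b (teich (u - t)) * J ks (w - u))"
    proof (intro sum.cong refl)
      fix u assume u: "u \<in> T"
      have "v (u - t) \<le> 1" using u t Teich_v_le by (intro v_diff_le)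
      then have "v (u - t - teich (u - t)) < 1" by (rule teich)
      then have "J ks (w - t - teich (- t + u)) = J ks (w - u)" by (intro J_cong) (simp add: algebra_simps)
      then show "chi b (teich (- t + u)) * J ks (w - t - teich (- t + u)) = chi b (teich (u - t)) * J ks (w - u)"
        by simp
    qed
    finally show ?thesis .
  qed
  then have "J (a # b # ks) w = (\<Sum>t\<in>T. chi a t * (\<Sum>u\<in>T. chi b (teich (u - t)) * J ks (w - u)))" by simp
  also have "\<dots> = (\<Sum>t\<in>T. \<Sum>u\<in>T. chi a t * chi b (teich (u - t)) * J ks (w - u))"
    by (simp add: sum_distrib_left mult.assoc)
  also have "\<dots> = (\<Sum>u\<in>T. \<Sum>t\<in>T. chi a t * chi b (teich (u - t)) * J ks (w - u))" by (rule sum.swap)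
  finally show ?thesis by (simp add: conv_def sum_distrib_right)
qed

text \<open>For positive exponents this is the classical Jacobi sum of the characters with exponents
  \<open>-a\<close> and \<open>-b\<close>; the convention \<open>inverse 0 = 0\<close> drops the
  arguments 0 and 1.\<close>

definition jac :: "nat \<Rightarrow> nat \<Rightarrow> 'k" where
  "jac a b = (\<Sum>t\<in>T. inverse t ^ a * inverse (teich (1 - t)) ^ b)"

lemma v_one_minus_Teich: "t \<in> T \<Longrightarrow> v (1 - t) \<le> 1"
  using Teich_v_le by (intro v_diff_le) auto

lemma v_jac: "v (jac a b) \<le> 1"
  unfolding jac_def
proof (intro v_sum_le v_mult_le_1)
  fix t assume t: "t \<in> T"
  show "v (inverse t ^ a) \<le> 1" using Teich_v_le Teich_power Teich_inverse t by blast
  show "v (inverse (teich (1 - t)) ^ b) \<le> 1"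
    using Teich_v_le Teich_power Teich_inverse teich(1)[OF v_one_minus_Teich[OF t]] by blast
qed auto

text \<open>For nonzero \<open>u\<close>, scaling \<open>t\<close> by \<open>u\<close> splits off
  the power of \<open>u\<close> and leaves the Jacobi sum. The value at \<open>u = 0\<close> is
  forced by the other values, because both sides have sum 0 over \<open>T\<close>. The correction in
  \<open>chi\<close> makes this true also when \<open>q - 1\<close> divides
  \<open>a + b\<close>.\<close>

lemma conv_eq:
  assumes a: "\<not> (q - 1) dvd a" and b: "\<not> (q - 1) dvd b" and u: "u \<in> T"
  shows "conv a b u = jac a b * chi (a + b) u"
proof -
  have nz: "conv a b u = jac a b * chi (a + b) u" if u: "u \<in> T" "u \<noteq> 0" for u
  proof -
    have "conv a b u = (\<Sum>t\<in>T. inverse t ^ a * inverse (teich (u - t)) ^ b)"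
      unfolding conv_def chi_plain[OF a] chi_plain[OF b] ..
    also have "\<dots> = (\<Sum>t\<in>T. inverse (u * t) ^ a * inverse (teich (u - u * t)) ^ b)"
      by (rule sum.reindex_bij_betw[symmetric]) (rule bij_Teich_mult[OF u])
    also have "\<dots> = (\<Sum>t\<in>T. inverse u ^ (a + b) * (inverse t ^ a * inverse (teich (1 - t)) ^ b))"
    proof (intro sum.cong refl)
      fix t assume t: "t \<in> T"
      have "teich (u - u * t) = u * teich (1 - t)"
      proof (rule teich_eqI)
        show "u * teich (1 - t) \<in> T" using u teich(1)[OF v_one_minus_Teich[OF t]] by (intro Teich_mult)
        have "v (u * ((1 - t) - teich (1 - t))) < 1"
          using Teich_v_le[OF u(1)] teich(2)[OF v_one_minus_Teich[OF t]] by (rule v_mult_less_1)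
        then show "v (u - u * t - u * teich (1 - t)) < 1" by (simp add: algebra_simps)
      qed
      then show "inverse (u * t) ^ a * inverse (teich (u - u * t)) ^ b
          = inverse u ^ (a + b) * (inverse t ^ a * inverse (teich (1 - t)) ^ b)"
        by (simp add: power_mult_distrib power_add)
    qed
    also have "\<dots> = jac a b * inverse u ^ (a + b)"
      unfolding jac_def sum_distrib_left[symmetric] by (rule mult.commute)
    finally show ?thesis using u by (simp add: chi_def)
  qed
  show ?thesis
  proof (cases "u = 0")
    case True
    have ab: "a \<ge> 1" "b \<ge> 1" using a b by (auto simp: Suc_le_eq intro!: Nat.gr0I)
    have "(\<Sum>u\<in>T. conv a b u) = (\<Sum>t\<in>T. chi a t * (\<Sum>u\<in>T. chi b (teich (u - t))))"
      unfolding conv_def sum_distrib_left by (rule sum.swap)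
    also have "\<dots> = (\<Sum>t\<in>T. chi a t * (\<Sum>u\<in>T. chi b u))"
    proof (intro sum.cong refl)
      fix t assume "t \<in> T"
      then show "chi a t * (\<Sum>u\<in>T. chi b (teich (u - t))) = chi a t * (\<Sum>u\<in>T. chi b u)"
        using sum_Teich_shift[of "- t" "chi b"] Teich_v_le by simp
    qed
    finally have "(\<Sum>u\<in>T. conv a b u) = 0" using sum_chi ab by simp
    moreover have "(\<Sum>u\<in>T. jac a b * chi (a + b) u) = 0"
      using sum_chi[of "a + b"] ab by (simp flip: sum_distrib_left)
    moreover have "(\<Sum>u\<in>T - {0}. conv a b u) = (\<Sum>u\<in>T - {0}. jac a b * chi (a + b) u)"
      using nz by (intro sum.cong) auto
    ultimately have "conv a b 0 + (\<Sum>u\<in>T - {0}. jac a b * chi (a + b) u)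
        = jac a b * chi (a + b) 0 + (\<Sum>u\<in>T - {0}. jac a b * chi (a + b) u)"
      using sum.remove[OF finite_Teich, of 0 "conv a b"] sum.remove[OF finite_Teich, of 0 "\<lambda>u. jac a b * chi (a + b) u"]
      by simp
    then have "conv a b 0 = jac a b * chi (a + b) 0" by (rule add_right_imp_eq)
    then show ?thesis using True by simp
  qed (use nz u in blast)
qed

lemma J_merge:
  assumes "\<not> (q - 1) dvd a" "\<not> (q - 1) dvd b"
  shows "J (a # b # ks) w = jac a b * J ((a + b) # ks) w"
  using conv_eq[OF assms] by (simp add: J_conv sum_distrib_left mult.assoc del: J.simps(2)) (simp add: sum_distrib_left mult.assoc)

text \<open>Here \<open>chi a\<close> is the constant 1 minus \<open>q\<close> times the indicator
  of 0. The constant contributes nothing, since \<open>chi b\<close> has sum 0 over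
  \<open>T\<close>.\<close>

lemma J_full:
  assumes "(q - 1) dvd a" "a \<ge> 1" "b \<ge> 1"
  shows "J (a # b # ks) w = - of_nat q * J (b # ks) w"
proof -
  have "conv a b u = - of_nat q * chi b u" if u: "u \<in> T" for u
  proof -
    have c: "chi a t = 1 - (if t = 0 then of_nat q else 0)" if t: "t \<in> T" for t
    proof (cases "t = 0")
      case True
      then show ?thesis using assms q_gt_1 by (simp add: chi_def of_nat_diff)
    next
      case False
      then show ?thesis using assms t Teich_unit_power[OF Teich_inverse[OF t]] by (auto elim!: dvdE simp: chi_def power_mult)
    qed
    have "conv a b u = (\<Sum>t\<in>T. chi b (teich (u - t)) - (if t = 0 then of_nat q * chi b (teich (u - t)) else 0))"
      unfolding conv_def by (intro sum.cong refl) (auto simp: c algebra_simps)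
    also have "\<dots> = (\<Sum>t\<in>T. chi b (teich (u - t))) - of_nat q * chi b u"
      using u by (simp add: sum_subtractf sum.delta finite_Teich)
    also have "(\<Sum>t\<in>T. chi b (teich (u - t))) = 0"
    proof -
      have "(\<Sum>t\<in>T. chi b (teich (u - t))) = (\<Sum>s\<in>T. chi b s)"
      proof (rule sum.reindex_bij_witness[where i = "\<lambda>s. teich (u - s)" and j = "\<lambda>t. teich (u - t)"])
        fix t assume t: "t \<in> T"
        have ut: "v (u - t) \<le> 1" using u t Teich_v_le by (intro v_diff_le)
        show "teich (u - t) \<in> T" "teich (u - t) \<in> T" using teich(1)[OF ut] by auto
        show "teich (u - teich (u - t)) = t" "teich (u - teich (u - t)) = t"
          using teich(2)[OF ut] t by (auto intro!: teich_eqI simp: algebra_simps)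
      qed auto
      then show ?thesis using sum_chi assms by simp
    qed
    finally show ?thesis by simp
  qed
  then show ?thesis by (simp add: J_conv mult.assoc del: J.simps(2)) (simp add: sum_distrib_left mult.assoc sum_negf)
qed

section \<open>Jacobi sums modulo \<open>p\<close>\<close>

lemma frobenius_add:
  assumes "v x \<le> 1" "v y \<le> 1" shows "v ((x + y) ^ p ^ i - (x ^ p ^ i + y ^ p ^ i)) < 1"
proof (induction i)
  case (Suc i)
  have base: "v ((x + y) ^ p - (x ^ p + y ^ p)) < 1" if "v x \<le> 1" "v y \<le> 1" for x y
  proof -
    have "(x + y) ^ p = (\<Sum>k\<le>p. of_nat (p choose k) * x ^ k * y ^ (p - k))" by (rule binomial_ring)
    also have "{..p} = insert 0 (insert p {0<..<p})" using p_gt_1 by auto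
    finally have "(x + y) ^ p - (x ^ p + y ^ p) = (\<Sum>k\<in>{0<..<p}. of_nat (p choose k) * x ^ k * y ^ (p - k))"
      using p_gt_1 by simp
    also have "v \<dots> < 1"
    proof (intro v_sum_less)
      fix k assume k: "k \<in> {0<..<p}"
      have "p dvd (p choose k)" using k prime_p by (intro dvd_choose_prime) auto
      then have "v (of_nat (p choose k)) < 1" by (simp add: v_of_nat_less_1_iff)
      then show "v (of_nat (p choose k) * x ^ k * y ^ (p - k)) < 1"
        using that by (intro v_mult_less_1') (auto simp: v_power power_le_1_v)
    qed simp
    finally show ?thesis .
  qed
  let ?P = "p ^ i"
  have v1: "v ((x + y) ^ ?P) \<le> 1" using assms v_add_le by (auto simp: v_power intro!: power_le_1_v)
  have v2: "v (x ^ ?P) \<le> 1" "v (y ^ ?P) \<le> 1" using assms by (auto simp: v_power intro!: power_le_1_v)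
  have "v (((x + y) ^ ?P) ^ p - (x ^ ?P + y ^ ?P) ^ p) < 1"
    using v1 v2 Suc by (intro v_cong_power v_add_le) auto
  moreover have "v ((x ^ ?P + y ^ ?P) ^ p - ((x ^ ?P) ^ p + (y ^ ?P) ^ p)) < 1" using v2 by (rule base)
  ultimately have "v (((x + y) ^ ?P) ^ p - ((x ^ ?P) ^ p + (y ^ ?P) ^ p)) < 1" by (rule v_trans_less)
  then show ?case by (simp flip: power_mult add: mult.commute)
qed simp

text \<open>The substitution \<open>t \<mapsto> t ^ p ^ i\<close> permutes \<open>T\<close> and
  commutes with \<open>t \<mapsto> 1 - t\<close> modulo \<open>p\<close>.\<close>

lemma jac_frobenius: "jac (a * p ^ i) (p ^ i) = jac a 1"
proof -
  have "jac a 1 = (\<Sum>t\<in>T. inverse t ^ a * inverse (teich (1 - t)))" by (simp add: jac_def)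
  also have "\<dots> = (\<Sum>t\<in>T. inverse (t ^ p ^ i) ^ a * inverse (teich (1 - t ^ p ^ i)))"
    by (rule sum.reindex_bij_betw[OF bij_Teich_power, symmetric])
  also have "\<dots> = jac (a * p ^ i) (p ^ i)" unfolding jac_def
  proof (intro sum.cong refl)
    fix t assume t: "t \<in> T"
    note t1 = v_one_minus_Teich[OF t]
    have "teich (1 - t ^ p ^ i) = teich (1 - t) ^ p ^ i"
    proof (rule teich_eqI)
      show "teich (1 - t) ^ p ^ i \<in> T" using teich(1)[OF t1] by (rule Teich_power)
      have "v ((1 - t) ^ p ^ i - teich (1 - t) ^ p ^ i) < 1"
        using t1 teich[OF t1] Teich_v_le by (intro v_cong_power) auto
      moreover have "v (1 - t ^ p ^ i - (1 - t) ^ p ^ i) < 1"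
        using frobenius_add[OF t1 Teich_v_le[OF t], of i] by (simp add: algebra_simps)
      ultimately show "v (1 - t ^ p ^ i - teich (1 - t) ^ p ^ i) < 1" using v_trans_less by blast
    qed
    then show "inverse (t ^ p ^ i) ^ a * inverse (teich (1 - t ^ p ^ i))
        = inverse t ^ (a * p ^ i) * inverse (teich (1 - t)) ^ p ^ i"
      by (simp add: power_inverse mult.commute flip: power_mult)
  qed
  finally show ?thesis by simp
qed

text \<open>With \<open>y\<close> the inverse of \<open>t\<close>, the summand becomes
  \<open>y ^ (a + 1) / (y - 1)\<close> modulo \<open>p\<close>. This is \<open>1 / (y - 1)\<close>
  plus the geometric sum of the \<open>y ^ c\<close> for \<open>c \<le> a\<close>, and both parts
  are evaluated by power sums over the residue field.\<close>

lemma jac_one: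
  assumes a: "1 \<le> a" "a \<le> q - 2" shows "v (jac a 1 + of_nat (a + 1)) < 1"
proof -
  let ?T = "T - {0, 1}"
  have q3: "q \<ge> 3" using a by simp
  define E where "E y = inverse (teich (y - 1))" for y
  have vE: "v (E y) \<le> 1" "teich (y - 1) \<in> T" "v ((y - 1) - teich (y - 1)) < 1" if "y \<in> T" for y
  proof -
    have y: "v (y - 1) \<le> 1" using that Teich_v_le by (intro v_diff_le) auto
    show "teich (y - 1) \<in> T" "v ((y - 1) - teich (y - 1)) < 1" using teich[OF y] by auto
    then show "v (E y) \<le> 1" unfolding E_def using Teich_v_le Teich_inverse by blast
  qed
  have "jac a 1 = (\<Sum>t\<in>T. inverse t ^ a * inverse (teich (1 - t)))" by (simp add: jac_def)
  also have "\<dots> = (\<Sum>y\<in>T. inverse (inverse y) ^ a * inverse (teich (1 - inverse y)))"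
    by (rule sum.reindex_bij_betw[OF bij_Teich_inverse, symmetric])
  \<comment> \<open>By \<open>inverse 0 = 0\<close>, the first factor vanishes at 0 (as
    \<open>a \<ge> 1\<close>) and the second at 1.\<close>
  also have "\<dots> = (\<Sum>y\<in>?T. inverse (inverse y) ^ a * inverse (teich (1 - inverse y)))"
    using a by (intro sum.mono_neutral_right) (auto simp: finite_Teich)
  also have "\<dots> = (\<Sum>y\<in>?T. y ^ Suc a * E y)"
  proof (intro sum.cong refl)
    fix y assume "y \<in> ?T"
    then have y: "y \<in> T" "y \<noteq> 0" by auto
    have "teich (1 - inverse y) = inverse y * teich (y - 1)"
    proof (rule teich_eqI)
      show "inverse y * teich (y - 1) \<in> T" using y vE by (intro Teich_mult Teich_inverse)
      have "v (inverse y * ((y - 1) - teich (y - 1))) < 1"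
        using Teich_v_le[OF Teich_inverse[OF y(1)]] vE(3)[OF y(1)] by (rule v_mult_less_1)
      then show "v (1 - inverse y - inverse y * teich (y - 1)) < 1" using y by (simp add: algebra_simps)
    qed
    then show "inverse (inverse y) ^ a * inverse (teich (1 - inverse y)) = y ^ Suc a * E y"
      by (simp add: E_def)
  qed
  finally have j: "jac a 1 = (\<Sum>y\<in>?T. y ^ Suc a * E y)" .
  have "v (\<Sum>y\<in>?T. y ^ Suc a * E y - (E y + (\<Sum>c<Suc a. y ^ c))) < 1"
  proof (intro v_sum_less)
    fix y assume "y \<in> ?T"
    then have y: "y \<in> T" "y \<noteq> 0" "y \<noteq> 1" by auto
    have nz: "teich (y - 1) \<noteq> 0"
    proof
      assume "teich (y - 1) = 0"
      then have "y = 1" using vE(3)[OF y(1)] y Teich_eqI[of y 1] by simp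
      then show False using y by simp
    qed
    have e: "y ^ Suc a - 1 = (y - 1) * (\<Sum>c<Suc a. y ^ c)" by (rule power_diff_1_eq)
    have "y ^ Suc a * E y - (E y + (\<Sum>c<Suc a. y ^ c)) = (y ^ Suc a - 1) * E y - (\<Sum>c<Suc a. y ^ c)"
      by (simp add: algebra_simps)
    also have "\<dots> = (\<Sum>c<Suc a. y ^ c) * (((y - 1) - teich (y - 1)) * E y)"
      unfolding e using nz by (simp add: E_def algebra_simps del: sum.lessThan_Suc)
    also have "v \<dots> < 1"
    proof (rule v_mult_less_1)
      show "v (\<Sum>c<Suc a. y ^ c) \<le> 1" using y Teich_power Teich_v_le by (intro v_sum_le) auto
      show "v (((y - 1) - teich (y - 1)) * E y) < 1" using vE[OF y(1)] by (intro v_mult_less_1')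
    qed
    finally show "v (y ^ Suc a * E y - (E y + (\<Sum>c<Suc a. y ^ c))) < 1" .
  qed simp
  then have 1: "v (jac a 1 - ((\<Sum>y\<in>?T. E y) + (\<Sum>y\<in>?T. \<Sum>c<Suc a. y ^ c))) < 1"
    unfolding j by (simp only: sum_subtractf sum.distrib)
  have "(\<Sum>y\<in>T. E y) = (\<Sum>s\<in>T. inverse s)"
    using sum_Teich_shift[of "- 1" inverse] by (simp add: E_def)
  also have "\<dots> = 0" using sum_Teich_inverse_power[of 1] sum_Teich_power[of 1] q3 by simp
  finally have "(\<Sum>y\<in>?T. E y) = - E 0 - E 1"
    using sum.subset_diff[of "{0, 1}" T E] finite_Teich by (simp add: eq_neg_iff_add_eq_0 algebra_simps)
  then have Es: "(\<Sum>y\<in>?T. E y) = - E 0" by (simp add: E_def)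
  have E0: "v (- E 0 - 1) < 1"
  proof -
    have t: "teich (- 1) \<in> T" "v (- 1 - teich (- 1)) < 1" using vE[of 0] by auto
    have nz: "teich (- 1) \<noteq> 0" using t(2) by auto
    have "- E 0 - 1 = (- 1 - teich (- 1)) * E 0" using nz by (simp add: E_def algebra_simps)
    also have "v \<dots> < 1" using t(2) vE(1)[of 0] by (intro v_mult_less_1') auto
    finally show ?thesis .
  qed
  have "(\<Sum>y\<in>?T. \<Sum>c<Suc a. y ^ c) = (\<Sum>c<Suc a. \<Sum>y\<in>?T. y ^ c)" by (rule sum.swap)
  \<comment> \<open>For \<open>0 < c \<le> a\<close> the full power sum vanishes because
    \<open>c < q - 1\<close>, and removing 0 and 1 leaves -1. For \<open>c = 0\<close> there are
    \<open>q - 2\<close> points.\<close>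
  also have "\<dots> = (\<Sum>c<Suc a. (if c = 0 then of_nat q - 1 else 0) - 1)"
  proof (intro sum.cong refl)
    fix c assume c: "c \<in> {..<Suc a}"
    have "(\<Sum>y\<in>?T. y ^ c) = (\<Sum>y\<in>T. y ^ c) - (\<Sum>y\<in>{0,1}. y ^ c)"
      using sum.subset_diff[of "{0, 1}" T "\<lambda>y. y ^ c"] finite_Teich by (simp add: algebra_simps)
    moreover have "c \<noteq> 0 \<Longrightarrow> \<not> (q - 1) dvd c" using c a q3 by (intro nat_dvd_not_less) auto
    ultimately show "(\<Sum>y\<in>?T. y ^ c) = (if c = 0 then of_nat q - 1 else 0) - 1"
      using sum_Teich_power[of c] by auto
  qed
  also have "\<dots> = of_nat q - 1 - of_nat (a + 1)"
    by (simp add: sum_subtractf sum.delta del: sum.lessThan_Suc)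
  finally have 2: "(\<Sum>y\<in>?T. \<Sum>c<Suc a. y ^ c) = of_nat q - 1 - of_nat (a + 1)" .
  have "jac a 1 + of_nat (a + 1) = (jac a 1 - ((\<Sum>y\<in>?T. E y) + (\<Sum>y\<in>?T. \<Sum>c<Suc a. y ^ c))) + (- E 0 - 1) + of_nat q"
    unfolding 2 Es by simp
  also have "v \<dots> < 1"
  proof (intro v_add_less 1 E0)
    show "v (of_nat q) < 1" unfolding v_of_nat_less_1_iff using h_pos by (simp add: dvd_power)
  qed
  finally show ?thesis .
qed

text \<open>The dichotomy behind the digit count: joining \<open>a * p ^ i\<close> with
  \<open>p ^ i\<close> costs a unit unless \<open>p\<close> divides \<open>a + 1\<close>, that is,
  unless the addition of 1 to \<open>a\<close> carries.\<close>

lemma jac_p_power: "1 \<le> a \<Longrightarrow> a \<le> q - 2 \<Longrightarrow> v (jac (a * p ^ i) (p ^ i) + of_nat (a + 1)) < 1"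
  unfolding jac_frobenius by (rule jac_one)

section \<open>Stickelberger's estimate\<close>

text \<open>For positive \<open>x\<close> the representative modulo \<open>q - 1\<close> lies
  between 1 and \<open>q - 1\<close>, and 0 is kept for \<open>x = 0\<close>: the powers
  \<open>q - 1\<close> and 0 agree on the nonzero elements of \<open>T\<close> but differ at
  0.\<close>

definition rep :: "nat \<Rightarrow> nat" where
  "rep x = (if x = 0 then 0 else (x - 1) mod (q - 1) + 1)"

lemma rep_0 [simp]: "rep 0 = 0" by (simp add: rep_def)
lemma rep_eq_0_iff [simp]: "rep x = 0 \<longleftrightarrow> x = 0" by (simp add: rep_def)
lemma rep_le: "rep x \<le> x"
  using mod_less_eq_dividend[of "x - 1" "q - 1"] by (cases x) (auto simp: rep_def)
lemma cong_rep: "[rep x = x] (mod (q - 1))"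
proof (cases x)
  case (Suc y)
  have "[y mod (q - 1) + 1 = y + 1] (mod (q - 1))" by (intro cong_add) (auto simp: cong_def)
  then show ?thesis using Suc by (simp add: rep_def)
qed (simp add: cong_def)
lemma rep_cong: "[x = y] (mod (q - 1)) \<Longrightarrow> x \<ge> 1 \<Longrightarrow> y \<ge> 1 \<Longrightarrow> rep x = rep y"
proof -
  assume a: "[x = y] (mod (q - 1))" "x \<ge> 1" "y \<ge> 1"
  then have "[(x - 1) + 1 = (y - 1) + 1] (mod (q - 1))" by simp
  then have "[x - 1 = y - 1] (mod (q - 1))" by (simp only: cong_add_rcancel_nat)
  then show ?thesis using a by (simp add: rep_def cong_def)
qed
lemma rep_add_le: "rep (x + y) \<le> rep x + rep y"
proof (cases "x = 0 \<or> y = 0")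
  case False
  have "[x + y = rep x + rep y] (mod (q - 1))" using cong_rep by (intro cong_add) (auto intro: cong_sym)
  then have "rep (x + y) = rep (rep x + rep y)" using False by (intro rep_cong) (auto simp: Suc_le_eq)
  then show ?thesis using rep_le by simp
qed auto
lemma rep_small: "x \<le> q - 1 \<Longrightarrow> rep x = x"
  by (cases x) (auto simp: rep_def)

text \<open>For \<open>1 \<le> k \<le> q - 1\<close>, multiplication by \<open>p\<close> modulo
  \<open>q - 1\<close> rotates the \<open>h\<close> digits of \<open>k\<close> in base
  \<open>p\<close>, so \<open>W k\<close> is \<open>(q - 1) / (p - 1)\<close> times the digit sum.
  In this form subadditivity is immediate and the contributions of the Frobenius twists are
  separated.\<close>

definition W :: "nat \<Rightarrow> nat" where
  "W k = (\<Sum>c<h. rep (p ^ c * k))"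

lemma W_add_le: "W (a + b) \<le> W a + W b"
  unfolding W_def sum.distrib[symmetric] distrib_left by (intro sum_mono rep_add_le)

lemma cong_q_1: "[q = 1] (mod (q - 1))"
proof -
  have "[(q - 1) + 1 = 0 + 1] (mod (q - 1))" by (intro cong_add) (auto simp: cong_def)
  then show ?thesis using q_gt_1 by simp
qed

lemma cong_p_power_mod: "[p ^ i = p ^ (i mod h)] (mod (q - 1))"
proof -
  have "p ^ i = q ^ (i div h) * p ^ (i mod h)" by (simp flip: power_mult power_add)
  moreover have "[q ^ (i div h) * p ^ (i mod h) = 1 ^ (i div h) * p ^ (i mod h)] (mod (q - 1))"
    by (intro cong_mult cong_pow cong_q_1 cong_refl)
  ultimately show ?thesis by simp
qed

lemma W_p_mult: assumes "k \<ge> 1" shows "W (p * k) = W k"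
proof -
  have "W k + rep (q * k) = rep k + W (p * k)"
    unfolding W_def using sum.lessThan_Suc[of "\<lambda>c. rep (p ^ c * k)" h]
      sum.lessThan_Suc_shift[of "\<lambda>c. rep (p ^ c * k)" h] by (simp add: mult.assoc mult.left_commute)
  moreover have "rep (q * k) = rep k"
    using cong_mult[OF cong_q_1 cong_refl[of k]] assms by (intro rep_cong) (auto simp: Suc_le_eq)
  ultimately show ?thesis by simp
qed

lemma W_p_power: "W (p ^ i) = W 1"
proof (induction i)
  case (Suc i)
  show ?case using W_p_mult[of "p ^ i"] Suc by (simp add: Suc_le_eq)
qed simp

lemma W_1: "(p - 1) * W 1 = q - 1"
proof -
  have "W 1 = (\<Sum>c<h. p ^ c)" unfolding W_def
  proof (intro sum.cong refl)
    fix c assume "c \<in> {..<h}"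
    then have "p ^ c < q" using p_gt_1 by (intro power_strict_increasing) auto
    then show "rep (p ^ c * 1) = p ^ c" using rep_small[of "p ^ c"] by simp
  qed
  then have "int ((p - 1) * W 1) = (int p - 1) * (\<Sum>c<h. int p ^ c)" using p_gt_1 by (simp add: of_nat_diff)
  also have "\<dots> = int p ^ h - 1" by (rule power_diff_1_eq[symmetric])
  also have "\<dots> = int (q - 1)" using q_gt_1 by (simp add: of_nat_diff)
  finally show ?thesis by (simp only: of_nat_eq_iff)
qed

lemma W_1_pos: "W 1 > 0" using W_1 q_gt_1 by (intro Nat.gr0I) auto

lemma J_Cons_chi: "(\<And>t. t \<in> T \<Longrightarrow> chi k t = chi l t) \<Longrightarrow> J (k # ks) w = J (l # ks) w"
  by (auto intro!: sum.cong)

lemma not_dvd_small: "1 \<le> c \<Longrightarrow> c < q - 1 \<Longrightarrow> \<not> (q - 1) dvd c * p ^ i"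
  by (intro q_dvd_iff nat_dvd_not_less) auto

text \<open>Preparation of a carry: fewer than \<open>p\<close> equal powers are collected into one
  exponent. Of the product of Jacobi sums that arises, only integrality is recorded.\<close>

lemma J_replicate:
  assumes "1 \<le> c" "c \<le> p - 1"
  shows "\<exists>x. v x \<le> 1 \<and> (\<forall>ks w. J (replicate c (p ^ i) @ ks) w = x * J (c * p ^ i # ks) w)"
  using assms
proof (induction c rule: nat_induct_at_least)
  case base
  show ?case by (intro exI[of _ 1]) simp
next
  case (Suc c)
  then obtain x where x: "v x \<le> 1" "\<And>ks w. J (replicate c (p ^ i) @ ks) w = x * J (c * p ^ i # ks) w" by auto
  have c: "1 \<le> c" "c < q - 1" using Suc p_le_q by auto
  have nd: "\<not> (q - 1) dvd p ^ i" "\<not> (q - 1) dvd c * p ^ i"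
    using not_dvd_small[of 1 i] not_dvd_small[of c i] c by auto
  have "J (replicate (Suc c) (p ^ i) @ ks) w = x * jac (p ^ i) (c * p ^ i) * J (Suc c * p ^ i # ks) w" for ks w
  proof -
    have "J (replicate (Suc c) (p ^ i) @ ks) w = x * J (p ^ i # c * p ^ i # ks) w"
      using x(2) by (simp only: replicate_Suc append_Cons) (rule J_Cons_cong, simp)
    also have "\<dots> = x * (jac (p ^ i) (c * p ^ i) * J ((p ^ i + c * p ^ i) # ks) w)"
      by (simp only: J_merge[OF nd])
    finally show ?thesis by (simp add: mult.assoc del: J.simps)
  qed
  moreover have "v (x * jac (p ^ i) (c * p ^ i)) \<le> 1" using x(1) v_jac by (intro v_mult_le_1)
  ultimately show ?case by blast
qed

text \<open>The last of the merges has a Jacobi sum congruent to \<open>-p\<close>, hence to 0,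
  modulo \<open>p\<close>. For \<open>h = 1\<close> the exponent \<open>(p - 1) * p ^ i\<close> is
  divisible by \<open>q - 1\<close>, and the factor \<open>p\<close> comes from
  \<open>J_full\<close> instead.\<close>

lemma J_carry:
  "\<exists>x. v x \<le> pinv \<and> (\<forall>ks w. J (replicate p (p ^ i) @ ks) w = x * J (p ^ Suc i # ks) w)"
proof -
  have p1: "1 \<le> p - 1" using p_gt_1 by linarith
  obtain x where x: "v x \<le> 1" "\<And>ks w. J (replicate (p - 1) (p ^ i) @ ks) w = x * J ((p - 1) * p ^ i # ks) w"
    using J_replicate[OF p1 order_refl, of i] by blast
  have r: "J (replicate p (p ^ i) @ ks) w = x * J ((p - 1) * p ^ i # p ^ i # ks) w" for ks w
  proof -
    have "replicate p (p ^ i) = p ^ i # replicate (p - 1) (p ^ i)" using p_gt_1 by (cases p) auto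
    then have "J (replicate p (p ^ i) @ ks) w = J (p ^ i # (replicate (p - 1) (p ^ i) @ ks)) w" by simp
    also have "\<dots> = x * J (p ^ i # (p - 1) * p ^ i # ks) w" using x(2) by (rule J_Cons_cong)
    finally show ?thesis by (simp only: J_swap)
  qed
  show ?thesis
  proof (cases "h = 1")
    case True
    have "J ((p - 1) * p ^ i # p ^ i # ks) w = - of_nat q * J (p ^ Suc i # ks) w" for ks w
    proof -
      have "J ((p - 1) * p ^ i # p ^ i # ks) w = - of_nat q * J (p ^ i # ks) w"
        using True p_gt_1 by (intro J_full) (auto simp: Suc_le_eq)
      also have "J (p ^ i # ks) w = J (p ^ Suc i # ks) w"
      proof (intro J_Cons_chi chi_cong)
        have "[1 * p ^ i = p * p ^ i] (mod (q - 1))" using cong_q_1 True by (intro cong_mult) (auto intro: cong_sym)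
        then show "[p ^ i = p ^ Suc i] (mod (q - 1))" by simp
      qed (auto simp: Suc_le_eq)
      finally show ?thesis .
    qed
    then have "\<forall>ks w. J (replicate p (p ^ i) @ ks) w = (x * - of_nat q) * J (p ^ Suc i # ks) w"
      unfolding r by (simp add: mult.assoc del: J.simps)
    moreover have "v (x * - of_nat q) \<le> pinv" using x(1) True by (intro v_mult_le_1) auto
    ultimately show ?thesis by blast
  next
    case False
    then have "h \<ge> 2" using h_pos by simp
    then have "p ^ 2 \<le> q" using p_gt_1 by (intro power_increasing) auto
    then have pq: "p + 1 \<le> q" using p_gt_1 by (simp add: power2_eq_square) (metis Suc_leI le_trans less_le_trans n_less_m_mult_n p_pos)
    have nd: "\<not> (q - 1) dvd (p - 1) * p ^ i" "\<not> (q - 1) dvd p ^ i"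
      using not_dvd_small[of "p - 1" i] not_dvd_small[of 1 i] pq p_gt_1 by auto
    let ?j = "jac ((p - 1) * p ^ i) (p ^ i)"
    have "v (?j + of_nat (p - 1 + 1)) < 1" using pq p_gt_1 by (intro jac_p_power) auto
    then have "v (?j + of_nat p) < 1" using p_gt_1 by simp
    moreover have "v (of_nat p) < 1" using inv_p_less_1 by simp
    ultimately have "v (?j + of_nat p - of_nat p) < 1" by (rule v_diff_less)
    then have "v ?j \<le> pinv" by (intro discrete) simp
    then have "v (x * ?j) \<le> pinv" using x(1) by (intro v_mult_le_1)
    moreover have "J (replicate p (p ^ i) @ ks) w = (x * ?j) * J (p ^ Suc i # ks) w" for ks w
    proof -
      have "(p - 1) * p ^ i + p ^ i = p ^ Suc i" using p_gt_1 by (simp add: algebra_simps diff_mult_distrib)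
      then show ?thesis unfolding r J_merge[OF nd] by (simp add: mult.assoc del: J.simps)
    qed
    ultimately show ?thesis by blast
  qed
qed

text \<open>For \<open>e \<le> h\<close> the bound is integrality. Otherwise there are more than
  \<open>h * (p - 1)\<close> exponents, so some power of \<open>p\<close> occurs at least
  \<open>p\<close> times, and a carry gains one factor \<open>p\<close> while lowering
  \<open>length is * W 1\<close> by exactly \<open>q - 1\<close>.\<close>

lemma v_J_powers:
  assumes "set is \<subseteq> {..<h}" "(q - 1) * e \<le> length is * W 1"
  shows "v (J (map (\<lambda>i. p ^ i) is) w) \<le> pinv ^ (e - h)"
  using assms
proof (induction "length is" arbitrary: "is" e w rule: less_induct)
  case less
  show ?case
  proof (cases "e \<le> h")
    case True
    then show ?thesis using v_J by simp
  next
    case False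
    have "W 1 * ((p - 1) * e) \<le> W 1 * length is" using less.prems(2) W_1 by (simp add: ac_simps)
    then have len: "(p - 1) * e \<le> length is" using W_1_pos by simp
    have "\<exists>r<h. count_list is r \<ge> p"
    proof (rule ccontr)
      assume "\<not> ?thesis"
      then have "sum (count_list is) {..<h} \<le> (\<Sum>r<h. p - 1)" using p_gt_1 by (intro sum_mono) (auto simp: not_le)
      then have "length is \<le> h * (p - 1)" using sum_count_set[OF less.prems(1)] by simp
      then have "(p - 1) * e \<le> (p - 1) * h" using len by (metis le_trans mult.commute)
      then show False using False p_gt_1 by simp
    qed
    then obtain r where r: "r < h" "count_list is r \<ge> p" by blast
    have "replicate_mset p r \<subseteq># mset is" using r by (simp add: count_le_replicate_mset_subset_eq[symmetric] count_mset)
    then obtain M where M: "mset is = replicate_mset p r + M" by (metis subset_mset.le_iff_add)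
    obtain js where js: "mset js = M" using ex_mset by blast
    have ms: "mset is = mset (replicate p r @ js)" using M js by simp
    have lenis: "length is = p + length js" using arg_cong[OF ms, of size] by simp
    have setis: "set js \<subseteq> {..<h}" using less.prems(1) arg_cong[OF ms, of set_mset] by auto
    obtain x where x: "v x \<le> pinv" "\<And>ks w. J (replicate p (p ^ r) @ ks) w = x * J (p ^ Suc r # ks) w"
      using J_carry by blast
    \<comment> \<open>Exponents of \<open>p\<close> count modulo \<open>h\<close>, because on
      \<open>T\<close> the function \<open>chi\<close> depends only on the class modulo
      \<open>q - 1\<close> of a positive exponent.\<close>
    define is' where "is' = Suc r mod h # js"
    have "J (map (\<lambda>i. p ^ i) is) w = J (map (\<lambda>i. p ^ i) (replicate p r @ js)) w"
      using ms by (intro J_mset) (simp only: mset_map)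
    also have "\<dots> = x * J (p ^ Suc r # map (\<lambda>i. p ^ i) js) w" using x(2) by (simp only: map_append map_replicate)
    also have "J (p ^ Suc r # map (\<lambda>i. p ^ i) js) w = J (map (\<lambda>i. p ^ i) is') w"
      unfolding is'_def list.map by (intro J_Cons_chi chi_cong cong_p_power_mod) (auto simp: Suc_le_eq)
    finally have eq: "J (map (\<lambda>i. p ^ i) is) w = x * J (map (\<lambda>i. p ^ i) is') w" .
    have "v (J (map (\<lambda>i. p ^ i) is') w) \<le> pinv ^ (e - 1 - h)"
    proof (rule less.hyps)
      show "length is' < length is" using lenis p_gt_1 by (simp add: is'_def)
      show "set is' \<subseteq> {..<h}" using setis h_pos by (simp add: is'_def)
      have "(q - 1) * (e - 1) + (q - 1) = (q - 1) * e" using False by (cases e) auto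
      also have "\<dots> \<le> (length is' + (p - 1)) * W 1" using less.prems(2) lenis p_gt_1 by (simp add: is'_def add.commute)
      also have "\<dots> = length is' * W 1 + (q - 1)" using W_1 by (simp add: add_mult_distrib)
      finally show "(q - 1) * (e - 1) \<le> length is' * W 1" by simp
    qed
    then have "v (x * J (map (\<lambda>i. p ^ i) is') w) \<le> pinv * pinv ^ (e - 1 - h)"
      using x(1) by (intro v_mult_le)
    also have "\<dots> = pinv ^ Suc (e - 1 - h)" by simp
    also have "Suc (e - 1 - h) = e - h" using False by simp
    finally show ?thesis unfolding eq .
  qed
qed

text \<open>An exponent \<open>p ^ i * k'\<close> with \<open>k'\<close> prime to \<open>p\<close> splits off
  \<open>p ^ i\<close> without carry, that is, at the cost of a unit; so all exponents may be taken to be powers of \<open>p\<close>.\<close>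
lemma v_J_bound:
  assumes "\<And>k. k \<in> set ks \<Longrightarrow> 1 \<le> k \<and> k \<le> q - 1" "(q - 1) * e \<le> sum_list (map W ks)"
  shows "v (J ks w) \<le> pinv ^ (e - h)"
  using assms
proof (induction "sum_list (map (\<lambda>k. k - 1) ks)" arbitrary: ks rule: less_induct)
  case less
  show ?case
  proof (cases "\<forall>k\<in>set ks. \<exists>i. k = p ^ i")
    case True
    have "\<forall>k. \<exists>i. k \<in> set ks \<longrightarrow> i < h \<and> k = p ^ i"
    proof
      fix k
      show "\<exists>i. k \<in> set ks \<longrightarrow> i < h \<and> k = p ^ i"
      proof (cases "k \<in> set ks")
        case k: True
        then obtain i where i: "k = p ^ i" using True by blast
        have "k < p ^ h" using less.prems(1)[OF k] q_gt_1 by linarith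
        then have "p ^ i < p ^ h" unfolding i .
        then have "i < h" using p_gt_1 power_less_imp_less_exp by blast
        then show ?thesis using i by blast
      qed blast
    qed
    then obtain g where g: "\<And>k. k \<in> set ks \<Longrightarrow> g k < h \<and> k = p ^ g k" by metis
    have ks: "ks = map (\<lambda>i. p ^ i) (map g ks)" using g by (simp add: map_idI comp_def)
    have "sum_list (map W ks) = length ks * W 1"
    proof -
      have m: "map W ks = map (\<lambda>_. W 1) ks" using g W_p_power by (metis (no_types, lifting) map_eq_conv)
      show ?thesis unfolding m by (simp add: sum_list_triv)
    qed
    then have "v (J (map (\<lambda>i. p ^ i) (map g ks)) w) \<le> pinv ^ (e - h)"
      using g less.prems(2) by (intro v_J_powers) auto
    then show ?thesis using ks by metis
  next
    case False
    then obtain k where k: "k \<in> set ks" "\<And>i. k \<noteq> p ^ i" by blast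
    have kb: "1 \<le> k" "k \<le> q - 1" using less.prems(1) k by auto
    obtain as bs where ks: "ks = as @ k # bs" using k(1) by (meson split_list)
    have "k \<noteq> 0" "\<not> is_unit p" using kb p_gt_1 by auto
    then obtain k' where k': "k = p ^ multiplicity p k * k'" "\<not> p dvd k'"
      using multiplicity_decompose'[of k p] by metis
    define i where "i = multiplicity p k"
    have k2: "k = p ^ i * k'" using k'(1) by (simp only: i_def)
    have k'0: "k' \<noteq> 0" using k2 kb by (cases "k' = 0") auto
    moreover have "k' \<noteq> 1" using k2 k(2)[of i] by (cases "k' = 1") auto
    ultimately have k'2: "k' \<ge> 2" by simp
    define a where "a = (k' - 1) * p ^ i"
    have a: "k = a + p ^ i" using k'2 k2 by (cases k') (auto simp: a_def algebra_simps)
    have "k' \<le> k" using k2 by (simp add: Suc_le_eq)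
    then have k'q: "1 \<le> k' - 1" "k' - 1 \<le> q - 2" "k' - 1 < q - 1" using k'2 kb by auto
    have ap: "a \<ge> 1" using k'q by (simp add: a_def Suc_le_eq)
    have nda: "\<not> (q - 1) dvd a" unfolding a_def using k'q by (intro not_dvd_small)
    have q3: "1 < q - 1" using k'q by simp
    have ndb: "\<not> (q - 1) dvd p ^ i" using not_dvd_small[of 1 i] q3 by simp
    have "v (jac a (p ^ i) + of_nat (k' - 1 + 1)) < 1" unfolding a_def using k'q by (intro jac_p_power)
    then have j: "v (jac a (p ^ i) + of_nat k') < 1" using k'2 by simp
    have "v (of_nat k') = 1" using k'(2) v_of_nat_less_1_iff[of k'] v_of_nat_le[of k'] by linarith
    then have "v (jac a (p ^ i)) = 1"
      using v_eq_if_less[of "of_nat k'" "- jac a (p ^ i)"] j by (simp add: add.commute)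
    moreover have "J (a # p ^ i # as @ bs) w = jac a (p ^ i) * J ks w"
    proof -
      have "J (a # p ^ i # as @ bs) w = jac a (p ^ i) * J (k # as @ bs) w" unfolding a by (rule J_merge[OF nda ndb])
      then show ?thesis by (simp only: ks J_move)
    qed
    ultimately have "v (J ks w) = v (J (a # p ^ i # as @ bs) w)" by (simp only: v_mult)
    also have "\<dots> \<le> pinv ^ (e - h)"
    proof (rule less.hyps)
      \<comment> \<open>Splitting one exponent into two positive parts keeps the sum of the
        exponents and lowers this measure by 1.\<close>
      show "sum_list (map (\<lambda>k. k - 1) (a # p ^ i # as @ bs)) < sum_list (map (\<lambda>k. k - 1) ks)"
      proof -
        have "p ^ i \<ge> 1" by (simp add: Suc_le_eq)
        then have "(a - 1) + (p ^ i - 1) < k - 1" using a ap by linarith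
        then show ?thesis unfolding ks by simp
      qed
      show "\<And>k. k \<in> set (a # p ^ i # as @ bs) \<Longrightarrow> 1 \<le> k \<and> k \<le> q - 1"
      proof -
        fix l assume l: "l \<in> set (a # p ^ i # as @ bs)"
        have "p ^ i \<ge> 1" by (simp add: Suc_le_eq)
        then have "1 \<le> a \<and> a \<le> q - 1" "1 \<le> p ^ i \<and> p ^ i \<le> q - 1" using kb a ap by linarith+
        moreover have "1 \<le> l \<and> l \<le> q - 1" if "l \<in> set as \<union> set bs"
          using that less.prems(1)[of l] unfolding ks by auto
        ultimately show "1 \<le> l \<and> l \<le> q - 1" using l by auto
      qed
      have "W k \<le> W a + W (p ^ i)" unfolding a by (rule W_add_le)
      then show "(q - 1) * e \<le> sum_list (map W (a # p ^ i # as @ bs))" using less.prems(2) unfolding ks by simp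
    qed
    finally show ?thesis .
  qed
qed

lemma J_scale:
  assumes "t \<in> T" "t \<noteq> 0" "\<And>k. k \<in> set ks \<Longrightarrow> k \<ge> 1"
  shows "J ks (t * w) = inverse t ^ sum_list ks * J ks w"
  using assms(3)
proof (induction ks arbitrary: w)
  case Nil
  then show ?case using Teich_v[OF assms(1,2)] by (simp add: v_mult)
next
  case (Cons k ks)
  have chi: "chi k (t * s) = inverse t ^ k * chi k s" for s
  proof (cases "s = 0 \<and> (q - 1) dvd k")
    case True
    then have "inverse t ^ k = 1" using Teich_unit_power[OF Teich_inverse[OF assms(1)]] assms(2)
      by (auto elim!: dvdE simp: power_mult)
    then show ?thesis using True Cons.prems[of k] by (simp add: chi_def)
  qed (use assms in \<open>auto simp: chi_def power_mult_distrib\<close>)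
  have "J (k # ks) (t * w) = (\<Sum>s\<in>T. chi k (t * s) * J ks (t * w - t * s))"
    unfolding J.simps by (rule sum.reindex_bij_betw[OF bij_Teich_mult[OF assms(1,2)], symmetric])
  also have "\<dots> = (\<Sum>s\<in>T. inverse t ^ (k + sum_list ks) * (chi k s * J ks (w - s)))"
  proof (intro sum.cong refl)
    fix s
    have "J ks (t * w - t * s) = inverse t ^ sum_list ks * J ks (w - s)"
      unfolding right_diff_distrib[symmetric] using Cons by simp
    then show "chi k (t * s) * J ks (t * w - t * s) = inverse t ^ (k + sum_list ks) * (chi k s * J ks (w - s))"
      by (simp add: chi power_add)
  qed
  finally show ?case by (simp add: sum_distrib_left)
qed

text \<open>The condition on the sum of the variables is homogeneous at 0, so scaling all of them by
  some root of unity multiplies \<open>J ks 0\<close> by a factor other than 1.\<close>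

lemma J_0_eq_0:
  assumes "\<And>k. k \<in> set ks \<Longrightarrow> k \<ge> 1" "\<not> (q - 1) dvd sum_list ks" shows "J ks 0 = 0"
proof -
  obtain t where t: "t \<in> T" "t \<noteq> 0" "t ^ sum_list ks \<noteq> 1" using Teich_nontrivial_power[OF assms(2)] by blast
  have "J ks 0 = inverse t ^ sum_list ks * J ks 0" using J_scale[OF t(1,2) assms(1), of ks 0] by simp
  then show ?thesis using t(2,3) by (simp add: power_inverse field_simps)
qed

text \<open>Powers from 1 to \<open>q - 1\<close> all vanish at \<open>t = 0\<close>, so the
  constant term of an interpolating polynomial is the value at 0. The second indicator on the right,
  produced by the correction in \<open>chi\<close>, subtracts exactly this value.\<close>

lemma chi_orthogonal:
  assumes s: "s \<in> T" and t: "t \<in> T"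
  shows "(\<Sum>k=1..q-1. t ^ k * chi k s) = of_nat (q - 1) * ((if s = t then 1 else 0) - (if s = 0 then 1 else 0))"
proof -
  consider "t = 0" | "t \<noteq> 0" "s = 0" | "t \<noteq> 0" "s \<noteq> 0" by blast
  then show ?thesis
  proof cases
    case 1
    then show ?thesis by (auto simp: power_0_left intro!: sum.neutral)
  next
    case 2
    have "(\<Sum>k=1..q-1. t ^ k * chi k s) = (\<Sum>k=1..q-1. if k = q - 1 then - of_nat (q - 1) else 0)"
    proof (intro sum.cong refl)
      fix k assume k: "k \<in> {1..q-1}"
      show "t ^ k * chi k s = (if k = q - 1 then - of_nat (q - 1) else 0)"
      proof (cases "k = q - 1")
        case True
        then show ?thesis using 2 k Teich_unit_power[OF t] by (simp add: chi_def power_0_left)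
      next
        case False
        then have "\<not> (q - 1) dvd k" using k by (intro nat_dvd_not_less) auto
        then show ?thesis using 2 k False by (simp add: chi_plain power_0_left del: One_nat_def)
      qed
    qed
    also have "\<dots> = - of_nat (q - 1)" using q_gt_1 by (simp add: sum.delta)
    finally show ?thesis using 2 by simp
  next
    case 3
    define x where "x = t * inverse s"
    have x: "x \<in> T" "x \<noteq> 0" using 3 s t by (auto simp: x_def intro!: Teich_mult Teich_inverse)
    have "(\<Sum>k=1..q-1. t ^ k * chi k s) = (\<Sum>k=1..q-1. x ^ k)"
      using 3 by (intro sum.cong) (auto simp: chi_def x_def power_mult_distrib)
    also have "\<dots> = (\<Sum>k<q-1. x ^ Suc k)"
      by (rule sum.reindex_bij_witness[where i = Suc and j = "\<lambda>k. k - 1"]) auto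
    also have "\<dots> = x * (\<Sum>k<q-1. x ^ k)" by (simp add: sum_distrib_left)
    also have "\<dots> = of_nat (q - 1) * (if s = t then 1 else 0)"
    proof (cases "s = t")
      case True
      then show ?thesis using 3 by (simp add: x_def)
    next
      case False
      then have "x \<noteq> 1" using 3 by (auto simp: x_def field_simps)
      moreover have "(x - 1) * (\<Sum>k<q-1. x ^ k) = 0"
        using power_diff_1_eq[of x "q - 1"] Teich_unit_power[OF x] by simp
      ultimately show ?thesis using False by simp
    qed
    finally show ?thesis using 3 by simp
  qed
qed

lemma Teich_expand:
  assumes t: "t \<in> T"
  shows "f t = f 0 + (\<Sum>k=1..q-1. t ^ k * ((\<Sum>s\<in>T. chi k s * f s) / of_nat (q - 1)))"
proof -
  have "(\<Sum>k=1..q-1. t ^ k * (\<Sum>s\<in>T. chi k s * f s)) = (\<Sum>s\<in>T. \<Sum>k=1..q-1. t ^ k * chi k s * f s)"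
    by (subst sum.swap) (simp add: sum_distrib_left mult.assoc)
  also have "\<dots> = (\<Sum>s\<in>T. (\<Sum>k=1..q-1. t ^ k * chi k s) * f s)" by (simp add: sum_distrib_right)
  also have "\<dots> = (\<Sum>s\<in>T. of_nat (q - 1) * ((if s = t then 1 else 0) - (if s = 0 then 1 else 0)) * f s)"
    by (intro sum.cong refl) (simp only: chi_orthogonal[OF _ t])
  also have "\<dots> = of_nat (q - 1) * (\<Sum>s\<in>T. (if s = t then f s else 0) - (if s = 0 then f s else 0))"
    unfolding sum_distrib_left by (intro sum.cong) auto
  also have "\<dots> = of_nat (q - 1) * (f t - f 0)"
    using t by (simp add: sum_subtractf sum.delta finite_Teich)
  finally have "(\<Sum>k=1..q-1. t ^ k * (\<Sum>s\<in>T. chi k s * f s)) = of_nat (q - 1) * (f t - f 0)" .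
  moreover have "(of_nat (q - 1) :: 'k) \<noteq> 0" unfolding of_nat_eq_0_iff using q_gt_1 by simp
  ultimately show ?thesis by (simp add: sum_divide_distrib[symmetric] times_divide_eq_right field_simps del: of_nat_diff)
qed

text \<open>One summand is peeled off the argument of \<open>J\<close> at the price of one more
  character. Iteration expands the indicator \<open>J []\<close> of a sum in monomials of the
  summands.\<close>

lemma J_expand:
  assumes "t \<in> T"
  shows "J ks (w - t) = J ks w + (\<Sum>k=1..q-1. t ^ k * (J (k # ks) w / of_nat (q - 1)))"
  using Teich_expand[OF assms, of "\<lambda>t. J ks (w - t)"] by simp

lemma v_q_minus_1: "v (of_nat (q - 1)) = 1"
proof -
  have "\<not> p dvd q - 1"
  proof
    assume "p dvd q - 1"
    moreover have "p dvd q" using h_pos by (simp add: dvd_power)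
    ultimately have "p dvd q - (q - 1)" by (rule dvd_diff_nat[rotated])
    then show False using q_gt_1 p_gt_1 by simp
  qed
  then show ?thesis using v_of_nat_less_1_iff[of "q - 1"] v_of_nat_le[of "q - 1"] by linarith
qed

end

section \<open>Functions with controlled character sums\<close>

definition mon :: "('n::finite \<Rightarrow> nat) \<Rightarrow> ('n \<Rightarrow> 'a::comm_ring_1) \<Rightarrow> 'a" where
  "mon u X = (\<Prod>l\<in>UNIV. X l ^ u l)"

lemma mon_0 [simp]: "mon (\<lambda>_. 0) X = 1" by (simp add: mon_def)
lemma mon_add: "mon (\<lambda>l. u l + w l) X = mon u X * mon w X"
  by (simp add: mon_def power_add prod.distrib)
lemma mon_mult: "mon (\<lambda>l. k * u l) X = mon u X ^ k"
  by (simp add: mon_def mult.commute[of k] power_mult prod_power_distrib)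

context unramified_extension
begin

definition TT :: "('n \<Rightarrow> 'k) set" where "TT = {X. \<forall>l. X l \<in> T}"

lemma TT_eq_PiE: "TT = (UNIV \<rightarrow>\<^sub>E T)"
  by (auto simp: TT_def PiE_def)

lemma finite_TT: "finite (TT :: ('n::finite \<Rightarrow> 'k) set)"
  unfolding TT_eq_PiE by (intro finite_PiE) (auto simp: finite_Teich)

lemma card_TT: "card (TT :: ('n::finite \<Rightarrow> 'k) set) = q ^ CARD('n)"
  unfolding TT_eq_PiE by (subst card_PiE) (auto simp: card_Teich)

lemma mon_Teich: "X \<in> TT \<Longrightarrow> mon u X \<in> T"
  unfolding mon_def TT_def by (intro Teich_prod Teich_power) auto

text \<open>Up to \<open>x ^ q = x\<close> on \<open>T\<close>, the \<open>p ^ i\<close>-th power of the monomial \<open>u\<close> is a monomial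
  with the same variables and degree at most \<open>N\<close>.\<close>
definition twist :: "nat \<Rightarrow> ('n::finite \<Rightarrow> nat) \<Rightarrow> nat \<Rightarrow> bool" where
  "twist i u N \<longleftrightarrow> (\<exists>U. (\<forall>l. U l = 0 \<longleftrightarrow> u l = 0) \<and> (\<forall>l. [U l = p ^ i * u l] (mod (q - 1))) \<and> (\<Sum>l\<in>UNIV. U l) \<le> N)"

lemma twist_0: "twist i (\<lambda>_. 0) N"
  unfolding twist_def by (intro exI[of _ "\<lambda>_. 0"]) auto
lemma twist_mono: "twist i u N \<Longrightarrow> N \<le> N' \<Longrightarrow> twist i u N'"
  unfolding twist_def by (meson order_trans)
lemma twist_add:
  assumes "twist i u N" "twist i w M" shows "twist i (\<lambda>l. u l + w l) (N + M)"
proof -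
  obtain U where U: "\<And>l. U l = 0 \<longleftrightarrow> u l = 0" "\<And>l. [U l = p ^ i * u l] (mod (q - 1))" "(\<Sum>l\<in>UNIV. U l) \<le> N"
    using assms(1) unfolding twist_def by blast
  obtain V where V: "\<And>l. V l = 0 \<longleftrightarrow> w l = 0" "\<And>l. [V l = p ^ i * w l] (mod (q - 1))" "(\<Sum>l\<in>UNIV. V l) \<le> M"
    using assms(2) unfolding twist_def by blast
  have "[U l + V l = p ^ i * (u l + w l)] (mod (q - 1))" for l
    unfolding distrib_left by (intro cong_add U V)
  then show ?thesis unfolding twist_def using U V
    by (intro exI[of _ "\<lambda>l. U l + V l"]) (auto simp: sum.distrib add_mono)
qed
lemma twist_rep:
  assumes "(\<Sum>l\<in>UNIV. u l) \<le> D" shows "twist i (\<lambda>l. k * u l) (D * rep (p ^ i * k))"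
proof -
  have "[rep (p ^ i * k) * u l = p ^ i * (k * u l)] (mod (q - 1))" for l
    unfolding mult.assoc[symmetric] by (intro cong_mult cong_rep cong_refl)
  moreover have "(\<Sum>l\<in>UNIV. rep (p ^ i * k) * u l) \<le> D * rep (p ^ i * k)"
    unfolding sum_distrib_left[symmetric] using assms by (simp add: mult.commute mult_le_mono2)
  ultimately show ?thesis unfolding twist_def
    using p_gt_1 by (intro exI[of _ "\<lambda>l. rep (p ^ i * k) * u l"]) auto
qed

text \<open>\<open>B i\<close> records the \<open>p\<close>-adic valuation of the coefficient that is attributed to the \<open>i\<close>-th Frobenius
  twist. Bounding each twist separately gives the valuation with respect to \<open>q\<close> and not only \<open>p\<close>.\<close>
inductive weighted :: "nat \<Rightarrow> nat \<Rightarrow> (('n::finite \<Rightarrow> 'k) \<Rightarrow> 'k) \<Rightarrow> bool" for D \<Delta> where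
  weighted_term: "\<lbrakk>v c \<le> pinv ^ (\<Sum>i<h. B i); \<And>i. i < h \<Longrightarrow> twist i u ((q - 1) * (D * B i + \<Delta>));
     \<And>X. X \<in> TT \<Longrightarrow> \<phi> X = c * mon u X\<rbrakk> \<Longrightarrow> weighted D \<Delta> \<phi>"
| weighted_add: "\<lbrakk>weighted D \<Delta> \<phi>; weighted D \<Delta> \<psi>; \<And>X. X \<in> TT \<Longrightarrow> \<chi> X = \<phi> X + \<psi> X\<rbrakk> \<Longrightarrow> weighted D \<Delta> \<chi>"

lemma weighted_0: "(\<And>X. X \<in> TT \<Longrightarrow> \<phi> X = 0) \<Longrightarrow> weighted D \<Delta> \<phi>"
  by (rule weighted_term[of 0 "\<lambda>_. 0" "\<lambda>_. 0"]) (auto simp: twist_0)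

lemma weighted_cong: "weighted D \<Delta> \<phi> \<Longrightarrow> (\<And>X. X \<in> TT \<Longrightarrow> \<psi> X = \<phi> X) \<Longrightarrow> weighted D \<Delta> \<psi>"
  by (rule weighted_add[OF _ weighted_0[of "\<lambda>_. 0"]]) auto

lemma weighted_sum: "(\<And>i. i \<in> I \<Longrightarrow> weighted D \<Delta> (\<phi> i)) \<Longrightarrow> weighted D \<Delta> (\<lambda>X. \<Sum>i\<in>I. \<phi> i X)"
  by (induction I rule: infinite_finite_induct) (auto intro: weighted_0 weighted_add)

lemma weighted_mult:
  assumes "weighted D \<Delta> \<phi>" "weighted D \<Delta>' \<psi>" shows "weighted D (\<Delta> + \<Delta>') (\<lambda>X. \<phi> X * \<psi> X)"
  using assms(1)
proof (induction rule: weighted.induct)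
  case (weighted_term c B u \<phi>)
  note 1 = weighted_term
  show ?case using assms(2)
  proof (induction rule: weighted.induct)
    case (weighted_term c' B' u' \<psi>)
    show ?case
    proof (rule weighted.weighted_term[of "c * c'" "\<lambda>i. B i + B' i" "\<lambda>l. u l + u' l"])
      show "v (c * c') \<le> pinv ^ (\<Sum>i<h. B i + B' i)"
        using v_mult_le[OF 1(1) weighted_term(1)] by (simp add: sum.distrib power_add)
      fix i assume i: "i < h"
      have "(q - 1) * (D * B i + \<Delta>) + (q - 1) * (D * B' i + \<Delta>') = (q - 1) * (D * (B i + B' i) + (\<Delta> + \<Delta>'))"
        by (simp add: algebra_simps)
      then show "twist i (\<lambda>l. u l + u' l) ((q - 1) * (D * (B i + B' i) + (\<Delta> + \<Delta>')))"
        using twist_add[OF 1(2)[OF i] weighted_term(2)[OF i]] by simp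
    next
      fix X :: "'a \<Rightarrow> 'k" assume "X \<in> TT"
      then show "\<phi> X * \<psi> X = c * c' * mon (\<lambda>l. u l + u' l) X" using 1(3) weighted_term(3) by (simp add: mon_add)
    qed
  next
    case (weighted_add \<psi>1 \<psi>2 \<chi>)
    show ?case by (rule weighted.weighted_add[OF weighted_add.IH]) (simp add: weighted_add.hyps algebra_simps)
  qed
next
  case (weighted_add \<phi>1 \<phi>2 \<chi>)
  show ?case by (rule weighted.weighted_add[OF weighted_add.IH]) (simp add: weighted_add.hyps algebra_simps)
qed

lemma weighted_prod:
  fixes m :: nat
  shows "(\<And>s. s < m \<Longrightarrow> weighted D (\<Delta> s) (\<phi> s)) \<Longrightarrow> weighted D (\<Sum>s<m. \<Delta> s) (\<lambda>X. \<Prod>s<m. \<phi> s X)"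
proof (induction m)
  case 0
  show ?case by (rule weighted_term[of 1 "\<lambda>_. 0" "\<lambda>_. 0"]) (auto simp: twist_0)
next
  case (Suc m)
  then show ?case using weighted_mult[of D "\<Sum>s<m. \<Delta> s" "\<lambda>X. \<Prod>s<m. \<phi> s X" "\<Delta> m" "\<phi> m"] by simp
qed

text \<open>In a surviving monomial all exponents are divisible by \<open>q - 1\<close>, and each of
  the \<open>z\<close> absent variables yields a factor \<open>q\<close>. Twist \<open>i\<close>
  allows at most \<open>D * B i + \<Delta>\<close> variables to be present, so
  \<open>B i + z \<ge> N\<close>; summation over the \<open>h\<close> twists gives
  \<open>h * N\<close>. The hypothesis on \<open>N\<close> is a ceiling in the form in which it is
  applied.\<close>

lemma v_sum_weighted:
  fixes \<phi> :: "('n::finite \<Rightarrow> 'k) \<Rightarrow> 'k"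
  assumes "weighted D \<Delta> \<phi>" and D: "D \<ge> 1" and N: "\<And>b. CARD('n) \<le> D * b + \<Delta> \<Longrightarrow> N \<le> b"
  shows "v (\<Sum>X\<in>TT. \<phi> X) \<le> pinv ^ (h * N)"
  using assms(1)
proof (induction rule: weighted.induct)
  case (weighted_term c B u \<phi>)
  have "(\<Sum>X\<in>TT. \<phi> X) = c * (\<Sum>X\<in>TT. mon u X)" using weighted_term(3) by (simp add: sum_distrib_left)
  also have "(\<Sum>X\<in>TT. mon u X) = (\<Prod>l\<in>UNIV. \<Sum>t\<in>T. t ^ u l)"
    unfolding mon_def TT_eq_PiE by (rule prod_sum_PiE[symmetric]) (auto simp: finite_Teich)
  finally have S: "(\<Sum>X\<in>TT. \<phi> X) = c * (\<Prod>l\<in>UNIV. \<Sum>t\<in>T. t ^ u l)" .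
  show ?case
  proof (cases "\<forall>l. (q - 1) dvd u l")
    case False
    then obtain l where "\<not> (q - 1) dvd u l" by blast
    then have "(\<Sum>t\<in>T. t ^ u l) = 0" using sum_Teich_power[of "u l"] by (cases "u l = 0") auto
    then have "(\<Prod>l\<in>UNIV. \<Sum>t\<in>T. t ^ u l) = 0" by (intro prod_zero) auto
    then have "(\<Sum>X\<in>TT. \<phi> X) = 0" using S by (simp only: mult_zero_right)
    then show ?thesis by simp
  next
    case True
    define z where "z = card {l. u l = 0}"
    have "v (\<Prod>l\<in>UNIV. \<Sum>t\<in>T. t ^ u l) = (\<Prod>l\<in>UNIV. v (\<Sum>t\<in>T. t ^ u l))" by (rule v_prod)
    also have "\<dots> \<le> (\<Prod>l\<in>UNIV. if u l = 0 then pinv ^ h else 1)"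
    proof (intro prod_mono conjI v_nonneg)
      fix l
      show "v (\<Sum>t\<in>T. t ^ u l) \<le> (if u l = 0 then pinv ^ h else 1)"
      proof (cases "u l = 0")
        case True
        then show ?thesis using v_of_nat_dvd[of h q] sum_Teich_power[of "u l"] by (simp del: of_nat_power)
      next
        case False
        then have "(\<Sum>t\<in>T. t ^ u l) = of_nat (q - 1)" using sum_Teich_power[of "u l"] True by simp
        then show ?thesis using False v_of_nat_le[of "q - 1"] by (simp del: v_of_nat_le)
      qed
    qed
    also have "\<dots> = pinv ^ (h * z)"
      by (simp add: prod.If_cases z_def power_mult)
    finally have "v (c * (\<Prod>l\<in>UNIV. \<Sum>t\<in>T. t ^ u l)) \<le> pinv ^ (\<Sum>i<h. B i) * pinv ^ (h * z)"
      using weighted_term(1) by (intro v_mult_le)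
    also have "\<dots> = pinv ^ (\<Sum>i<h. B i + z)" by (simp add: sum.distrib power_add)
    also have "\<dots> \<le> pinv ^ (h * N)"
    proof (rule inv_p_power_mono)
      have "N \<le> B i + z" if i: "i < h" for i
      proof (rule N)
        obtain U where U: "\<And>l. U l = 0 \<longleftrightarrow> u l = 0" "\<And>l. [U l = p ^ i * u l] (mod (q - 1))"
            "(\<Sum>l\<in>UNIV. U l) \<le> (q - 1) * (D * B i + \<Delta>)"
          using weighted_term(2)[OF i] unfolding twist_def by blast
        have "(\<Sum>l\<in>UNIV. if u l = 0 then 0 else q - 1) \<le> (\<Sum>l\<in>UNIV. U l)"
        proof (intro sum_mono)
          fix l
          have "(q - 1) dvd U l" using True by (subst cong_dvd_iff[OF U(2)]) simp
          then show "(if u l = 0 then 0 else q - 1) \<le> U l" using U(1)[of l] by (auto intro: dvd_imp_le)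
        qed
        also have "(\<Sum>l\<in>UNIV. if u l = 0 then 0 else q - 1) = (q - 1) * card {l. u l \<noteq> 0}"
          by (simp add: sum.If_cases Collect_neg_eq[symmetric])
        finally have "(q - 1) * card {l. u l \<noteq> 0} \<le> (q - 1) * (D * B i + \<Delta>)" using U(3) by linarith
        then have "card {l. u l \<noteq> 0} \<le> D * B i + \<Delta>" using q_gt_1 by simp
        moreover have "CARD('n) = z + card {l. u l \<noteq> 0}"
        proof -
          have "card ({l. u l = 0} \<union> {l. u l \<noteq> 0}) = z + card {l. u l \<noteq> 0}"
            unfolding z_def by (intro card_Un_disjoint) auto
          moreover have "{l. u l = 0} \<union> {l. u l \<noteq> 0} = UNIV" by auto
          ultimately show ?thesis by simp
        qed
        moreover have "z \<le> D * z" using D by simp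
        ultimately show "CARD('n) \<le> D * (B i + z) + \<Delta>" unfolding distrib_left by linarith
      qed
      then have "(\<Sum>i<h. N) \<le> (\<Sum>i<h. B i + z)" by (intro sum_mono) auto
      then show "h * N \<le> (\<Sum>i<h. B i + z)" by simp
    qed
    finally show ?thesis unfolding S .
  qed
next
  case (weighted_add \<phi>1 \<phi>2 \<chi>)
  have "(\<Sum>X\<in>TT. \<chi> X) = (\<Sum>X\<in>TT. \<phi>1 X) + (\<Sum>X\<in>TT. \<phi>2 X)"
    using weighted_add.hyps by (simp add: sum.distrib)
  then show ?case using weighted_add.IH v_add_le by simp
qed

section \<open>Expansion of an indicator into weighted monomials\<close>

lemma sum_rep_W: "(\<Sum>i<h. \<Sum>k\<leftarrow>ks. rep (p ^ i * k)) = (\<Sum>k\<leftarrow>ks. W k)"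
  by (induction ks) (auto simp: W_def sum.distrib)

lemma cong_sum_rep: "[(\<Sum>k\<leftarrow>ks. rep (p ^ i * k)) = p ^ i * sum_list ks] (mod (q - 1))"
proof (induction ks)
  case (Cons k ks)
  then show ?case using cong_add[OF cong_rep[of "p ^ i * k"] Cons] by (simp add: distrib_left)
qed simp

text \<open>Unless \<open>J ks 0\<close> vanishes or \<open>ks\<close> is empty, the twisted
  exponents have sums \<open>(q - 1) * A i\<close> with \<open>A i \<ge> 1\<close>. Stickelberger's
  estimate, with its loss of \<open>h\<close>, provides the valuation as the sum of the
  \<open>A i - 1\<close>, so twist \<open>i\<close> is credited with \<open>A i - 1\<close>; the
  unit left over in each twist is the single \<open>D'\<close> of the degree bound.\<close>

lemma weighted_J_const:
  assumes ks: "\<And>k. k \<in> set ks \<Longrightarrow> 1 \<le> k \<and> k \<le> q - 1" and c: "v c \<le> 1"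
    and u: "\<And>i. i < h \<Longrightarrow> twist i u (D' * (\<Sum>k\<leftarrow>ks. rep (p ^ i * k)))" and D: "D' \<le> D"
  shows "weighted D D' (\<lambda>X. c * mon u X * J ks 0)"
proof -
  define S where "S i = (\<Sum>k\<leftarrow>ks. rep (p ^ i * k))" for i
  consider "ks = []" | "\<not> (q - 1) dvd sum_list ks" | "ks \<noteq> []" "(q - 1) dvd sum_list ks" by blast
  then show ?thesis
  proof cases
    case 1
    show ?thesis
      by (rule weighted_term[of c "\<lambda>_. 0" u]) (use 1 c u in \<open>auto intro: twist_mono\<close>)
  next
    case 2
    then show ?thesis using ks by (intro weighted_0) (simp add: J_0_eq_0)
  next
    case 3
    have "(q - 1) dvd S i" for i
      unfolding S_def using 3 by (subst cong_dvd_iff[OF cong_sum_rep]) simp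
    then have S: "S i = (q - 1) * (S i div (q - 1))" for i by simp
    define A where "A i = S i div (q - 1)" for i
    have SA: "S i = (q - 1) * A i" for i using S A_def by simp
    \<comment> \<open>Positivity makes the truncated subtraction \<open>A i - 1\<close>
      exact.\<close>
    have A1: "A i \<ge> 1" for i
    proof -
      obtain k ks' where k: "ks = k # ks'" using 3(1) by (cases ks) auto
      have "p ^ i * k \<noteq> 0" using ks[of k] k by simp
      then have "rep (p ^ i * k) \<noteq> 0" by simp
      then have "S i \<noteq> 0" unfolding S_def k by simp
      then show ?thesis using SA[of i] by (cases "A i") auto
    qed
    have "(q - 1) * (\<Sum>i<h. A i) = (\<Sum>k\<leftarrow>ks. W k)"
      unfolding sum_distrib_left SA[symmetric] S_def by (rule sum_rep_W)
    then have "v (J ks 0) \<le> pinv ^ ((\<Sum>i<h. A i) - h)" using ks by (intro v_J_bound) auto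
    also have "(\<Sum>i<h. A i) - h = (\<Sum>i<h. A i - 1)" using A1 by (subst sum_subtractf_nat) auto
    finally have "v (c * J ks 0) \<le> pinv ^ (\<Sum>i<h. A i - 1)" using c by (intro v_mult_le_1)
    then show ?thesis
    proof (rule weighted_term[of "c * J ks 0" "\<lambda>i. A i - 1" u])
      fix i assume i: "i < h"
      have "D' * A i = D' * (A i - 1) + D'" using A1[of i] by (cases "A i") auto
      also have "\<dots> \<le> D * (A i - 1) + D'" using D by simp
      finally have "(q - 1) * (D' * A i) \<le> (q - 1) * (D * (A i - 1) + D')" by (rule mult_le_mono2)
      then have "D' * S i \<le> (q - 1) * (D * (A i - 1) + D')" unfolding SA by (simp only: mult.left_commute)
      then show "twist i u ((q - 1) * (D * (A i - 1) + D'))" using u[OF i] twist_mono unfolding S_def by blast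
    qed auto
  qed
qed

text \<open>The terms of the sum are peeled off one at a time; \<open>u\<close> and
  \<open>ks\<close> accumulate the powers chosen so far. The hypothesis on \<open>twist\<close> is
  the invariant that ties the degree of the accumulated monomial to the accumulated
  characters.\<close>

lemma weighted_J:
  assumes "\<And>a w. (a, w) \<in> set ms \<Longrightarrow> a \<in> T \<and> (\<Sum>l\<in>UNIV. w l) \<le> D'"
    and "\<And>k. k \<in> set ks \<Longrightarrow> 1 \<le> k \<and> k \<le> q - 1" and "v c \<le> 1"
    and "\<And>i. i < h \<Longrightarrow> twist i u (D' * (\<Sum>k\<leftarrow>ks. rep (p ^ i * k)))" and "D' \<le> D"
  shows "weighted D D' (\<lambda>X. c * mon u X * J ks (- (\<Sum>(a, w)\<leftarrow>ms. a * mon w X)))"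
  using assms(1-4)
proof (induction ms arbitrary: ks c u)
  case Nil
  then show ?case using weighted_J_const[OF Nil(2-4) assms(5)] by simp
next
  case (Cons aw ms)
  obtain a w where aw: "aw = (a, w)" by fastforce
  have a: "a \<in> T" and w: "(\<Sum>l\<in>UNIV. w l) \<le> D'" using Cons.prems(1)[of a w] aw by auto
  define R where "R X = - (\<Sum>(a, w)\<leftarrow>ms. a * mon w X)" for X
  have ms: "\<And>a w. (a, w) \<in> set ms \<Longrightarrow> a \<in> T \<and> (\<Sum>l\<in>UNIV. w l) \<le> D'" using Cons.prems(1) by auto
  have 1: "weighted D D' (\<lambda>X. c * mon u X * J ks (R X))"
    unfolding R_def using ms Cons.prems(2-4) by (rule Cons.IH)
  have 2: "weighted D D' (\<lambda>X. c * a ^ k / of_nat (q - 1) * mon (\<lambda>l. u l + k * w l) X * J (k # ks) (R X))"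
    if k: "k \<in> {1..q-1}" for k
    unfolding R_def
  proof (rule Cons.IH[OF ms])
    show "1 \<le> k' \<and> k' \<le> q - 1" if "k' \<in> set (k # ks)" for k' using that k Cons.prems(2) by auto
    have "v (c * a ^ k) \<le> 1" using Cons.prems(3) Teich_v_le[OF Teich_power[OF a]] by (intro v_mult_le_1)
    then show "v (c * a ^ k / of_nat (q - 1)) \<le> 1" by (simp only: v_divide v_q_minus_1 div_by_1)
    fix i assume "i < h"
    then show "twist i (\<lambda>l. u l + k * w l) (D' * (\<Sum>k\<leftarrow>k # ks. rep (p ^ i * k)))"
      using twist_add[OF Cons.prems(4) twist_rep[OF w, of i k]] by (simp add: distrib_left add.commute)
  qed
  show ?case
  proof (rule weighted_add[OF 1 weighted_sum[OF 2]])
    fix X :: "'a \<Rightarrow> 'k" assume X: "X \<in> TT"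
    have m: "a * mon w X \<in> T" using a mon_Teich[OF X] by (rule Teich_mult)
    have "- (\<Sum>(a, w)\<leftarrow>aw # ms. a * mon w X) = R X - a * mon w X"
      by (simp add: R_def aw)
    then have "J ks (- (\<Sum>(a, w)\<leftarrow>aw # ms. a * mon w X)) = J ks (R X - a * mon w X)" by (rule arg_cong)
    also have "\<dots> = J ks (R X) + (\<Sum>k=1..q-1. (a * mon w X) ^ k * (J (k # ks) (R X) / of_nat (q - 1)))"
      by (rule J_expand[OF m])
    finally show "c * mon u X * J ks (- (\<Sum>(a, w)\<leftarrow>aw # ms. a * mon w X)) = c * mon u X * J ks (R X) +
      (\<Sum>k=1..q-1. c * a ^ k / of_nat (q - 1) * mon (\<lambda>l. u l + k * w l) X * J (k # ks) (R X))"
      by (simp add: distrib_left sum_distrib_left mon_add mon_mult power_mult_distrib mult.assoc mult.left_commute del: J.simps of_nat_diff)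
  qed auto
qed

lemma weighted_indicator:
  assumes "\<And>a w. (a, w) \<in> set ms \<Longrightarrow> a \<in> T \<and> (\<Sum>l\<in>UNIV. w l) \<le> D'" "D' \<le> D"
  shows "weighted D D' (\<lambda>X. if v (\<Sum>(a, w)\<leftarrow>ms. a * mon w X) < 1 then 1 else 0)"
  using weighted_J[OF assms(1), of ms "[]" 1 "\<lambda>_. 0" D] assms(2) by (simp add: twist_0)

end

section \<open>Reduction of a congruence modulo a power to a system modulo the prime\<close>

definition exps :: "'j set \<Rightarrow> nat \<Rightarrow> ('j \<Rightarrow> nat) set" where
  "exps A n = {e. (\<forall>j. j \<notin> A \<longrightarrow> e j = 0) \<and> (\<Sum>j\<in>A. e j) = n}"

lemma finite_exps: "finite A \<Longrightarrow> finite (exps A n)"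
proof (rule finite_subset)
  assume A: "finite A"
  show "exps A n \<subseteq> {e. \<forall>j. (j \<in> A \<longrightarrow> e j \<in> {..n}) \<and> (j \<notin> A \<longrightarrow> e j = 0)}"
    using member_le_sum[OF _ _ A] by (fastforce simp: exps_def)
  show "finite \<dots>" using A by (intro finite_set_of_finite_funs) auto
qed

text \<open>\<open>C e\<close> is the multinomial coefficient, built up one variable at a time, so
  the divisibility reduces to the absorption identities of binomial coefficients. One function
  serves all \<open>n\<close>, because the induction passes from \<open>n\<close> to
  \<open>n - b\<close>.\<close>

lemma multinomial_divisibility:
  assumes "finite A"
  shows "\<exists>C :: ('j \<Rightarrow> nat) \<Rightarrow> nat. \<forall>n. (\<forall>e\<in>exps A n. \<forall>j\<in>A. n dvd e j * C e) \<and>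
    (\<forall>r :: 'j \<Rightarrow> 'a::comm_ring_1. (\<Sum>j\<in>A. r j) ^ n = (\<Sum>e\<in>exps A n. of_nat (C e) * (\<Prod>j\<in>A. r j ^ e j)))"
  using assms
proof (induction A)
  case empty
  have "exps ({} :: 'j set) n = (if n = 0 then {\<lambda>_. 0} else {})" for n :: nat by (auto simp: exps_def)
  then show ?case by (intro exI[of _ "\<lambda>_. 1"]) (auto simp: power_0_left)
next
  case (insert x A)
  obtain C :: "('j \<Rightarrow> nat) \<Rightarrow> nat" where C0: "\<forall>n. (\<forall>e\<in>exps A n. \<forall>j\<in>A. n dvd e j * C e) \<and>
    (\<forall>r :: 'j \<Rightarrow> 'a. (\<Sum>j\<in>A. r j) ^ n = (\<Sum>e\<in>exps A n. of_nat (C e) * (\<Prod>j\<in>A. r j ^ e j)))"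
    using insert.IH by (elim exE)
  have C: "n dvd e j * C e" if "e \<in> exps A n" "j \<in> A" for n e j using C0 that by simp
  have C2: "(\<Sum>j\<in>A. r j) ^ n = (\<Sum>e\<in>exps A n. of_nat (C e) * (\<Prod>j\<in>A. r j ^ e j))" for n and r :: "'j \<Rightarrow> 'a"
    using C0 by simp
  define C' where "C' e = ((\<Sum>j\<in>insert x A. e j) choose e x) * C (e(x := 0))" for e
  have restr: "e(x := 0) \<in> exps A (n - e x)" "e x \<le> n" if "e \<in> exps (insert x A) n" for e n
  proof -
    have "e x + (\<Sum>j\<in>A. e j) = n" "\<And>j. j \<notin> insert x A \<Longrightarrow> e j = 0" using that insert.hyps by (auto simp: exps_def)
    moreover have "(\<Sum>j\<in>A. (e(x := 0)) j) = (\<Sum>j\<in>A. e j)" using insert.hyps by (intro sum.cong) auto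
    ultimately show "e(x := 0) \<in> exps A (n - e x)" "e x \<le> n" by (auto simp: exps_def)
  qed
  have dv: "n dvd e j * C' e" if e: "e \<in> exps (insert x A) n" and j: "j \<in> insert x A" for n e j
  proof -
    define b where "b = e x"
    have C'e: "C' e = (n choose b) * C (e(x := 0))" using e by (simp add: C'_def exps_def b_def)
    have b: "b \<le> n" using restr(2)[OF e] b_def by simp
    show ?thesis
    proof (cases "j = x")
      case True
      have "n dvd b * (n choose b)"
      proof (cases b)
        case (Suc b')
        then obtain n' where "n = Suc n'" using b by (cases n) auto
        then show ?thesis using Suc Suc_times_binomial_eq[of n' b'] by (metis dvd_triv_left mult.commute)
      qed simp
      then show ?thesis unfolding C'e using True b_def by (metis dvd_mult2 mult.assoc)
    next
      case False
      then have jA: "j \<in> A" using j by simp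
      have "(n - b) dvd (e(x := 0)) j * C (e(x := 0))" using C[OF restr(1)[OF e] jA] b_def by simp
      then obtain y where y: "e j * C (e(x := 0)) = (n - b) * y" using False by auto
      have "n dvd (n - b) * (n choose b)"
      proof (cases "b = n")
        case False
        then obtain n' where n': "n = Suc n'" using b by (cases n) auto
        have "(n - b) * (n choose b) = n * (n' choose b)"
          using binomial_absorb_comp[of n b] n' by simp
        then show ?thesis by simp
      qed simp
      then have "n dvd (n - b) * (n choose b) * y" by simp
      moreover have "e j * C' e = (n choose b) * (e j * C (e(x := 0)))" unfolding C'e by (simp only: mult.left_commute)
      ultimately show ?thesis unfolding y by (simp only: ac_simps)
    qed
  qed
  have ex: "(\<Sum>j\<in>insert x A. r j) ^ n = (\<Sum>e\<in>exps (insert x A) n. of_nat (C' e) * (\<Prod>j\<in>insert x A. r j ^ e j))"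
    for n and r :: "'j \<Rightarrow> 'a"
  proof -
    have "(\<Sum>j\<in>insert x A. r j) ^ n = (\<Sum>b\<le>n. of_nat (n choose b) * r x ^ b * (\<Sum>j\<in>A. r j) ^ (n - b))"
      using insert.hyps by (simp add: binomial_ring)
    also have "\<dots> = (\<Sum>b\<le>n. \<Sum>e\<in>exps A (n - b). of_nat (n choose b) * r x ^ b * (of_nat (C e) * (\<Prod>j\<in>A. r j ^ e j)))"
      unfolding C2 sum_distrib_left ..
    also have "\<dots> = (\<Sum>(b, e)\<in>Sigma {..n} (\<lambda>b. exps A (n - b)).
        of_nat (n choose b) * r x ^ b * (of_nat (C e) * (\<Prod>j\<in>A. r j ^ e j)))"
      by (rule sum.Sigma) (auto intro: finite_exps insert.hyps)
    also have "\<dots> = (\<Sum>e\<in>exps (insert x A) n. of_nat (C' e) * (\<Prod>j\<in>insert x A. r j ^ e j))"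
    proof (rule sum.reindex_bij_witness[where j = "\<lambda>(b, e). e(x := b)" and i = "\<lambda>e. (e x, e(x := 0))"])
      fix be assume be: "be \<in> Sigma {..n} (\<lambda>b. exps A (n - b))"
      obtain b e where [simp]: "be = (b, e)" by fastforce
      have b: "b \<le> n" and e: "\<And>j. j \<notin> A \<Longrightarrow> e j = 0" "(\<Sum>j\<in>A. e j) = n - b" using be by (auto simp: exps_def)
      have ex0: "e(x := 0) = e" using e(1)[of x] insert.hyps by auto
      show "(case be of (b, e) \<Rightarrow> e(x := b)) \<in> exps (insert x A) n"
      proof -
        have "(\<Sum>j\<in>A. (e(x := b)) j) = (\<Sum>j\<in>A. e j)" using insert.hyps by (intro sum.cong) auto
        then show ?thesis using b e insert.hyps by (auto simp: exps_def)
      qed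
      then have C'e: "C' (e(x := b)) = (n choose b) * C e" by (simp add: C'_def exps_def ex0)
      show "((case be of (b, e) \<Rightarrow> e(x := b)) x, (case be of (b, e) \<Rightarrow> e(x := b))(x := 0)) = be" using ex0 by simp
      have "(\<Prod>j\<in>A. r j ^ (e(x := b)) j) = (\<Prod>j\<in>A. r j ^ e j)" using insert.hyps by (intro prod.cong) auto
      then show "of_nat (C' (case be of (b, e) \<Rightarrow> e(x := b))) * (\<Prod>j\<in>insert x A. r j ^ (case be of (b, e) \<Rightarrow> e(x := b)) j)
        = (case be of (b, e) \<Rightarrow> of_nat (n choose b) * r x ^ b * (of_nat (C e) * (\<Prod>j\<in>A. r j ^ e j)))"
        using insert.hyps by (simp add: C'e)
    next
      fix e assume e: "e \<in> exps (insert x A) n"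
      show "(case (e x, e(x := 0)) of (b, e) \<Rightarrow> e(x := b)) = e" by simp
      show "(e x, e(x := 0)) \<in> Sigma {..n} (\<lambda>b. exps A (n - b))" using restr[OF e] by auto
    qed
    finally show ?thesis .
  qed
  show ?case using dv ex by blast
qed

context unramified_extension
begin

text \<open>In effect \<open>\<mu>\<close> is a monomial with fractional exponents, of denominator
  \<open>p ^ k\<close> and total degree at most \<open>d\<close>. It is kept as a function into
  \<open>T\<close>, where roots of order \<open>p ^ k\<close> are unique.\<close>

definition root_monomial :: "nat \<Rightarrow> nat \<Rightarrow> (('n::finite \<Rightarrow> 'k) \<Rightarrow> 'k) \<Rightarrow> bool" where
  "root_monomial d k \<mu> \<longleftrightarrow> (\<forall>X\<in>TT. \<mu> X \<in> T) \<and>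
     (\<exists>a\<in>T. \<exists>u. (\<Sum>l\<in>UNIV. u l) \<le> d * p ^ k \<and> (\<forall>X\<in>TT. \<mu> X ^ p ^ k = a * mon u X))"

text \<open>Lists permit repetition, so multiples by natural numbers stay in the class.\<close>

definition root_sum :: "nat \<Rightarrow> nat \<Rightarrow> (('n::finite \<Rightarrow> 'k) \<Rightarrow> 'k) \<Rightarrow> bool" where
  "root_sum d k \<phi> \<longleftrightarrow> (\<exists>L. (\<forall>\<mu>\<in>set L. root_monomial d k \<mu>) \<and> (\<forall>X\<in>TT. \<phi> X = (\<Sum>\<mu>\<leftarrow>L. \<mu> X)))"

lemma root_sum_0: "root_sum d k (\<lambda>_. 0)" unfolding root_sum_def by (intro exI[of _ "[]"]) auto
lemma root_sum_root_monomial: "root_monomial d k \<mu> \<Longrightarrow> root_sum d k \<mu>" unfolding root_sum_def by (intro exI[of _ "[\<mu>]"]) auto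
lemma root_sum_add: assumes "root_sum d k \<phi>" "root_sum d k \<psi>" shows "root_sum d k (\<lambda>X. \<phi> X + \<psi> X)"
proof -
  obtain L L' where "\<forall>\<mu>\<in>set L. root_monomial d k \<mu>" "\<forall>X\<in>TT. \<phi> X = (\<Sum>\<mu>\<leftarrow>L. \<mu> X)"
    "\<forall>\<mu>\<in>set L'. root_monomial d k \<mu>" "\<forall>X\<in>TT. \<psi> X = (\<Sum>\<mu>\<leftarrow>L'. \<mu> X)" using assms unfolding root_sum_def by blast
  then show ?thesis unfolding root_sum_def by (intro exI[of _ "L @ L'"]) auto
qed
lemma root_sum_sum: "(\<And>i. i \<in> I \<Longrightarrow> root_sum d k (\<phi> i)) \<Longrightarrow> root_sum d k (\<lambda>X. \<Sum>i\<in>I. \<phi> i X)"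
  by (induction I rule: infinite_finite_induct) (auto intro: root_sum_0 root_sum_add)
lemma root_sum_of_nat: "root_sum d k \<phi> \<Longrightarrow> root_sum d k (\<lambda>X. of_nat c * \<phi> X)"
  by (induction c) (auto simp: distrib_right intro: root_sum_0 root_sum_add)
lemma v_root_sum: assumes "root_sum d k \<phi>" "X \<in> TT" shows "v (\<phi> X) \<le> 1"
proof -
  have "(\<forall>\<mu>\<in>set L. root_monomial d k \<mu>) \<Longrightarrow> v (\<Sum>\<mu>\<leftarrow>L. \<mu> X) \<le> 1" for L :: "(('a \<Rightarrow> 'k) \<Rightarrow> 'k) list"
    using assms(2) by (induction L) (auto intro!: v_add_le intro: Teich_v_le simp: root_monomial_def)
  then show ?thesis using assms unfolding root_sum_def by auto
qed

text \<open>Meant for an exponent \<open>x\<close> and its multinomial coefficient \<open>y\<close>: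
  the less \<open>p\<close> divides the exponent, the more it divides the coefficient.\<close>

lemma p_power_dvd_cofactor:
  assumes "p ^ N dvd x * y" "\<not> p ^ Suc (N - i) dvd x" "i \<le> N" shows "p ^ i dvd (y::nat)"
proof (cases "y = 0")
  case False
  have x: "x \<noteq> 0" using assms(2) by (cases "x = 0") auto
  have np: "\<not> is_unit p" using p_gt_1 by simp
  have "N \<le> multiplicity p (x * y)" using assms(1) x False np by (simp add: power_dvd_iff_le_multiplicity)
  also have "\<dots> = multiplicity p x + multiplicity p y"
    using prime_p x False by (intro prime_elem_multiplicity_mult_distrib) auto
  finally have "N \<le> multiplicity p x + multiplicity p y" .
  moreover have "multiplicity p x \<le> N - i"
    using assms(2) x np power_dvd_iff_le_multiplicity[of x p "Suc (N - i)"] by simp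
  ultimately have "i \<le> multiplicity p y" using assms(3) by linarith
  then show ?thesis using False np by (simp add: power_dvd_iff_le_multiplicity)
qed simp

text \<open>Expanding the \<open>p ^ N\<close>-th power of the sum of the \<open>p ^ N\<close>-th roots of the summands of \<open>\<phi>\<close>; the
  multinomial coefficients provide the powers of \<open>p\<close>.\<close>
lemma root_sum_carry:
  fixes \<phi> :: "('n::finite \<Rightarrow> 'k) \<Rightarrow> 'k"
  assumes "root_sum d a \<phi>"
  shows "\<exists>\<psi>. (\<forall>i\<in>{1..N}. root_sum d (a + i) (\<psi> i)) \<and>
    (\<forall>X\<in>TT. v (\<phi> X) < 1 \<longrightarrow> v (\<phi> X - (\<Sum>i=1..N. of_nat p ^ i * \<psi> i X)) \<le> pinv ^ Suc N)"
proof -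
  obtain L where L: "\<And>\<mu>. \<mu> \<in> set L \<Longrightarrow> root_monomial d a \<mu>" "\<And>X. X \<in> TT \<Longrightarrow> \<phi> X = (\<Sum>\<mu>\<leftarrow>L. \<mu> X)"
    using assms unfolding root_sum_def by blast
  define A where "A = {..<length L}"
  define \<mu> where "\<mu> j = L ! j" for j
  define n where "n = p ^ N"
  have n0: "n > 0" by (simp add: n_def)
  have finA: "finite A" by (simp add: A_def)
  have \<mu>: "root_monomial d a (\<mu> j)" if "j \<in> A" for j using that L(1) by (simp add: A_def \<mu>_def)
  have \<phi>: "\<phi> X = (\<Sum>j\<in>A. \<mu> j X)" if "X \<in> TT" for X
    unfolding L(2)[OF that] A_def \<mu>_def by (simp add: sum_list_sum_nth atLeast0LessThan)
  \<comment> \<open>As the power \<open>p ^ (h * N)\<close> is the identity on \<open>T\<close>,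
    this is the root of order \<open>p ^ N\<close> of \<open>\<mu> j\<close>.\<close>
  define r where "r j X = \<mu> j X ^ p ^ (h * N - N)" for j and X :: "'n \<Rightarrow> 'k"
  have rT: "r j X \<in> T" and rn: "r j X ^ n = \<mu> j X" if "j \<in> A" "X \<in> TT" for j X
  proof -
    have m: "\<mu> j X \<in> T" using \<mu> that by (auto simp: root_monomial_def)
    then show "r j X \<in> T" unfolding r_def by (rule Teich_power)
    have "N \<le> h * N" using h_pos by simp
    then have "p ^ (h * N - N) * n = p ^ (h * N)" unfolding n_def by (simp flip: power_add)
    then show "r j X ^ n = \<mu> j X" unfolding r_def using Teich_power_q_power[OF m] by (simp flip: power_mult)
  qed
  obtain C :: "(nat \<Rightarrow> nat) \<Rightarrow> nat" where C: "\<And>e j. e \<in> exps A n \<Longrightarrow> j \<in> A \<Longrightarrow> n dvd e j * C e"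
    "\<And>r :: nat \<Rightarrow> 'k. (\<Sum>j\<in>A. r j) ^ n = (\<Sum>e\<in>exps A n. of_nat (C e) * (\<Prod>j\<in>A. r j ^ e j))"
    using multinomial_divisibility[OF finA] by metis
  define dl where "dl j = (\<lambda>j'. if j' = j then n else 0)" for j :: nat
  have dl: "dl j \<in> exps A n" if "j \<in> A" for j using that finA by (auto simp: exps_def dl_def sum.delta)
  \<comment> \<open>Evaluating the expansion at a unit vector isolates the coefficient of a pure
    power.\<close>
  have Cdl: "C (dl j) = 1" if j: "j \<in> A" for j
  proof -
    define r' :: "nat \<Rightarrow> 'k" where "r' j' = (if j' = j then 1 else 0)" for j'
    have "(\<Sum>j\<in>A. r' j) ^ n = 1" using j finA by (simp add: r'_def sum.delta)
    also have "(\<Sum>j\<in>A. r' j) ^ n = (\<Sum>e\<in>exps A n. if e = dl j then of_nat (C e) else 0)"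
      unfolding C(2)
    proof (intro sum.cong refl)
      fix e assume e: "e \<in> exps A n"
      show "of_nat (C e) * (\<Prod>j\<in>A. r' j ^ e j) = (if e = dl j then of_nat (C e) else 0)"
      proof (cases "\<exists>i\<in>A. i \<noteq> j \<and> e i \<noteq> 0")
        case True
        then obtain i where i: "i \<in> A" "i \<noteq> j" "e i \<noteq> 0" by blast
        then have "(\<Prod>j\<in>A. r' j ^ e j) = 0" using finA by (intro prod_zero) (auto simp: r'_def power_0_left)
        moreover have "e \<noteq> dl j" using i by (auto simp: dl_def)
        ultimately show ?thesis by simp
      next
        case False
        then have "(\<Sum>j\<in>A. e j) = (\<Sum>i\<in>A. if i = j then e j else 0)" by (intro sum.cong) auto
        then have "e j = n" using e j finA by (simp add: exps_def sum.delta)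
        then have "e = dl j" using False e unfolding exps_def dl_def by force
        moreover have "(\<Prod>j\<in>A. r' j ^ e j) = 1" using False by (intro prod.neutral) (auto simp: r'_def)
        ultimately show ?thesis by simp
      qed
    qed
    also have "\<dots> = of_nat (C (dl j))" using dl[OF j] finite_exps[OF finA] by (simp add: sum.delta)
    finally show ?thesis by simp
  qed
  \<comment> \<open>\<open>p ^ (N - lv e)\<close> is the largest power of \<open>p\<close>, up to
    \<open>p ^ N\<close>, that divides all exponents. Cancelling it against \<open>p ^ N\<close>
    leaves roots of order \<open>p ^ lv e\<close>, while \<open>p ^ lv e\<close> divides the
    coefficient: such a term belongs to level \<open>a + lv e\<close>.\<close>
  define lv where "lv e = (LEAST i. \<forall>j\<in>A. p ^ (N - i) dvd e j)" for e :: "nat \<Rightarrow> nat"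
  have lvN: "lv e \<le> N" and lvd: "j \<in> A \<Longrightarrow> p ^ (N - lv e) dvd e j" for e j
  proof -
    have N: "\<forall>j\<in>A. p ^ (N - N) dvd e j" by simp
    show "lv e \<le> N" unfolding lv_def using N by (rule Least_le)
    show "j \<in> A \<Longrightarrow> p ^ (N - lv e) dvd e j" unfolding lv_def using LeastI[of "\<lambda>i. \<forall>j\<in>A. p ^ (N - i) dvd e j", OF N] by blast
  qed
  have Clv: "p ^ lv e dvd C e" if e: "e \<in> exps A n" for e
  proof (cases "lv e")
    case (Suc i)
    then have "\<not> (\<forall>j\<in>A. p ^ (N - i) dvd e j)" using not_less_Least[of i "\<lambda>i. \<forall>j\<in>A. p ^ (N - i) dvd e j"] unfolding lv_def by simp
    then obtain j where j: "j \<in> A" "\<not> p ^ (N - i) dvd e j" by blast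
    have "N - i = Suc (N - lv e)" using Suc lvN[of e] by simp
    then show ?thesis using p_power_dvd_cofactor[of N "e j" "C e" "lv e"] C(1)[OF e j(1)] j(2) lvN[of e] unfolding n_def by simp
  qed simp
  define t where "t e X = (\<Prod>j\<in>A. r j X ^ e j)" for e X
  have tM: "root_monomial d (a + lv e) (t e)" if e: "e \<in> exps A n" for e
  proof -
    define i where "i = lv e"
    have iN: "i \<le> N" using lvN i_def by simp
    define f where "f j = e j div p ^ (N - i)" for j
    have ef: "e j = p ^ (N - i) * f j" if "j \<in> A" for j using lvd[OF that, of e] by (simp add: f_def i_def)
    have "p ^ (N - i) * (\<Sum>j\<in>A. f j) = n" using e ef by (simp add: exps_def sum_distrib_left)
    also have "n = p ^ (N - i) * p ^ i" using iN by (simp add: n_def flip: power_add)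
    finally have sf: "(\<Sum>j\<in>A. f j) = p ^ i" using p_gt_1 by simp
    have "\<forall>j. \<exists>c w. j \<in> A \<longrightarrow> c \<in> T \<and> (\<Sum>l\<in>UNIV. w l) \<le> d * p ^ a \<and> (\<forall>X\<in>TT. \<mu> j X ^ p ^ a = c * mon w X)"
      using \<mu> unfolding root_monomial_def by blast
    then obtain c w where cw: "\<And>j. j \<in> A \<Longrightarrow> c j \<in> T" "\<And>j. j \<in> A \<Longrightarrow> (\<Sum>l\<in>UNIV. w j l) \<le> d * p ^ a"
      "\<And>j X. j \<in> A \<Longrightarrow> X \<in> TT \<Longrightarrow> \<mu> j X ^ p ^ a = c j * mon (w j) X" by metis
    have "t e X ^ p ^ (a + i) = (\<Prod>j\<in>A. c j ^ f j) * mon (\<lambda>l. \<Sum>j\<in>A. f j * w j l) X" if X: "X \<in> TT" for X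
    proof -
      have "t e X ^ p ^ (a + i) = (\<Prod>j\<in>A. (r j X ^ e j) ^ p ^ (a + i))"
        unfolding t_def by (rule prod_power_distrib)
      also have "\<dots> = (\<Prod>j\<in>A. c j ^ f j * mon (w j) X ^ f j)"
      proof (intro prod.cong refl)
        fix j assume j: "j \<in> A"
        have "e j * p ^ (a + i) = n * p ^ a * f j"
        proof -
          have "e j * p ^ (a + i) = p ^ (N - i) * p ^ i * (p ^ a * f j)" unfolding ef[OF j] by (simp add: power_add)
          also have "p ^ (N - i) * p ^ i = n" using iN by (simp add: n_def flip: power_add)
          finally show ?thesis by simp
        qed
        then have "(r j X ^ e j) ^ p ^ (a + i) = ((r j X ^ n) ^ p ^ a) ^ f j" by (simp only: power_mult[symmetric])
        also have "\<dots> = (c j * mon (w j) X) ^ f j" unfolding rn[OF j X] cw(3)[OF j X] ..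
        finally show "(r j X ^ e j) ^ p ^ (a + i) = c j ^ f j * mon (w j) X ^ f j" by (simp add: power_mult_distrib)
      qed
      also have "\<dots> = (\<Prod>j\<in>A. c j ^ f j) * (\<Prod>j\<in>A. mon (w j) X ^ f j)" by (rule prod.distrib)
      also have "(\<Prod>j\<in>A. mon (w j) X ^ f j) = mon (\<lambda>l. \<Sum>j\<in>A. f j * w j l) X"
        using finA by (induction A) (auto simp: mon_add mon_mult)
      finally show ?thesis .
    qed
    moreover have "(\<Sum>l\<in>UNIV. \<Sum>j\<in>A. f j * w j l) \<le> d * p ^ (a + i)"
    proof -
      have "(\<Sum>l\<in>UNIV. \<Sum>j\<in>A. f j * w j l) = (\<Sum>j\<in>A. f j * (\<Sum>l\<in>UNIV. w j l))"
        by (subst sum.swap) (simp add: sum_distrib_left)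
      also have "\<dots> \<le> (\<Sum>j\<in>A. f j * (d * p ^ a))" using cw(2) by (intro sum_mono mult_le_mono2)
      also have "\<dots> = d * p ^ (a + i)" unfolding sum_distrib_right[symmetric] sf by (simp add: power_add)
      finally show ?thesis .
    qed
    moreover have "(\<Prod>j\<in>A. c j ^ f j) \<in> T" using cw(1) by (intro Teich_prod Teich_power)
    moreover have "\<forall>X\<in>TT. t e X \<in> T" unfolding t_def using rT by (auto intro!: Teich_prod Teich_power)
    ultimately show ?thesis unfolding root_monomial_def i_def[symmetric] by blast
  qed
  define E where "E i = {e \<in> exps A n. lv e = i}" for i
  define \<chi> where "\<chi> i X = (\<Sum>e\<in>E i. of_nat (C e div p ^ i) * t e X)" for i X
  have \<chi>root_sum: "root_sum d (a + i) (\<chi> i)" for i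
    unfolding \<chi>_def E_def using tM by (intro root_sum_sum root_sum_of_nat root_sum_root_monomial) auto
  have \<chi>p: "of_nat p ^ i * \<chi> i X = (\<Sum>e\<in>E i. of_nat (C e) * t e X)" for i X
    unfolding \<chi>_def sum_distrib_left
  proof (intro sum.cong refl)
    fix e assume "e \<in> E i"
    then have "p ^ i * (C e div p ^ i) = C e" using Clv[of e] by (simp add: E_def)
    then have "of_nat p ^ i * of_nat (C e div p ^ i) = (of_nat (C e) :: 'k)" by (metis of_nat_mult of_nat_power)
    then show "of_nat p ^ i * (of_nat (C e div p ^ i) * t e X) = of_nat (C e) * t e X"
      by (simp only: mult.assoc[symmetric])
  qed
  \<comment> \<open>Level 0 consists of the pure powers of the roots, which recover the summands of
    \<open>\<phi>\<close>.\<close>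
  have E0: "(\<Sum>e\<in>E 0. of_nat (C e) * t e X) = \<phi> X" if X: "X \<in> TT" for X
  proof -
    have "E 0 = dl ` A"
    proof (intro set_eqI iffI)
      fix e assume "e \<in> dl ` A"
      then obtain j where j: "j \<in> A" "e = dl j" by blast
      have "\<forall>j'\<in>A. p ^ (N - 0) dvd e j'" using j by (auto simp: dl_def n_def)
      then have "lv e \<le> 0" unfolding lv_def by (rule Least_le)
      then show "e \<in> E 0" using dl j by (simp add: E_def)
    next
      fix e assume "e \<in> E 0"
      then have e: "e \<in> exps A n" "lv e = 0" by (auto simp: E_def)
      have nd: "n dvd e j" if "j \<in> A" for j using lvd[OF that, of e] e(2) by (simp add: n_def)
      have se: "(\<Sum>j\<in>A. e j) = n" using e(1) by (simp add: exps_def)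
      then have "\<exists>j\<in>A. e j \<noteq> 0" using n0 by (metis less_numeral_extra(3) sum.neutral)
      then obtain j where j: "j \<in> A" "e j \<noteq> 0" by blast
      have "n \<le> e j" using nd[OF j(1)] j(2) by (intro dvd_imp_le) auto
      moreover have "e j + (\<Sum>j\<in>A - {j}. e j) = n" using se j(1) finA by (simp add: sum.remove)
      ultimately have ej: "e j = n" "(\<Sum>j\<in>A - {j}. e j) = 0" by auto
      then have "\<forall>i\<in>A - {j}. e i = 0" using finA by (simp add: sum_eq_0_iff)
      then have "e = dl j" using e(1) ej(1) unfolding exps_def dl_def by force
      then show "e \<in> dl ` A" using j by blast
    qed
    moreover have "inj_on dl A" using n0 by (intro inj_onI) (metis dl_def less_numeral_extra(3))
    ultimately have "(\<Sum>e\<in>E 0. of_nat (C e) * t e X) = (\<Sum>j\<in>A. of_nat (C (dl j)) * t (dl j) X)"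
      by (simp add: sum.reindex)
    also have "\<dots> = (\<Sum>j\<in>A. \<mu> j X)"
    proof (intro sum.cong refl)
      fix j assume j: "j \<in> A"
      have "t (dl j) X = (\<Prod>j'\<in>A. if j' = j then r j X ^ n else 1)" unfolding t_def dl_def by (intro prod.cong) auto
      also have "\<dots> = \<mu> j X" using j finA rn[OF j X] by (simp add: prod.delta)
      finally show "of_nat (C (dl j)) * t (dl j) X = \<mu> j X" using Cdl[OF j] by simp
    qed
    finally show ?thesis using \<phi>[OF X] by simp
  qed
  have main: "(\<Sum>j\<in>A. r j X) ^ n = \<phi> X + (\<Sum>i=1..N. of_nat p ^ i * \<chi> i X)" if X: "X \<in> TT" for X
  proof -
    have "(\<Sum>j\<in>A. r j X) ^ n = (\<Sum>e\<in>exps A n. of_nat (C e) * t e X)" unfolding C(2) t_def ..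
    also have "\<dots> = (\<Sum>i\<in>{0..N}. \<Sum>e\<in>E i. of_nat (C e) * t e X)"
      unfolding E_def using lvN finite_exps[OF finA] by (intro sum.group[symmetric]) auto
    also have "\<dots> = (\<Sum>e\<in>E 0. of_nat (C e) * t e X) + (\<Sum>i=1..N. \<Sum>e\<in>E i. of_nat (C e) * t e X)"
      by (simp add: sum.atLeast_Suc_atMost)
    finally show ?thesis unfolding \<chi>p E0[OF X] .
  qed
  \<comment> \<open>\<open>M\<close> represents -1 modulo \<open>p ^ (N + 1)\<close>. Moving the
    carries to the other side needs a sign, and \<open>root_sum\<close> is closed under multiples by
    natural numbers.\<close>
  define M where "M = p ^ Suc N - 1"
  have M: "of_nat M = (of_nat p ^ Suc N - 1 :: 'k)" unfolding M_def by (simp add: of_nat_diff Suc_le_eq)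
  define \<psi> where "\<psi> i X = of_nat M * \<chi> i X" for i X
  have "v (\<phi> X - (\<Sum>i=1..N. of_nat p ^ i * \<psi> i X)) \<le> pinv ^ Suc N" if X: "X \<in> TT" "v (\<phi> X) < 1" for X
  proof -
    let ?Z = "\<Sum>i=1..N. of_nat p ^ i * \<chi> i X"
    have "v ?Z < 1"
    proof (intro v_sum_less)
      fix i assume i: "i \<in> {1..N}"
      have "v (of_nat p ^ i) < 1" using i inv_p_less_1 p_gt_1 by (simp add: v_power power_less_one_iff)
      then show "v (of_nat p ^ i * \<chi> i X) < 1" using v_root_sum[OF \<chi>root_sum X(1)] by (rule v_mult_less_1')
    qed simp
    then have "v ((\<Sum>j\<in>A. r j X) ^ n) < 1" unfolding main[OF X(1)] using X(2) by (intro v_add_less)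
    then have "v (\<Sum>j\<in>A. r j X) < 1" using n0 v_nonneg by (simp add: v_power power_less_one_iff)
    \<comment> \<open>If \<open>p\<close> divides the sum of the roots, then \<open>p ^ n\<close>
      divides its \<open>n\<close>-th power, and \<open>n = p ^ N \<ge> N + 1\<close>. So the whole
      expansion vanishes to the required precision.\<close>
    then have "v (\<Sum>j\<in>A. r j X) \<le> pinv" by (rule discrete)
    then have "v ((\<Sum>j\<in>A. r j X) ^ n) \<le> pinv ^ n" unfolding v_power by (intro power_mono v_nonneg)
    also have "Suc N \<le> n" unfolding n_def using p_gt_1 by (intro Suc_leI power_gt_expt) simp
    then have "pinv ^ n \<le> pinv ^ Suc N" by (rule inv_p_power_mono)
    finally have "v (\<phi> X + ?Z) \<le> pinv ^ Suc N" unfolding main[OF X(1)] .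
    moreover have "v (of_nat p ^ Suc N * ?Z) \<le> pinv ^ Suc N"
      using \<open>v ?Z < 1\<close> by (intro v_mult_le_1') (auto simp: v_power v_mult)
    ultimately have "v (\<phi> X + ?Z - of_nat p ^ Suc N * ?Z) \<le> pinv ^ Suc N" by (rule v_diff_le)
    moreover have "(\<Sum>i=1..N. of_nat p ^ i * \<psi> i X) = of_nat M * ?Z"
      unfolding \<psi>_def sum_distrib_left by (intro sum.cong refl) (simp only: ac_simps)
    moreover have "\<phi> X - of_nat M * ?Z = \<phi> X + ?Z - of_nat p ^ Suc N * ?Z"
      unfolding M by (simp add: algebra_simps)
    ultimately show ?thesis by (simp only:)
  qed
  moreover have "root_sum d (a + i) (\<psi> i)" for i unfolding \<psi>_def using \<chi>root_sum by (rule root_sum_of_nat)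
  ultimately show ?thesis by blast
qed

lemma v_p_power_le: "v (of_nat p ^ s) \<le> 1"
  using v_of_nat_le[of "p ^ s"] by (simp only: of_nat_power)

text \<open>Induction on the precision with the starting level \<open>a\<close> free. If
  \<open>p\<close> does not divide \<open>\<phi> 0 X\<close>, neither side holds. Otherwise the
  carry replaces \<open>\<phi> 0\<close> by terms from level \<open>a + 1\<close> on, and division
  by \<open>p\<close> leaves the same problem with one level fewer.\<close>

lemma root_sum_reduction:
  fixes \<phi> :: "nat \<Rightarrow> ('n::finite \<Rightarrow> 'k) \<Rightarrow> 'k"
  assumes "\<And>s. s \<le> N \<Longrightarrow> root_sum d (a + s) (\<phi> s)"
  shows "\<exists>Q. (\<forall>s\<le>N. root_sum d (a + s) (Q s)) \<and>
    (\<forall>X\<in>TT. v (\<Sum>s\<le>N. of_nat p ^ s * \<phi> s X) \<le> pinv ^ Suc N \<longleftrightarrow> (\<forall>s\<le>N. v (Q s X) < 1))"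
  using assms
proof (induction N arbitrary: a \<phi>)
  case 0
  have "v x \<le> pinv \<longleftrightarrow> v x < 1" for x using discrete[of x] inv_p_less_1 by (metis le_less_trans)
  then show ?case using 0 by (intro exI[of _ \<phi>]) auto
next
  case (Suc N)
  obtain \<psi> where \<psi>: "\<And>i. i \<in> {1..Suc N} \<Longrightarrow> root_sum d (a + i) (\<psi> i)"
    "\<And>X. X \<in> TT \<Longrightarrow> v (\<phi> 0 X) < 1 \<Longrightarrow> v (\<phi> 0 X - (\<Sum>i=1..Suc N. of_nat p ^ i * \<psi> i X)) \<le> pinv ^ Suc (Suc N)"
  proof -
    have "root_sum d a (\<phi> 0)" using Suc.prems[of 0] by simp
    then show ?thesis using root_sum_carry[of d a "\<phi> 0" "Suc N"] that by blast
  qed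
  define \<phi>' where "\<phi>' s X = \<phi> (Suc s) X + \<psi> (Suc s) X" for s X
  have \<phi>': "root_sum d (Suc a + s) (\<phi>' s)" if "s \<le> N" for s
    unfolding \<phi>'_def using that Suc.prems[of "Suc s"] \<psi>(1)[of "Suc s"] by (intro root_sum_add) auto
  obtain Q' where Q': "\<And>s. s \<le> N \<Longrightarrow> root_sum d (Suc a + s) (Q' s)"
    "\<And>X. X \<in> TT \<Longrightarrow> v (\<Sum>s\<le>N. of_nat p ^ s * \<phi>' s X) \<le> pinv ^ Suc N \<longleftrightarrow> (\<forall>s\<le>N. v (Q' s X) < 1)"
    using Suc.IH[OF \<phi>'] by blast
  define Q where "Q s = (case s of 0 \<Rightarrow> \<phi> 0 | Suc s \<Rightarrow> Q' s)" for s
  have "root_sum d (a + s) (Q s)" if "s \<le> Suc N" for s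
    using that Suc.prems[of 0] Q'(1) by (cases s) (auto simp: Q_def)
  moreover have "v (\<Sum>s\<le>Suc N. of_nat p ^ s * \<phi> s X) \<le> pinv ^ Suc (Suc N) \<longleftrightarrow> (\<forall>s\<le>Suc N. v (Q s X) < 1)"
    if X: "X \<in> TT" for X
  proof -
    define S where "S = (\<Sum>s\<le>N. of_nat p ^ s * \<phi> (Suc s) X)"
    have S: "(\<Sum>s\<le>Suc N. of_nat p ^ s * \<phi> s X) = \<phi> 0 X + of_nat p * S"
      unfolding S_def by (simp add: sum.atMost_Suc_shift sum_distrib_left mult.assoc del: sum.atMost_Suc)
    have QS: "(\<forall>s\<le>Suc N. v (Q s X) < 1) \<longleftrightarrow> v (\<phi> 0 X) < 1 \<and> (\<forall>s\<le>N. v (Q' s X) < 1)"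
      unfolding Q_def by (auto split: nat.splits)
    have "v S \<le> 1" unfolding S_def using Suc.prems v_root_sum[OF _ X]
      by (intro v_sum_le v_mult_le_1 v_p_power_le) auto
    then have pS: "v (of_nat p * S) < 1" using inv_p_less_1 by (intro v_mult_less_1') auto
    show ?thesis
    proof (cases "v (\<phi> 0 X) < 1")
      case False
      have "\<not> v (\<phi> 0 X + of_nat p * S) < 1" using False pS v_diff_less[of "\<phi> 0 X + of_nat p * S" 1 "of_nat p * S"] by auto
      moreover have "pinv ^ Suc (Suc N) < 1" using p_gt_1 by (intro power_Suc_less_one) auto
      ultimately show ?thesis using False unfolding S QS by linarith
    next
      case True
      define S' where "S' = (\<Sum>s\<le>N. of_nat p ^ s * \<psi> (Suc s) X)"
      have "(\<Sum>i=1..Suc N. of_nat p ^ i * \<psi> i X) = (\<Sum>s\<le>N. of_nat p ^ Suc s * \<psi> (Suc s) X)"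
        by (rule sum.reindex_bij_witness[where i = Suc and j = "\<lambda>i. i - 1"]) auto
      also have "\<dots> = of_nat p * S'" by (simp add: S'_def sum_distrib_left mult.assoc)
      finally have d: "v (\<phi> 0 X - of_nat p * S') \<le> pinv ^ Suc (Suc N)" using \<psi>(2)[OF X True] by simp
      have SS: "(\<Sum>s\<le>N. of_nat p ^ s * \<phi>' s X) = S + S'"
        by (simp add: \<phi>'_def S_def S'_def distrib_left sum.distrib)
      have "v (\<phi> 0 X + of_nat p * S) \<le> pinv ^ Suc (Suc N) \<longleftrightarrow> v (of_nat p * (S + S')) \<le> pinv ^ Suc (Suc N)"
      proof
        assume "v (\<phi> 0 X + of_nat p * S) \<le> pinv ^ Suc (Suc N)"
        from v_diff_le[OF this d] show "v (of_nat p * (S + S')) \<le> pinv ^ Suc (Suc N)" by (simp add: algebra_simps)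
      next
        assume "v (of_nat p * (S + S')) \<le> pinv ^ Suc (Suc N)"
        from v_add_le[OF this d] show "v (\<phi> 0 X + of_nat p * S) \<le> pinv ^ Suc (Suc N)" by (simp add: algebra_simps)
      qed
      also have "\<dots> \<longleftrightarrow> v (S + S') \<le> pinv ^ Suc N"
        by (simp only: v_mult[of "of_nat p"] v_p power_Suc[of _ "Suc N"] mult_le_cancel_left_pos[OF inv_p_pos])
      finally show ?thesis using Q'(2)[OF X] True unfolding S QS SS by blast
    qed
  qed
  ultimately show ?case by blast
qed

section \<open>From sums of roots to indicators of polynomial equations\<close>

lemma frobenius_sum_list:
  "(\<And>x. x \<in> set xs \<Longrightarrow> v x \<le> 1) \<Longrightarrow> v (sum_list xs ^ p ^ k - (\<Sum>x\<leftarrow>xs. x ^ p ^ k)) < 1"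
proof (induction xs)
  case (Cons x xs)
  have "v (sum_list xs) \<le> 1"
    using Cons.prems by (induction xs) (auto intro: v_add_le)
  then have "v ((x + sum_list xs) ^ p ^ k - (x ^ p ^ k + sum_list xs ^ p ^ k)) < 1"
    using Cons.prems by (intro frobenius_add) auto
  moreover have "v ((x ^ p ^ k + sum_list xs ^ p ^ k) - (x ^ p ^ k + (\<Sum>x\<leftarrow>xs. x ^ p ^ k))) < 1"
    using Cons by simp
  ultimately show ?case using v_trans_less by simp
qed (auto simp: power_0_left)

text \<open>Raising to the power \<open>p ^ k\<close> turns a sum of roots, modulo \<open>p\<close>,
  into a genuine polynomial of degree at most \<open>d * p ^ k\<close>, and does not affect
  divisibility by \<open>p\<close>.\<close>

lemma weighted_root_sum_indicator:
  fixes \<phi> :: "('n::finite \<Rightarrow> 'k) \<Rightarrow> 'k"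
  assumes "root_sum d k \<phi>" "d * p ^ k \<le> D"
  shows "weighted D (d * p ^ k) (\<lambda>X. if v (\<phi> X) < 1 then 1 else 0)"
proof -
  obtain L where L: "\<And>\<mu>. \<mu> \<in> set L \<Longrightarrow> root_monomial d k \<mu>" "\<And>X. X \<in> TT \<Longrightarrow> \<phi> X = (\<Sum>\<mu>\<leftarrow>L. \<mu> X)"
    using assms unfolding root_sum_def by blast
  have "\<forall>\<mu>. \<exists>c w. \<mu> \<in> set L \<longrightarrow> c \<in> T \<and> (\<Sum>l\<in>UNIV. w l) \<le> d * p ^ k \<and> (\<forall>X\<in>TT. \<mu> X ^ p ^ k = c * mon w X)"
    using L(1) unfolding root_monomial_def by blast
  then obtain c w where cw: "\<And>\<mu>. \<mu> \<in> set L \<Longrightarrow> c \<mu> \<in> T" "\<And>\<mu>. \<mu> \<in> set L \<Longrightarrow> (\<Sum>l\<in>UNIV. w \<mu> l) \<le> d * p ^ k"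
    "\<And>\<mu> X. \<mu> \<in> set L \<Longrightarrow> X \<in> TT \<Longrightarrow> \<mu> X ^ p ^ k = c \<mu> * mon (w \<mu>) X" by metis
  define ms where "ms = map (\<lambda>\<mu>. (c \<mu>, w \<mu>)) L"
  have "weighted D (d * p ^ k) (\<lambda>X. if v (\<Sum>(a, w)\<leftarrow>ms. a * mon w X) < 1 then 1 else 0)"
    using cw(1,2) assms(2) by (intro weighted_indicator) (auto simp: ms_def)
  then show ?thesis
  proof (rule weighted_cong)
    fix X :: "'n \<Rightarrow> 'k" assume X: "X \<in> TT"
    have "(\<Sum>(a, w)\<leftarrow>ms. a * mon w X) = (\<Sum>\<mu>\<leftarrow>L. \<mu> X ^ p ^ k)"
      unfolding ms_def using cw(3) X by (simp add: comp_def cong: map_cong)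
    moreover have "v (\<phi> X ^ p ^ k - (\<Sum>\<mu>\<leftarrow>L. \<mu> X ^ p ^ k)) < 1"
      unfolding L(2)[OF X] using frobenius_sum_list[of "map (\<lambda>\<mu>. \<mu> X) L" k] L(1) X Teich_v_le
      by (auto simp: comp_def root_monomial_def)
    ultimately have "v (\<phi> X ^ p ^ k - (\<Sum>(a, w)\<leftarrow>ms. a * mon w X)) < 1" by simp
    then have "v (\<phi> X ^ p ^ k) < 1 \<longleftrightarrow> v (\<Sum>(a, w)\<leftarrow>ms. a * mon w X) < 1"
      using v_trans_less[of "\<phi> X ^ p ^ k" "\<Sum>(a, w)\<leftarrow>ms. a * mon w X" 1 0]
        v_trans_less[of "\<Sum>(a, w)\<leftarrow>ms. a * mon w X" "\<phi> X ^ p ^ k" 1 0] v_diff_commute[of "\<phi> X ^ p ^ k"] by auto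
    moreover have "v (\<phi> X ^ p ^ k) < 1 \<longleftrightarrow> v (\<phi> X) < 1"
      using v_nonneg p_gt_1 by (simp add: v_power power_less_one_iff)
    ultimately show "(if v (\<phi> X) < 1 then 1 else 0) = (if v (\<Sum>(a, w)\<leftarrow>ms. a * mon w X) < 1 then 1 else 0)" by simp
  qed
qed

end

section \<open>Polynomials on a box\<close>

abbreviation lookup :: "('a \<Rightarrow>\<^sub>0 'b::zero) \<Rightarrow> 'a \<Rightarrow> 'b" where "lookup \<equiv> Poly_Mapping.lookup"

section \<open>Evaluation and degree of polynomials\<close>

lemma peval_superset:
  assumes "finite S" "Poly_Mapping.keys P \<subseteq> S"
  shows "peval P X = (\<Sum>u\<in>S. lookup P u * mon (lookup u) X)"
  unfolding peval_def mon_def using assms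
  by (intro sum.mono_neutral_left) (auto simp: not_in_keys_iff_lookup_eq_zero)

lemma peval_add: "peval (P + Q) X = peval P X + peval Q X"
proof -
  let ?S = "Poly_Mapping.keys P \<union> Poly_Mapping.keys Q"
  have "peval (P + Q) X = (\<Sum>u\<in>?S. lookup (P + Q) u * mon (lookup u) X)"
    using keys_add[of P Q] by (intro peval_superset) auto
  also have "\<dots> = (\<Sum>u\<in>?S. lookup P u * mon (lookup u) X)
      + (\<Sum>u\<in>?S. lookup Q u * mon (lookup u) X)"
    by (simp add: lookup_add distrib_right sum.distrib)
  also have "\<dots> = peval P X + peval Q X" by (subst (1 2) peval_superset[of ?S]) auto
  finally show ?thesis .
qed

lemma peval_0 [simp]: "peval 0 X = 0" by (simp add: peval_def)
lemma peval_sum: "peval (\<Sum>i\<in>I. P i) X = (\<Sum>i\<in>I. peval (P i) X)"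
  by (induction I rule: infinite_finite_induct) (auto simp: peval_add)
lemma peval_single: "peval (Poly_Mapping.single u c) X = c * mon (lookup u) X"
  by (subst peval_superset[of "{u}"]) (auto simp: lookup_single)

lemma poly_mapping_sum_single:
  "P = (\<Sum>u\<in>Poly_Mapping.keys P. Poly_Mapping.single u (lookup P u))"
proof (rule poly_mapping_eqI)
  fix w
  have "lookup (\<Sum>u\<in>Poly_Mapping.keys P. Poly_Mapping.single u (lookup P u)) w
    = (\<Sum>u\<in>Poly_Mapping.keys P. if u = w then lookup P u else 0)"
    by (simp add: lookup_sum lookup_single when_def)
  also have "\<dots> = lookup P w" by (simp add: sum.delta in_keys_iff)
  finally show "lookup P w = lookup
     (\<Sum>u\<in>Poly_Mapping.keys P. Poly_Mapping.single u (lookup P u)) w" by simp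
qed

lemma mult_eq_sum_single:
  fixes P Q :: "('n, 'k::comm_ring_1) mpol"
  shows "P * Q = (\<Sum>u\<in>Poly_Mapping.keys P. \<Sum>w\<in>Poly_Mapping.keys Q.
    Poly_Mapping.single (u + w) (lookup P u * lookup Q w))"
proof -
  have "P * Q = (\<Sum>u\<in>Poly_Mapping.keys P. Poly_Mapping.single u (lookup P u))
    * (\<Sum>w\<in>Poly_Mapping.keys Q. Poly_Mapping.single w (lookup Q w))"
    using poly_mapping_sum_single[of P] poly_mapping_sum_single[of Q] by simp
  then show ?thesis by (simp add: sum_product mult_single)
qed

lemma peval_mult: "peval (P * Q) X = peval P X * peval Q X"
proof -
  have "peval (P * Q) X = (\<Sum>u\<in>Poly_Mapping.keys P. \<Sum>w\<in>Poly_Mapping.keys Q.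
     (lookup P u * mon (lookup u) X) * (lookup Q w * mon (lookup w) X))"
    unfolding mult_eq_sum_single peval_sum peval_single
    by (intro sum.cong refl) (simp add: plus_poly_mapping.rep_eq mon_add)
  then show ?thesis unfolding sum_product[symmetric] by (simp add: peval_def mon_def)
qed

lemma peval_1 [simp]: "peval 1 X = 1"
  using peval_single[of 0 1 X] by (simp add: zero_poly_mapping.rep_eq)
lemma peval_prod: "peval (\<Prod>i\<in>I. P i) X = (\<Prod>i\<in>I. peval (P i) X)"
  by (induction I rule: infinite_finite_induct) (auto simp: peval_mult)

lemma total_deg_ge:
  assumes "u \<in> Poly_Mapping.keys P" shows "(\<Sum>l\<in>UNIV. lookup u l) \<le> total_deg P"
proof -
  have "P \<noteq> 0" using assms by auto
  then show ?thesis using assms unfolding total_deg_def by auto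
qed

context unramified_extension
begin

abbreviation integral_coeffs :: "('n, 'k) mpol \<Rightarrow> bool" where
  "integral_coeffs \<equiv> coeffs_in (val_ring v)"

lemma integral_coeffs_iff: "integral_coeffs P \<longleftrightarrow> (\<forall>u. v (lookup P u) \<le> 1)"
  by (simp add: coeffs_in_def val_ring_def)

lemma integral_coeffs_sum: "(\<And>i. i \<in> I \<Longrightarrow> integral_coeffs (P i)) \<Longrightarrow> integral_coeffs (\<Sum>i\<in>I. P i)"
  unfolding integral_coeffs_iff by (auto simp: lookup_sum intro!: v_sum_le)
lemma integral_coeffs_single: "v c \<le> 1 \<Longrightarrow> integral_coeffs (Poly_Mapping.single u c)"
  unfolding integral_coeffs_iff by (auto simp: lookup_single when_def)
lemma integral_coeffs_mult: "integral_coeffs P \<Longrightarrow> integral_coeffs Q \<Longrightarrow> integral_coeffs (P * Q)"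
  unfolding mult_eq_sum_single
  by (intro integral_coeffs_sum integral_coeffs_single v_mult_le_1) (auto simp: integral_coeffs_iff)
lemma integral_coeffs_prod: "(\<And>i. i \<in> I \<Longrightarrow> integral_coeffs (P i)) \<Longrightarrow> integral_coeffs (\<Prod>i\<in>I. P i)"
  by (induction I rule: infinite_finite_induct)
    (auto intro: integral_coeffs_mult integral_coeffs_single[of 1 0, unfolded single_one])
lemma integral_coeffs_Teich: "coeffs_in T P \<Longrightarrow> integral_coeffs P"
  unfolding integral_coeffs_iff using Teich_v_le by (auto simp: coeffs_in_def)

lemma v_mon_le: "(\<And>l. v (X l) \<le> 1) \<Longrightarrow> v (mon u X) \<le> 1"
  unfolding mon_def v_prod using v_nonneg by (intro prod_le_1) (auto simp: v_power power_le_1_v)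

lemma v_peval_le: "integral_coeffs P \<Longrightarrow> (\<And>l. v (X l) \<le> 1) \<Longrightarrow> v (peval P X) \<le> 1"
  unfolding peval_def mon_def[symmetric] by (intro v_sum_le v_mult_le_1 v_mon_le) (auto simp: integral_coeffs_iff)

lemma TT_v_le: "X \<in> TT \<Longrightarrow> v (X l) \<le> 1" by (simp add: TT_def Teich_v_le)

text \<open>Links congruences modulo \<open>p ^ m\<close> with the strict inequalities in which the
  congruence lemmas for products and powers are stated.\<close>

lemma le_power_iff_less: "m \<ge> 1 \<Longrightarrow> v x \<le> pinv ^ m \<longleftrightarrow> v x < pinv ^ (m - 1)"
proof -
  assume m: "m \<ge> 1"
  then have "pinv ^ m < pinv ^ (m - 1)"
    using inv_p_pos inv_p_less_1 by (intro power_strict_decreasing) auto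
  then show ?thesis using discrete_power[of x "m - 1"] m by fastforce
qed

lemma vsums_tail:
  assumes "vsums v s x" "\<And>i. v (s i) \<le> pinv ^ i" shows "v (x - (\<Sum>i<m. s i)) \<le> pinv ^ m"
proof -
  have "v ((\<Sum>i<m. s i) - x) \<le> pinv ^ m"
    using assms by (intro limit_bound[of "\<lambda>N. \<Sum>i<N. s i"]) (auto simp: vsums_def)
  then show ?thesis by (simp add: v_diff_commute)
qed

section \<open>Teichmueller digits and decomposition into levels\<close>

lemma Teich_digits:
  assumes "v c \<le> 1" shows "\<exists>\<tau>. (\<forall>k. \<tau> k \<in> T) \<and> v (c - (\<Sum>k<m. of_nat p ^ k * \<tau> k)) \<le> pinv ^ m"
proof (induction m)
  case 0
  show ?case using assms by (intro exI[of _ "\<lambda>_. 0"]) auto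
next
  case (Suc m)
  then obtain \<tau> where \<tau>: "\<And>k. \<tau> k \<in> T" "v (c - (\<Sum>k<m. of_nat p ^ k * \<tau> k)) \<le> pinv ^ m" by blast
  define c' where "c' = (c - (\<Sum>k<m. of_nat p ^ k * \<tau> k)) / of_nat p ^ m"
  have c'1: "v c' \<le> 1" using \<tau>(2) p_gt_1 by (simp add: c'_def v_divide v_power field_simps)
  have c': "of_nat p ^ m * c' = c - (\<Sum>k<m. of_nat p ^ k * \<tau> k)" using p_gt_1 by (simp add: c'_def)
  define \<tau>' where "\<tau>' = \<tau>(m := teich c')"
  have "(\<Sum>k<m. of_nat p ^ k * \<tau>' k) = (\<Sum>k<m. of_nat p ^ k * \<tau> k)"
    by (intro sum.cong) (auto simp: \<tau>'_def)
  then have "c - (\<Sum>k<Suc m. of_nat p ^ k * \<tau>' k) = of_nat p ^ m * (c' - teich c')"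
    using c' by (simp add: \<tau>'_def algebra_simps)
  moreover have "v \<dots> \<le> pinv ^ m * pinv"
    using discrete[OF teich(2)[OF c'1]] by (intro v_mult_le) (simp_all add: v_power)
  moreover have "\<forall>k. \<tau>' k \<in> T" using \<tau>(1) teich(1)[OF c'1] by (simp add: \<tau>'_def)
  ultimately show ?case by (intro exI[of _ \<tau>']) (simp add: mult.commute)
qed

text \<open>The input format of \<open>root_sum_reduction\<close>, up to an error divisible by
  \<open>p ^ m\<close>: the part at \<open>p ^ s\<close> consists of roots of order
  \<open>p ^ s\<close>.\<close>

definition level_sum :: "nat \<Rightarrow> nat \<Rightarrow> (('n::finite \<Rightarrow> 'k) \<Rightarrow> 'k) \<Rightarrow> bool" where
  "level_sum d m \<phi> \<longleftrightarrow> (\<exists>\<psi>. (\<forall>s<m. root_sum d s (\<psi> s)) \<and> (\<forall>X\<in>TT. v (\<phi> X - (\<Sum>s<m. of_nat p ^ s * \<psi> s X)) \<le> pinv ^ m))"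

lemma level_sum_small: "(\<And>X. X \<in> TT \<Longrightarrow> v (\<phi> X) \<le> pinv ^ m) \<Longrightarrow> level_sum d m \<phi>"
  unfolding level_sum_def by (intro exI[of _ "\<lambda>_ _. 0"]) (auto intro: root_sum_0)

lemma level_sum_add: assumes "level_sum d m \<phi>" "level_sum d m \<phi>'" shows "level_sum d m (\<lambda>X. \<phi> X + \<phi>' X)"
proof -
  obtain \<psi> where \<psi>: "\<And>s. s < m \<Longrightarrow> root_sum d s (\<psi> s)" "\<And>X. X \<in> TT \<Longrightarrow> v (\<phi> X - (\<Sum>s<m. of_nat p ^ s * \<psi> s X)) \<le> pinv ^ m"
    using assms(1) unfolding level_sum_def by blast
  obtain \<psi>' where \<psi>': "\<And>s. s < m \<Longrightarrow> root_sum d s (\<psi>' s)" "\<And>X. X \<in> TT \<Longrightarrow> v (\<phi>' X - (\<Sum>s<m. of_nat p ^ s * \<psi>' s X)) \<le> pinv ^ m"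
    using assms(2) unfolding level_sum_def by blast
  have "v (\<phi> X + \<phi>' X - (\<Sum>s<m. of_nat p ^ s * (\<psi> s X + \<psi>' s X))) \<le> pinv ^ m" if "X \<in> TT" for X
    using v_add_le[OF \<psi>(2)[OF that] \<psi>'(2)[OF that]] by (simp add: distrib_left sum.distrib algebra_simps)
  then show ?thesis unfolding level_sum_def using root_sum_add \<psi>(1) \<psi>'(1) by (intro exI[of _ "\<lambda>s X. \<psi> s X + \<psi>' s X"]) blast
qed

lemma level_sum_sum: "(\<And>i. i \<in> I \<Longrightarrow> level_sum d m (\<phi> i)) \<Longrightarrow> level_sum d m (\<lambda>X. \<Sum>i\<in>I. \<phi> i X)"
  by (induction I rule: infinite_finite_induct) (auto intro: level_sum_small level_sum_add)

lemma level_sum_cong: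
  assumes "level_sum d m \<phi>" "\<And>X. X \<in> TT \<Longrightarrow> v (\<phi>' X - \<phi> X) \<le> pinv ^ m" shows "level_sum d m \<phi>'"
  using level_sum_add[OF assms(1) level_sum_small[of "\<lambda>X. \<phi>' X - \<phi> X", OF assms(2)]] by simp

lemma Teich_power_p_mod: "x \<in> T \<Longrightarrow> x ^ p ^ t = x ^ p ^ (t mod h)"
proof -
  assume x: "x \<in> T"
  have "p ^ t = p ^ (h * (t div h)) * p ^ (t mod h)" by (simp flip: power_add)
  then have "x ^ p ^ t = (x ^ p ^ (h * (t div h))) ^ p ^ (t mod h)" by (simp only: power_mult)
  then show ?thesis using Teich_power_q_power[OF x] by simp
qed

text \<open>Levels \<open>t\<close> beyond \<open>s\<close> are included because the higher
  Teichmueller digits of a coefficient move its monomial there. The bound persists since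
  \<open>t div h\<close> grows with \<open>t\<close>.\<close>

lemma root_monomial_monomial:
  assumes "\<tau> \<in> T" "(\<Sum>l\<in>UNIV. u l) \<le> d * p ^ (h * (s div h))" "s \<le> t"
  shows "root_monomial d t (\<lambda>X. \<tau> * mon u X)"
proof -
  have "(\<Sum>l\<in>UNIV. p ^ (t mod h) * u l) \<le> d * p ^ t"
  proof -
    have "(\<Sum>l\<in>UNIV. p ^ (t mod h) * u l) \<le> p ^ (t mod h) * (d * p ^ (h * (s div h)))"
      unfolding sum_distrib_left[symmetric] using assms(2) by (rule mult_le_mono2)
    also have "\<dots> = d * p ^ (h * (s div h) + t mod h)" by (simp add: power_add)
    also have "h * (s div h) + t mod h \<le> h * (t div h) + t mod h"
      using assms(3) by (intro add_right_mono mult_le_mono2 div_le_mono)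
    then have "d * p ^ (h * (s div h) + t mod h) \<le> d * p ^ t" by (intro mult_le_mono2 power_increasing) (auto simp: Suc_le_eq)
    finally show ?thesis .
  qed
  moreover have "(\<tau> * mon u X) ^ p ^ t = \<tau> ^ p ^ t * mon (\<lambda>l. p ^ (t mod h) * u l) X" if "X \<in> TT" for X
    unfolding power_mult_distrib mon_mult using Teich_power_p_mod[OF mon_Teich[OF that]] by simp
  ultimately show ?thesis unfolding root_monomial_def using assms(1) mon_Teich Teich_mult Teich_power by blast
qed

lemma level_sum_monomial:
  assumes c: "v c \<le> 1" and u: "(\<Sum>l\<in>UNIV. u l) \<le> d * p ^ (h * (s div h))"
  shows "level_sum d m (\<lambda>X. of_nat p ^ s * (c * mon u X))"
proof -
  obtain \<tau> where \<tau>: "\<And>k. \<tau> k \<in> T" "v (c - (\<Sum>k<m. of_nat p ^ k * \<tau> k)) \<le> pinv ^ m"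
    using Teich_digits[OF c] by blast
  have 1: "level_sum d m (\<lambda>X. of_nat p ^ (s + k) * (\<tau> k * mon u X))" if "k < m" for k
  proof (cases "s + k < m")
    case True
    define \<psi> :: "nat \<Rightarrow> ('a \<Rightarrow> 'k) \<Rightarrow> 'k" where "\<psi> t = (if t = s + k then (\<lambda>X. \<tau> k * mon u X) else (\<lambda>X. 0))" for t
    have "root_sum d t (\<psi> t)" for t
      using root_sum_root_monomial[OF root_monomial_monomial[OF \<tau>(1) u]] root_sum_0 by (auto simp: \<psi>_def)
    moreover have "(\<Sum>t<m. of_nat p ^ t * \<psi> t X) = of_nat p ^ (s + k) * (\<tau> k * mon u X)" for X
    proof -
      have "(\<Sum>t<m. of_nat p ^ t * \<psi> t X) = (\<Sum>t<m. if t = s + k then of_nat p ^ t * (\<tau> k * mon u X) else 0)"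
        by (intro sum.cong) (auto simp: \<psi>_def)
      then show ?thesis using True by (simp add: sum.delta)
    qed
    ultimately show ?thesis unfolding level_sum_def by (intro exI[of _ \<psi>]) auto
  next
    case False
    show ?thesis
    proof (rule level_sum_small)
      fix X :: "'a \<Rightarrow> 'k" assume X: "X \<in> TT"
      have "v (of_nat p ^ (s + k)) \<le> pinv ^ m" using False inv_p_power_mono[of m "s + k"] by (simp add: v_power)
      moreover have "v (\<tau> k * mon u X) \<le> 1" using \<tau>(1) mon_Teich[OF X] by (intro Teich_v_le Teich_mult)
      ultimately show "v (of_nat p ^ (s + k) * (\<tau> k * mon u X)) \<le> pinv ^ m" by (rule v_mult_le_1')
    qed
  qed
  show ?thesis
  proof (rule level_sum_cong[OF level_sum_sum[OF 1]])
    fix X :: "'a \<Rightarrow> 'k" assume X: "X \<in> TT"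
    have "of_nat p ^ s * (c * mon u X) - (\<Sum>k\<in>{..<m}. of_nat p ^ (s + k) * (\<tau> k * mon u X))
      = (c - (\<Sum>k<m. of_nat p ^ k * \<tau> k)) * (of_nat p ^ s * mon u X)"
      by (simp add: power_add sum_distrib_right sum_distrib_left left_diff_distrib algebra_simps)
    also have "v \<dots> \<le> pinv ^ m"
      using \<tau>(2) v_p_power_le Teich_v_le[OF mon_Teich[OF X]] by (intro v_mult_le_1' v_mult_le_1)
    finally show "v (of_nat p ^ s * (c * mon u X) - (\<Sum>k\<in>{..<m}. of_nat p ^ (s + k) * (\<tau> k * mon u X))) \<le> pinv ^ m" .
  qed auto
qed

lemma level_sum_peval:
  assumes "integral_coeffs P" "total_deg P \<le> d * p ^ (h * (s div h))"
  shows "level_sum d m (\<lambda>X. of_nat p ^ s * peval P X)"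
  unfolding peval_def mon_def[symmetric] sum_distrib_left
proof (intro level_sum_sum level_sum_monomial)
  fix w assume "w \<in> Poly_Mapping.keys P"
  then show "(\<Sum>l\<in>UNIV. lookup w l) \<le> d * p ^ (h * (s div h))"
    using total_deg_ge[of w P] assms(2) by linarith
  show "v (lookup P w) \<le> 1" using assms(1) unfolding integral_coeffs_iff by blast
qed

text \<open>The solutions are counted by summing over \<open>TT\<close> the product of the
  indicators of the \<open>m\<close> equations. In this product the degrees add up in the second
  parameter of \<open>weighted\<close>, while the first, \<open>d * p ^ (m - 1)\<close>, is the
  largest degree.\<close>

lemma v_card_level_sum:
  fixes \<phi> :: "('n::finite \<Rightarrow> 'k) \<Rightarrow> 'k"
  assumes "level_sum d m \<phi>" and m: "m \<ge> 1" and d: "d \<ge> 1"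
    and N: "\<And>b. CARD('n) \<le> d * p ^ (m - 1) * b + (\<Sum>s<m. d * p ^ s) \<Longrightarrow> N \<le> b"
  shows "v (of_nat (card {X \<in> TT. v (\<phi> X) \<le> pinv ^ m})) \<le> pinv ^ (h * N)"
proof -
  obtain \<psi> where \<psi>: "\<And>s. s < m \<Longrightarrow> root_sum d s (\<psi> s)" "\<And>X. X \<in> TT \<Longrightarrow> v (\<phi> X - (\<Sum>s<m. of_nat p ^ s * \<psi> s X)) \<le> pinv ^ m"
    using assms(1) unfolding level_sum_def by blast
  have im: "{..<m} = {..m - 1}" "Suc (m - 1) = m" using m by auto
  have "\<exists>Q. (\<forall>s\<le>m - 1. root_sum d (0 + s) (Q s)) \<and>
    (\<forall>X\<in>TT. v (\<Sum>s\<le>m - 1. of_nat p ^ s * \<psi> s X) \<le> pinv ^ Suc (m - 1) \<longleftrightarrow> (\<forall>s\<le>m - 1. v (Q s X) < 1))"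
    using \<psi>(1) m by (intro root_sum_reduction) auto
  then obtain Q where Q0: "\<forall>s\<le>m - 1. root_sum d (0 + s) (Q s)"
    "\<forall>X\<in>TT. v (\<Sum>s\<le>m - 1. of_nat p ^ s * \<psi> s X) \<le> pinv ^ Suc (m - 1) \<longleftrightarrow> (\<forall>s\<le>m - 1. v (Q s X) < 1)"
    by blast
  have lm: "s < m \<longleftrightarrow> s \<le> m - 1" for s using m by linarith
  have Q: "root_sum d s (Q s)" if "s < m" for s using Q0(1) that unfolding lm by simp
  have Q2: "v (\<Sum>s<m. of_nat p ^ s * \<psi> s X) \<le> pinv ^ m \<longleftrightarrow> (\<forall>s<m. v (Q s X) < 1)" if "X \<in> TT" for X
    using Q0(2) that unfolding im lm by blast
  define D where "D = d * p ^ (m - 1)"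
  have D: "D \<ge> 1" using d by (simp add: D_def Suc_le_eq)
  define I where "I X = (\<Prod>s<m. if v (Q s X) < 1 then 1 else 0 :: 'k)" for X
  have "weighted D (\<Sum>s<m. d * p ^ s) I"
    unfolding I_def
  proof (intro weighted_prod weighted_root_sum_indicator Q)
    fix s assume "s < m"
    then have "p ^ s \<le> p ^ (m - 1)" using p_gt_1 by (intro power_increasing) auto
    then show "d * p ^ s \<le> D" by (simp add: D_def)
  qed
  then have "v (\<Sum>X\<in>TT. I X) \<le> pinv ^ (h * N)"
    using D N unfolding D_def[symmetric] by (rule v_sum_weighted)
  also have "(\<Sum>X\<in>TT. I X) = (\<Sum>X\<in>TT. if v (\<phi> X) \<le> pinv ^ m then 1 else 0)"
  proof (intro sum.cong refl)
    fix X :: "'n \<Rightarrow> 'k" assume X: "X \<in> TT"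
    have "v (\<phi> X) \<le> pinv ^ m \<longleftrightarrow> v (\<Sum>s<m. of_nat p ^ s * \<psi> s X) \<le> pinv ^ m"
      using v_diff_le[OF _ \<psi>(2)[OF X], of "\<phi> X"] v_add_le[OF \<psi>(2)[OF X], of "\<Sum>s<m. of_nat p ^ s * \<psi> s X"] by auto
    also have "\<dots> \<longleftrightarrow> (\<forall>s<m. v (Q s X) < 1)" by (rule Q2[OF X])
    finally have e: "v (\<phi> X) \<le> pinv ^ m \<longleftrightarrow> (\<forall>s<m. v (Q s X) < 1)" .
    show "I X = (if v (\<phi> X) \<le> pinv ^ m then 1 else 0)"
      unfolding e I_def by (auto intro: prod.neutral prod_zero)
  qed
  also have "\<dots> = of_nat (card {X \<in> TT. v (\<phi> X) \<le> pinv ^ m})"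
    using sum.inter_filter[OF finite_TT, of "\<lambda>_. 1 :: 'k" "\<lambda>X. v (\<phi> X) \<le> pinv ^ m"] by simp
  finally show ?thesis .
qed

text \<open>Inserting the truncated expansions of the coordinates into the monomials of
  \<open>f\<close> and multiplying out gives one term for each choice \<open>\<beta>\<close> of
  digits. It carries the factor \<open>p ^ (i + |\<beta>|)\<close> and exactly the polynomial of the
  degree hypothesis; terms with \<open>i + |\<beta>| \<ge> m\<close> are absorbed in the
  error.\<close>

lemma level_sum_peval_box:
  fixes Y :: "('n::finite \<Rightarrow> 'k) \<Rightarrow> 'n \<Rightarrow> 'k" and g :: "nat \<Rightarrow> 'n \<Rightarrow> ('n, 'k) mpol"
    and u :: "nat \<Rightarrow> 'n \<Rightarrow>\<^sub>0 nat"
  assumes m: "m \<ge> 1"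
    and g: "\<And>i l. integral_coeffs (g i l)"
    and Y: "\<And>X l. X \<in> TT \<Longrightarrow> vsums v (\<lambda>i. peval (g i l) X * of_nat p ^ i) (Y X l)"
    and Y1: "\<And>X l. X \<in> TT \<Longrightarrow> v (Y X l) \<le> 1"
    and f: "Teich_expansion p h v f F" and inj: "inj_on u {1..r}"
    and a: "\<And>i j. j \<in> {1..r} \<Longrightarrow> a i j \<in> T"
    and F: "\<And>i. F i = (\<Sum>j=1..r. Poly_Mapping.single (u j) (a i j))"
    and deg: "\<And>i j (\<beta> :: nat \<Rightarrow> 'n \<Rightarrow> nat) b.
           i \<le> m - 1 \<Longrightarrow> j \<in> {1..r} \<Longrightarrow>
           b = (\<Sum>l\<in>UNIV. \<Sum>t=1..lookup (u j) l. \<beta> t l) \<Longrightarrow>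
           i + b \<le> m - 1 \<Longrightarrow>
           total_deg (Poly_Mapping.single 0 (a i j) *
             (\<Prod>l\<in>UNIV. \<Prod>t=1..lookup (u j) l. g (\<beta> t l) l))
           \<le> d * p ^ (h * ((i + b) div h))"
  shows "level_sum d m (\<lambda>X. peval f (Y X))"
proof -
  have lF: "lookup (F i) w = (\<Sum>j=1..r. if u j = w then a i j else 0)" for i w
    unfolding F by (simp add: lookup_sum lookup_single when_def)
  have lFu: "lookup (F i) (u j) = a i j" if j: "j \<in> {1..r}" for i j
  proof -
    have "(\<Sum>j'=1..r. if u j' = u j then a i j' else 0) = (\<Sum>j'=1..r. if j' = j then a i j else 0)"
      using inj j by (intro sum.cong refl) (auto dest: inj_onD)
    then show ?thesis unfolding lF using j sum.delta[of "{1..r}" j "\<lambda>_. a i j"] by simp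
  qed
  have fdig: "v (lookup f w - (\<Sum>i<k. of_nat p ^ i * lookup (F i) w)) \<le> pinv ^ k" for w k
  proof (rule vsums_tail)
    show "vsums v (\<lambda>i. of_nat p ^ i * lookup (F i) w) (lookup f w)"
      using f by (simp add: Teich_expansion_def)
    fix i
    have "lookup (F i) w \<in> T" using f by (simp add: Teich_expansion_def coeffs_in_def)
    then show "v (of_nat p ^ i * lookup (F i) w) \<le> pinv ^ i"
      using Teich_v_le by (intro v_mult_le_1') (auto simp: v_power)
  qed
  \<comment> \<open>A monomial outside the list has only zero digits, so its coefficient in
    \<open>f\<close> is divisible by every power of \<open>p\<close>.\<close>
  have keys: "Poly_Mapping.keys f \<subseteq> u ` {1..r}"
  proof
    fix w assume w: "w \<in> Poly_Mapping.keys f"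
    show "w \<in> u ` {1..r}"
    proof (rule ccontr)
      assume "w \<notin> u ` {1..r}"
      then have "lookup (F i) w = 0" for i unfolding lF by (intro sum.neutral) auto
      then have "v (lookup f w) \<le> pinv ^ k" for k using fdig[of w k] by simp
      then have "lookup f w = 0" by (rule tiny_zero)
      then show False using w by (metis in_keys_iff)
    qed
  qed
  have pf: "peval f X = (\<Sum>j=1..r. lookup f (u j) * mon (lookup (u j)) X)" for X
  proof -
    have "peval f X = (\<Sum>w\<in>u ` {1..r}. lookup f w * mon (lookup w) X)"
      using keys by (intro peval_superset) auto
    then show ?thesis unfolding sum.reindex[OF inj] comp_def .
  qed
  define Z where "Z X l = (\<Sum>b<m. peval (g b l) X * of_nat p ^ b)" for X l
  have YZ: "v (Y X l - Z X l) \<le> pinv ^ m" if "X \<in> TT" for X l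
    unfolding Z_def
  proof (rule vsums_tail[OF Y[OF that]])
    fix i
    show "v (peval (g i l) X * of_nat p ^ i) \<le> pinv ^ i"
      using v_peval_le[OF g TT_v_le[OF that]] by (intro v_mult_le_1) (auto simp: v_power)
  qed
  have Z1: "v (Z X l) \<le> 1" if "X \<in> TT" for X l
    unfolding Z_def using v_peval_le[OF g TT_v_le[OF that]] v_p_power_le by (intro v_sum_le v_mult_le_1) auto
  have YZ': "v (mon w (Y X) - mon w (Z X)) \<le> pinv ^ m" if X: "X \<in> TT" for X w
  proof -
    have "v (mon w (Y X) - mon w (Z X)) < pinv ^ (m - 1)"
      unfolding mon_def
    proof (rule v_cong_prod)
      fix l
      show "v (Y X l ^ w l) \<le> 1" "v (Z X l ^ w l) \<le> 1" using Y1[OF X] Z1[OF X] by (auto simp: v_power power_le_1_v)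
      show "v (Y X l ^ w l - Z X l ^ w l) < pinv ^ (m - 1)"
        using Y1[OF X] Z1[OF X] YZ[OF X] m by (intro v_cong_power) (auto simp: le_power_iff_less)
    qed (use inv_p_pos in simp)
    then show ?thesis using le_power_iff_less[OF m] by simp
  qed
  have expand: "level_sum d m (\<lambda>X. of_nat p ^ i * (a i j * mon (lookup (u j)) (Z X)))"
    if i: "i < m" and j: "j \<in> {1..r}" for i j
  proof -
    \<comment> \<open>One index for each occurrence of a variable in the monomial
      \<open>u j\<close>, matching the entries of \<open>\<beta>\<close>.\<close>
    define A where "A = (SIGMA l:(UNIV :: 'n set). {1..lookup (u j) l})"
    have finA: "finite A" unfolding A_def by auto
    define \<beta> where "\<beta> \<gamma> t l = \<gamma> (l, t)" for \<gamma> :: "'n \<times> nat \<Rightarrow> nat" and t l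
    define P where "P \<gamma> = Poly_Mapping.single 0 (a i j) *
             (\<Prod>l\<in>UNIV. \<Prod>t=1..lookup (u j) l. g (\<beta> \<gamma> t l) l)" for \<gamma>
    define b where "b \<gamma> = (\<Sum>l\<in>UNIV. \<Sum>t=1..lookup (u j) l. \<beta> \<gamma> t l)" for \<gamma>
    have P1: "integral_coeffs (P \<gamma>)" for \<gamma>
      unfolding P_def using g Teich_v_le[OF a[OF j]]
      by (intro integral_coeffs_mult integral_coeffs_prod integral_coeffs_single)
    have "level_sum d m (\<lambda>X. of_nat p ^ (i + b \<gamma>) * peval (P \<gamma>) X)" for \<gamma>
    proof (cases "i + b \<gamma> < m")
      case True
      show ?thesis
      proof (rule level_sum_peval[OF P1])
        show "total_deg (P \<gamma>) \<le> d * p ^ (h * ((i + b \<gamma>) div h))"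
          unfolding P_def using True i by (intro deg[OF _ j]) (auto simp: b_def)
      qed
    next
      case False
      show ?thesis
      proof (rule level_sum_small)
        fix X :: "'n \<Rightarrow> 'k" assume X: "X \<in> TT"
        have "v (of_nat p ^ (i + b \<gamma>)) \<le> pinv ^ m"
          using False inv_p_power_mono[of m "i + b \<gamma>"] by (simp add: v_power)
        then show "v (of_nat p ^ (i + b \<gamma>) * peval (P \<gamma>) X) \<le> pinv ^ m"
          using v_peval_le[OF P1 TT_v_le[OF X]] by (rule v_mult_le_1')
      qed
    qed
    then have "level_sum d m (\<lambda>X. \<Sum>\<gamma>\<in>A \<rightarrow>\<^sub>E {..<m}. of_nat p ^ (i + b \<gamma>) * peval (P \<gamma>) X)" by (rule level_sum_sum)
    moreover have "of_nat p ^ i * (a i j * mon (lookup (u j)) (Z X))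
        = (\<Sum>\<gamma>\<in>A \<rightarrow>\<^sub>E {..<m}. of_nat p ^ (i + b \<gamma>) * peval (P \<gamma>) X)" for X
    proof -
      have "mon (lookup (u j)) (Z X) = (\<Prod>l\<in>UNIV. \<Prod>t=1..lookup (u j) l. Z X l)"
        unfolding mon_def by simp
      also have "\<dots> = (\<Prod>(l, t)\<in>A. Z X l)" unfolding A_def by (rule prod.Sigma) auto
      also have "\<dots> = (\<Prod>lt\<in>A. \<Sum>b<m. peval (g b (fst lt)) X * of_nat p ^ b)"
        unfolding Z_def by (intro prod.cong) auto
      also have "\<dots> = (\<Sum>\<gamma>\<in>A \<rightarrow>\<^sub>E {..<m}. \<Prod>lt\<in>A. peval (g (\<gamma> lt) (fst lt)) X * of_nat p ^ \<gamma> lt)"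
        by (rule prod_sum_PiE) (auto simp: finA)
      finally have e: "mon (lookup (u j)) (Z X)
        = (\<Sum>\<gamma>\<in>A \<rightarrow>\<^sub>E {..<m}. \<Prod>lt\<in>A. peval (g (\<gamma> lt) (fst lt)) X * of_nat p ^ \<gamma> lt)" .
      have summand: "of_nat p ^ i * (a i j * (\<Prod>lt\<in>A. peval (g (\<gamma> lt) (fst lt)) X * of_nat p ^ \<gamma> lt))
        = of_nat p ^ (i + b \<gamma>) * peval (P \<gamma>) X" for \<gamma>
      proof -
        have "(\<Prod>lt\<in>A. of_nat p ^ \<gamma> lt :: 'k) = of_nat p ^ (\<Sum>lt\<in>A. \<gamma> lt)" by (rule power_sum[symmetric])
        also have "(\<Sum>lt\<in>A. \<gamma> lt) = b \<gamma>" unfolding b_def A_def \<beta>_def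
          by (subst sum.Sigma) (auto intro!: sum.cong)
        finally have 1: "(\<Prod>lt\<in>A. of_nat p ^ \<gamma> lt :: 'k) = of_nat p ^ b \<gamma>" .
        have "(\<Prod>lt\<in>A. peval (g (\<gamma> lt) (fst lt)) X) = (\<Prod>l\<in>UNIV. \<Prod>t=1..lookup (u j) l. peval (g (\<beta> \<gamma> t l) l) X)"
          unfolding A_def \<beta>_def by (subst prod.Sigma) (auto intro!: prod.cong)
        then have 2: "peval (P \<gamma>) X = a i j * (\<Prod>lt\<in>A. peval (g (\<gamma> lt) (fst lt)) X)"
          unfolding P_def peval_mult peval_prod peval_single by (simp add: zero_poly_mapping.rep_eq)
        show ?thesis unfolding prod.distrib 1 2 power_add by (simp only: ac_simps)
      qed
      show ?thesis unfolding e sum_distrib_left summand ..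
    qed
    ultimately show ?thesis by simp
  qed
  have "level_sum d m (\<lambda>X. \<Sum>j\<in>{1..r}. \<Sum>i\<in>{..<m}. of_nat p ^ i * (a i j * mon (lookup (u j)) (Z X)))"
    using expand by (intro level_sum_sum) auto
  then show ?thesis
  proof (rule level_sum_cong)
    fix X :: "'n \<Rightarrow> 'k" assume X: "X \<in> TT"
    let ?c = "\<lambda>j. \<Sum>i<m. of_nat p ^ i * a i j" and ?m = "\<lambda>j. mon (lookup (u j))"
    have "v (lookup f (u j) * ?m j (Y X) - ?c j * ?m j (Z X)) \<le> pinv ^ m"
      if j: "j \<in> {1..r}" for j
    proof -
      have fc: "v (lookup f (u j) - ?c j) \<le> pinv ^ m" using fdig[of "u j" m] lFu[OF j] by simp
      have c1: "v (?c j) \<le> 1" using v_p_power_le Teich_v_le[OF a[OF j]] by (intro v_sum_le v_mult_le_1) auto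
      have "v ((lookup f (u j) - ?c j) * ?m j (Y X)) \<le> pinv ^ m"
        using fc v_mon_le[OF Y1[OF X]] by (rule v_mult_le_1')
      moreover have "v (?c j * (?m j (Y X) - ?m j (Z X))) \<le> pinv ^ m"
        using c1 YZ'[OF X] by (rule v_mult_le_1)
      ultimately have "v ((lookup f (u j) - ?c j) * ?m j (Y X) + ?c j * (?m j (Y X) - ?m j (Z X))) \<le> pinv ^ m"
        by (rule v_add_le)
      then show ?thesis by (simp add: left_diff_distrib right_diff_distrib)
    qed
    then have "v (\<Sum>j=1..r. lookup f (u j) * ?m j (Y X) - ?c j * ?m j (Z X)) \<le> pinv ^ m"
      using inv_p_pos by (intro v_sum_le) auto
    then show "v (peval f (Y X) - (\<Sum>j\<in>{1..r}. \<Sum>i\<in>{..<m}. of_nat p ^ i * (a i j * ?m j (Z X)))) \<le> pinv ^ m"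
      unfolding pf by (simp add: sum_subtractf sum_distrib_right mult.assoc)
  qed
qed

text \<open>The box meets every residue class, which gives surjectivity; injectivity follows from
  the equal cardinalities \<open>q ^ n\<close>.\<close>

lemma box_bij_Teich:
  fixes B :: "('n::finite \<Rightarrow> 'k) set"
  assumes "is_box p h v B" shows "bij_betw (\<lambda>Y l. teich (Y l)) B TT"
proof -
  have B1: "\<And>Y l. Y \<in> B \<Longrightarrow> v (Y l) \<le> 1" and cB: "card B = q ^ CARD('n)"
    and ex: "\<And>X. (\<And>l. v (X l) \<le> 1) \<Longrightarrow> \<exists>Y\<in>B. \<forall>l. cong_pow p v 1 (Y l) (X l)"
    using assms by (auto simp: is_box_def val_ring_def)
  have finB: "finite B" using cB by (intro card_ge_0_finite) simp
  have "(\<lambda>Y l. teich (Y l)) ` B = TT"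
  proof (intro set_eqI iffI)
    fix X assume "X \<in> (\<lambda>Y l. teich (Y l)) ` B"
    then show "X \<in> TT" using teich(1) B1 by (auto simp: TT_def)
  next
    fix X :: "'n \<Rightarrow> 'k" assume X: "X \<in> TT"
    obtain Y where Y: "Y \<in> B" "\<And>l. v (Y l - X l) \<le> pinv"
      using ex[of X] TT_v_le[OF X] by (auto simp: cong_pow_iff)
    have "teich (Y l) = X l" for l
      using X le_less_trans[OF Y(2)[of l] inv_p_less_1] by (intro teich_eqI) (auto simp: TT_def)
    then have "X = (\<lambda>l. teich (Y l))" by auto
    then show "X \<in> (\<lambda>Y l. teich (Y l)) ` B" using Y(1) by blast
  qed
  moreover from this have "inj_on (\<lambda>Y l. teich (Y l)) B"
    using finB cB card_TT by (intro eq_card_imp_inj_on) auto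
  ultimately show ?thesis by (simp add: bij_betw_def)
qed

end

theorem theorem4p3:
  fixes p h m d r :: nat
    and v :: "'k::field_char_0 \<Rightarrow> real"
    and B :: "('n::finite \<Rightarrow> 'k) set"
    and g :: "nat \<Rightarrow> 'n \<Rightarrow> ('n, 'k) mpol"
    and f :: "('n, 'k) mpol"
    and F :: "nat \<Rightarrow> ('n, 'k) mpol"
    and a :: "nat \<Rightarrow> nat \<Rightarrow> 'k"
    and u :: "nat \<Rightarrow> ('n \<Rightarrow>\<^sub>0 nat)"
  assumes "unramified_extension p h v"
    and "is_box p h v B"
    and "associated_polys p h v B g"
    and "coeffs_in (val_ring v) f" and "f \<noteq> 0"
    and "m \<ge> 1" and "d \<ge> 1"
    and "Teich_expansion p h v f F"
    and "inj_on u {1..r}"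
    and "\<And>i j. j \<in> {1..r} \<Longrightarrow> a i j \<in> Teich p h v"
    and "\<And>i. F i = (\<Sum>j=1..r. Poly_Mapping.single (u j) (a i j))"
    and "\<And>i j (\<beta> :: nat \<Rightarrow> 'n \<Rightarrow> nat) b.
           i \<le> m - 1 \<Longrightarrow> j \<in> {1..r} \<Longrightarrow>
           b = (\<Sum>l\<in>UNIV. \<Sum>t=1..Poly_Mapping.lookup (u j) l. \<beta> t l) \<Longrightarrow>
           i + b \<le> m - 1 \<Longrightarrow>
           total_deg (Poly_Mapping.single 0 (a i j) *
             (\<Prod>l\<in>UNIV. \<Prod>t=1..Poly_Mapping.lookup (u j) l. g (\<beta> t l) l))
           \<le> d * p ^ (h * ((i + b) div h))"
  shows "ordq p h (card {X \<in> B. cong_pow p v m (peval f X) 0})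
    \<ge> ereal (real (ceil_star
         ((real CARD('n) - (real p ^ m - 1) / (real p - 1) * real d) / (real p ^ (m - 1) * real d))))"
proof -
  interpret unramified_extension p h v by fact
  define N where "N = ceil_star
         ((real CARD('n) - (real p ^ m - 1) / (real p - 1) * real d) / (real p ^ (m - 1) * real d))"
  define V where "V = {X \<in> B. cong_pow p v m (peval f X) 0}"
  let ?\<tau> = "\<lambda>(Y :: 'n \<Rightarrow> 'k) l. teich (Y l)"
  have bij: "bij_betw ?\<tau> B TT" by (rule box_bij_Teich) fact
  \<comment> \<open>\<open>Y X\<close> is the point of the box above the residue class of
    \<open>X\<close>, so counting in the box becomes counting in \<open>TT\<close>.\<close>
  define Y where "Y = the_inv_into B ?\<tau>"
  have YB: "Y X \<in> B" and \<tau>Y: "?\<tau> (Y X) = X" if "X \<in> TT" for X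
    using that bij the_inv_into_into[of ?\<tau> B X B] f_the_inv_into_f[of ?\<tau> B X] by (auto simp: Y_def bij_betw_def)
  have bijY: "bij_betw Y TT B" unfolding Y_def using bij by (rule bij_betw_the_inv_into)
  have Y1: "v (Y X l) \<le> 1" if "X \<in> TT" for X l
    using YB[OF that] assms(2) by (simp add: is_box_def val_ring_def)
  have g: "integral_coeffs (g i l)" for i l
  proof (cases i)
    case 0
    then have "g i l = pvar l" using assms(3) by (simp add: associated_polys_def)
    then show ?thesis by (simp add: pvar_def integral_coeffs_single)
  next
    case (Suc i')
    then have "coeffs_in T (g i l)" using assms(3) by (simp add: associated_polys_def)
    then show ?thesis by (rule integral_coeffs_Teich)
  qed
  have vs: "vsums v (\<lambda>i. peval (g i l) X * of_nat p ^ i) (Y X l)" if X: "X \<in> TT" for X l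
  proof -
    have "X l \<in> T \<and> cong_pow p v 1 (X l) (Y X l)" for l
    proof -
      have "v (Y X l - teich (Y X l)) \<le> pinv" using teich(2)[OF Y1[OF X]] by (rule discrete)
      then have "v (Y X l - X l) \<le> pinv" using fun_cong[OF \<tau>Y[OF X], of l] by simp
      then show ?thesis using X by (simp add: TT_def cong_pow_iff v_diff_commute)
    qed
    then show ?thesis using assms(3) YB[OF X] unfolding associated_polys_def by blast
  qed
  have level_sum: "level_sum d m (\<lambda>X. peval f (Y X))"
    by (rule level_sum_peval_box[OF \<open>m \<ge> 1\<close> g vs Y1 assms(8-12)])
  have "v (of_nat (card {X \<in> TT. v (peval f (Y X)) \<le> pinv ^ m})) \<le> pinv ^ (h * N)"
  proof (rule v_card_level_sum[OF level_sum \<open>m \<ge> 1\<close> \<open>d \<ge> 1\<close>])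
    fix b assume b: "CARD('n) \<le> d * p ^ (m - 1) * b + (\<Sum>s<m. d * p ^ s)"
    \<comment> \<open>The geometric series identifies the sum of the degrees with the term
      subtracted in the bound; the rest unfolds the ceiling.\<close>
    have "real p - 1 \<noteq> 0" using p_gt_1 by simp
    then have "(\<Sum>s<m. real p ^ s) = (real p ^ m - 1) / (real p - 1)"
      using power_diff_1_eq[of "real p" m] by (simp add: field_simps)
    then have "real (\<Sum>s<m. d * p ^ s) = (real p ^ m - 1) / (real p - 1) * real d"
      by (simp add: sum_distrib_left[symmetric])
    moreover have "real CARD('n) \<le> real (d * p ^ (m - 1) * b + (\<Sum>s<m. d * p ^ s))" using b by (rule of_nat_mono)
    ultimately have "real CARD('n) - (real p ^ m - 1) / (real p - 1) * real d \<le> real b * (real p ^ (m - 1) * real d)"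
      by (simp add: algebra_simps)
    moreover have "real p ^ (m - 1) * real d > 0" using \<open>d \<ge> 1\<close> p_gt_1 by simp
    ultimately show "N \<le> b" unfolding N_def ceil_star_def by (intro Least_le) (simp add: pos_divide_le_eq)
  qed
  moreover have "card {X \<in> TT. v (peval f (Y X)) \<le> pinv ^ m} = card V"
  proof (rule bij_betw_same_card)
    show "bij_betw Y {X \<in> TT. v (peval f (Y X)) \<le> pinv ^ m} V"
      using bijY by (rule bij_betw_subset) (use bijY in \<open>auto simp: V_def cong_pow_iff bij_betw_def\<close>)
  qed
  ultimately have vV: "v (of_nat (card V)) \<le> pinv ^ (h * N)" by simp
  \<comment> \<open>An empty solution set has valuation infinity by definition of
    \<open>ordq\<close>; otherwise \<open>v\<close> of the cardinality determines its multiplicity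
    of \<open>p\<close>.\<close>
  have "ereal (real N) \<le> ordq p h (card V)"
  proof (cases "card V = 0")
    case False
    have "h * N \<le> multiplicity p (card V)"
    proof (rule ccontr)
      assume "\<not> ?thesis"
      then have "pinv ^ (h * N) < pinv ^ multiplicity p (card V)"
        using inv_p_pos inv_p_less_1 by (intro power_strict_decreasing) auto
      then show False using vV v_of_nat[OF False] by simp
    qed
    then have "real N * real h \<le> real (multiplicity p (card V))" by (metis mult.commute of_nat_le_iff of_nat_mult)
    then show ?thesis using False h_pos by (simp add: ordq_def pos_le_divide_eq)
  qed (simp add: ordq_def)
  then show ?thesis unfolding V_def N_def .
qed

end
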